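(* Let $n,m\ge2$ and $\alpha\in\mathbb{N}_0$. The following orthogonal (Hilbert space) decomposition holds: $$L^2(\Omega,d\Omega)=\bigoplus_{k=0}^{\infty}\mathcal{H}_k^\alpha.$$
   Context: $\mathbb{N}_0=\{0,1,2,\dots\}$. Points of $\mathbb{R}^{n+m}$ are $(x,y)$, $x\in\mathbb{R}^n$, $y\in\mathbb{R}^m$. Polar coordinates $(\rho,\phi,\omega_1,\omega_2)$: $\rho=\left(|x|^{2(\alpha+1)}+(\alpha+1)^2|y|^2\right)^{\frac{1}{2(\alpha+1)}}$, $\phi\in[0,\pi/2]$ with $|x|=\rho\sin^{\frac1{\alpha+1}}\phi$, $|y|=\frac{1}{\alpha+1}\rho^{\alpha+1}\cos\phi$, $\omega_1=x/|x|\in\mathbb{S}^{n-1}$, $\omega_2=y/|y|\in\mathbb{S}^{m-1}$. $\Omega=\{\rho=1\}$ is equipped with the measure $d\Omega=\sin^{\frac{n-2}{\alpha+1}+1}\phi\,\cos^{m-1}\phi\,d\phi\,d\omega_1\,d\omega_2$, $d\omega_1,d\omega_2$ being the Lebesgue surface measures on the spheres. Let $\{Y_{\ell,p}\}_{1\le p\le d_\ell(n)}$ be an orthonormal basis of the spherical harmonics of degree $\ell$ on $\mathbb{S}^{n-1}$ ($d_\ell(n)$ the dimension of that space), and similarly $\{Y_{j,q}\}_{1\le q\le d_j(m)}$ on $\mathbb{S}^{m-1}$. With $P_N^{(a,b)}$ the Jacobi polynomials, put $\widetilde{k}=\frac{k-\ell-j(\alpha+1)}{2(\alpha+1)}$,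 $\mu=\frac{n-2+2\ell}{2(\alpha+1)}$, $\gamma=j+\frac m2$ and $h_{k,\ell,j}(\phi)=\cos^j\phi\,\sin^{\frac{\ell}{\alpha+1}}\phi\,P_{\widetilde k}^{(\mu,\gamma-1)}(\cos2\phi)$. Then $\mathcal{H}_k^\alpha$ is the span of the functions $\rho^kh_{k,\ell,j}(\phi)Y_{\ell,p}(\omega_1)Y_{j,q}(\omega_2)$ over all $0\le\ell,j\le k$ with $\widetilde k\in\mathbb{N}_0$ and all $1\le p\le d_\ell(n)$, $1\le q\le d_j(m)$. In $L^2(\Omega,d\Omega)$ the elements of $\mathcal{H}_k^\alpha$ are identified with their restrictions to $\Omega$. *)

theory Defs
  imports "HOL-Analysis.Analysis" "HOL-Library.Function_Algebras"
begin

subsection \<open>Complex vector spaces of functions\<close>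

abbreviation cfun_scale :: "complex \<Rightarrow> ('a \<Rightarrow> complex) \<Rightarrow> 'a \<Rightarrow> complex" where
  "cfun_scale \<equiv> (\<lambda>c f x. c * f x)"

lemma vector_space_cfun_scale: "vector_space cfun_scale"
  by unfold_locales (auto simp: algebra_simps fun_eq_iff)

definition cspan :: "('a \<Rightarrow> complex) set \<Rightarrow> ('a \<Rightarrow> complex) set" where
  "cspan = module.span cfun_scale"

definition csubspace :: "('a \<Rightarrow> complex) set \<Rightarrow> bool" where
  "csubspace = module.subspace cfun_scale"

definition cdim :: "('a \<Rightarrow> complex) set \<Rightarrow> nat" where
  "cdim = vector_space.dim cfun_scale"


subsection \<open>Square-integrable functions and orthogonal Hilbert sums\<close>

text \<open>
  The elements of $L^2(M)$ are represented by functions; two functions represent the same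
  element iff they agree almost everywhere on \<open>space M\<close>. Values outside \<open>space M\<close> never matter,
  so a function is thereby identified with its restriction to \<open>space M\<close>.
\<close>

definition L2 :: "'a measure \<Rightarrow> ('a \<Rightarrow> complex) set" where
  "L2 M = {f \<in> borel_measurable M. integrable M (\<lambda>x. (cmod (f x))\<^sup>2)}"

definition L2_inner :: "'a measure \<Rightarrow> ('a \<Rightarrow> complex) \<Rightarrow> ('a \<Rightarrow> complex) \<Rightarrow> complex" where
  "L2_inner M f g = (LINT x|M. f x * cnj (g x))"

definition L2_norm :: "'a measure \<Rightarrow> ('a \<Rightarrow> complex) \<Rightarrow> real" where
  "L2_norm M f = sqrt (LINT x|M. (cmod (f x))\<^sup>2)"

definition L2_closed :: "'a measure \<Rightarrow> ('a \<Rightarrow> complex) set \<Rightarrow> bool" where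
  "L2_closed M V \<longleftrightarrow>
     (\<forall>f \<in> L2 M. (\<forall>e>0. \<exists>g\<in>V. L2_norm M (\<lambda>x. f x - g x) < e)
        \<longrightarrow> (\<exists>g\<in>V. AE x in M. f x = g x))"

text \<open>
  $L^2(M) = \bigoplus_k V_k$: the $V_k$ are closed, pairwise orthogonal subspaces, and every
  element of $L^2(M)$ is a norm-convergent sum of elements of the $V_k$. (Almost everywhere
  uniqueness of the summands is a consequence of the orthogonality.)
\<close>

definition L2_orthogonal_sum :: "'a measure \<Rightarrow> (nat \<Rightarrow> ('a \<Rightarrow> complex) set) \<Rightarrow> bool" where
  "L2_orthogonal_sum M V \<longleftrightarrow>
     (\<forall>k. V k \<subseteq> L2 M \<and> csubspace (V k) \<and> L2_closed M (V k)) \<and>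
     (\<forall>k k'. k \<noteq> k' \<longrightarrow> (\<forall>f \<in> V k. \<forall>g \<in> V k'. L2_inner M f g = 0)) \<and>
     (\<forall>f \<in> L2 M. \<exists>u. (\<forall>k. u k \<in> V k) \<and>
        (\<lambda>K. L2_norm M (\<lambda>x. f x - (\<Sum>k<K. u k x))) \<longlonglongrightarrow> 0)"


subsection \<open>Surface measure and spherical harmonics\<close>

text \<open>
  Surface measure on the unit sphere, as the cone measure: the measure of $A$ is the dimension
  times the Lebesgue measure of $\{r x \mid 0 < r \le 1,\ x \in A\}$. Note that
  \<open>sgn x = x /\<^sub>R norm x\<close>.
\<close>

definition sphere_measure :: "'a::euclidean_space measure" where
  "sphere_measure =
     scale_measure (of_nat DIM('a))
       (distr (restrict_space lborel (cball 0 1 - {0})) (restrict_space borel (sphere 0 1)) sgn)"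

definition partial_deriv :: "'a \<Rightarrow> ('a::euclidean_space \<Rightarrow> complex) \<Rightarrow> 'a \<Rightarrow> complex" where
  "partial_deriv b f x = frechet_derivative f (at x) b"

definition laplacian :: "('a::euclidean_space \<Rightarrow> complex) \<Rightarrow> 'a \<Rightarrow> complex" where
  "laplacian f x = (\<Sum>b\<in>Basis. partial_deriv b (partial_deriv b f) x)"

definition solid_harmonics :: "nat \<Rightarrow> ('a::euclidean_space \<Rightarrow> complex) set" where
  "solid_harmonics l =
     {P. polynomial_function P \<and>
         (\<forall>(t::real) x. P (t *\<^sub>R x) = of_real t ^ l * P x) \<and>
         (\<forall>x. laplacian P x = 0)}"

text \<open>
  Functions on the unit sphere are represented by their extensions by zero. In particular all
  spherical harmonics vanish at the origin, also those of degree zero.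
\<close>

definition spherical_harmonics :: "nat \<Rightarrow> ('a::euclidean_space \<Rightarrow> complex) set" where
  "spherical_harmonics l =
     (\<lambda>P x. if x \<in> sphere 0 1 then P x else 0) ` solid_harmonics l"

definition harmonic_dim :: "'a::euclidean_space itself \<Rightarrow> nat \<Rightarrow> nat" where
  "harmonic_dim _ l = cdim (spherical_harmonics l :: ('a \<Rightarrow> complex) set)"

definition harmonic_orthonormal_basis :: "nat \<Rightarrow> (nat \<Rightarrow> 'a::euclidean_space \<Rightarrow> complex) \<Rightarrow> bool" where
  "harmonic_orthonormal_basis l e \<longleftrightarrow>
     (let I = {1..harmonic_dim TYPE('a) l} in
       (\<forall>p\<in>I. \<forall>q\<in>I. L2_inner sphere_measure (e p) (e q) = (if p = q then 1 else 0)) \<and>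
       cspan (e ` I) = spherical_harmonics l)"


subsection \<open>Jacobi polynomials\<close>

text \<open>
  $P_N^{(a,b)}(z) = \sum_{s=0}^N \binom{N+a}{N-s}\binom{N+b}{s}
    \bigl(\frac{z-1}{2}\bigr)^s \bigl(\frac{z+1}{2}\bigr)^{N-s}$, the standard normalisation.
\<close>

definition jacobi_poly :: "nat \<Rightarrow> real \<Rightarrow> real \<Rightarrow> real \<Rightarrow> real" where
  "jacobi_poly N a b z =
     (\<Sum>s\<le>N. ((real N + a) gchoose (N - s)) * ((real N + b) gchoose s)
              * ((z - 1) / 2) ^ s * ((z + 1) / 2) ^ (N - s))"


subsection \<open>Polar coordinates and the measure on the unit gauge sphere\<close>

definition grushin_gauge :: "nat \<Rightarrow> 'a::euclidean_space \<times> 'b::euclidean_space \<Rightarrow> real" where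
  "grushin_gauge \<alpha> = (\<lambda>(x, y).
     root (2 * (\<alpha> + 1)) (norm x ^ (2 * (\<alpha> + 1)) + (real \<alpha> + 1)\<^sup>2 * (norm y)\<^sup>2))"

text \<open>The angle is uniquely determined by these conditions except at the origin.\<close>

definition polar_angle :: "nat \<Rightarrow> 'a::euclidean_space \<times> 'b::euclidean_space \<Rightarrow> real" where
  "polar_angle \<alpha> = (\<lambda>(x, y). THE \<phi>. \<phi> \<in> {0..pi/2} \<and>
     norm x = grushin_gauge \<alpha> (x, y) * root (\<alpha> + 1) (sin \<phi>) \<and>
     norm y = 1 / (real \<alpha> + 1) * grushin_gauge \<alpha> (x, y) ^ (\<alpha> + 1) * cos \<phi>)"

definition gauge_sphere :: "nat \<Rightarrow> ('a::euclidean_space \<times> 'b::euclidean_space) set" where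
  "gauge_sphere \<alpha> = {z. grushin_gauge \<alpha> z = 1}"

definition angle_measure :: "nat \<Rightarrow> nat \<Rightarrow> nat \<Rightarrow> real measure" where
  "angle_measure \<alpha> n m =
     density (restrict_space lborel {0..pi/2})
       (\<lambda>\<phi>. ennreal (sin \<phi> powr ((real n - 2) / (real \<alpha> + 1) + 1) * cos \<phi> ^ (m - 1)))"

definition gauge_sphere_param ::
  "nat \<Rightarrow> real \<times> 'a \<times> 'b \<Rightarrow> 'a::euclidean_space \<times> 'b::euclidean_space" where
  "gauge_sphere_param \<alpha> = (\<lambda>(\<phi>, \<omega>1, \<omega>2).
     (root (\<alpha> + 1) (sin \<phi>) *\<^sub>R \<omega>1, (1 / (real \<alpha> + 1) * cos \<phi>) *\<^sub>R \<omega>2))"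

definition gauge_sphere_measure :: "nat \<Rightarrow> ('a::euclidean_space \<times> 'b::euclidean_space) measure" where
  "gauge_sphere_measure \<alpha> =
     distr (angle_measure \<alpha> DIM('a) DIM('b) \<Otimes>\<^sub>M (sphere_measure \<Otimes>\<^sub>M sphere_measure))
       (restrict_space borel (gauge_sphere \<alpha>)) (gauge_sphere_param \<alpha>)"

text \<open>The two push-forwards are taken along measurable maps.\<close>

lemma sgn_measurable_sphere:
  "(sgn :: 'a::euclidean_space \<Rightarrow> 'a)
     \<in> measurable (restrict_space lborel (cball 0 1 - {0})) (restrict_space borel (sphere 0 1))"
proof (rule measurable_restrict_space2)
  show "(sgn :: 'a \<Rightarrow> 'a) \<in> space (restrict_space lborel (cball 0 1 - {0})) \<rightarrow> sphere 0 1"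
    by (auto simp: space_restrict_space norm_sgn)
  show "(sgn :: 'a \<Rightarrow> 'a) \<in> measurable (restrict_space lborel (cball 0 1 - {0})) borel"
    unfolding sgn_div_norm by (intro measurable_restrict_space1) measurable
qed

lemma gauge_sphere_param_measurable:
  "(gauge_sphere_param \<alpha> :: real \<times> 'a::euclidean_space \<times> 'b::euclidean_space \<Rightarrow> 'a \<times> 'b)
     \<in> measurable (angle_measure \<alpha> n m \<Otimes>\<^sub>M (sphere_measure \<Otimes>\<^sub>M sphere_measure))
         (restrict_space borel (gauge_sphere \<alpha>))"
proof (rule measurable_restrict_space2)
  let ?M = "angle_measure \<alpha> n m \<Otimes>\<^sub>M
      ((sphere_measure :: 'a measure) \<Otimes>\<^sub>M (sphere_measure :: 'b measure))"
  have on_sphere: "grushin_gauge \<alpha> (gauge_sphere_param \<alpha> (\<phi>, \<omega>1, \<omega>2)) = 1"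
    if "\<phi> \<in> {0..pi/2}" "norm \<omega>1 = 1" "norm \<omega>2 = 1" for \<phi> and \<omega>1 :: 'a and \<omega>2 :: 'b
  proof -
    have s: "sin \<phi> \<ge> 0" and c: "cos \<phi> \<ge> 0"
      using that by (auto intro: sin_ge_zero cos_ge_zero)
    have "root (\<alpha> + 1) (sin \<phi>) ^ (2 * (\<alpha> + 1)) = (sin \<phi>)\<^sup>2"
      using s by (subst mult.commute, subst power_mult) (simp add: real_root_pow_pos2 del: power_Suc)
    moreover have "(real \<alpha> + 1)\<^sup>2 * (1 / (real \<alpha> + 1) * cos \<phi>)\<^sup>2 = (cos \<phi>)\<^sup>2"
      by (simp flip: power_mult_distrib)
    ultimately show ?thesis
      using that s c
      by (simp add: grushin_gauge_def gauge_sphere_param_def abs_mult power_mult_distrib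
          real_root_ge_zero del: mult_Suc_right power_Suc)
  qed
  show "(gauge_sphere_param \<alpha> :: _ \<Rightarrow> 'a \<times> 'b) \<in> space ?M \<rightarrow> gauge_sphere \<alpha>"
    using on_sphere
    by (auto simp: gauge_sphere_def space_pair_measure angle_measure_def sphere_measure_def
        space_scale_measure space_restrict_space)
  have [measurable]: "fst \<in> borel_measurable ?M" 
    by (rule measurable_compose[OF measurable_fst])
       (simp add: angle_measure_def measurable_restrict_space1)
  have id_sphere: "(\<lambda>x. x) \<in> borel_measurable (sphere_measure :: 'c::euclidean_space measure)"
    by (subst measurable_cong_sets[of _ "restrict_space borel (sphere 0 1)" borel borel])
       (simp_all add: sphere_measure_def measurable_restrict_space1)
  have [measurable]: "(\<lambda>z. fst (snd z)) \<in> borel_measurable ?M"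
    "(\<lambda>z. snd (snd z)) \<in> borel_measurable ?M"
    using measurable_compose[OF measurable_compose[OF measurable_snd measurable_fst] id_sphere]
      measurable_compose[OF measurable_compose[OF measurable_snd measurable_snd] id_sphere]
    by auto
  have [measurable]: "root (\<alpha> + 1) \<in> borel_measurable borel"
    by (intro borel_measurable_continuous_onI continuous_intros)
  show "(gauge_sphere_param \<alpha> :: _ \<Rightarrow> 'a \<times> 'b) \<in> borel_measurable ?M"
    unfolding gauge_sphere_param_def case_prod_beta by measurable
qed


subsection \<open>The spaces of Grushin harmonics\<close>

definition jacobi_index :: "nat \<Rightarrow> nat \<Rightarrow> nat \<Rightarrow> nat \<Rightarrow> real" where
  "jacobi_index \<alpha> k l j =
     (real k - real l - real j * (real \<alpha> + 1)) / (2 * (real \<alpha> + 1))"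

text \<open>
  \<open>root (\<alpha> + 1) (sin \<phi>) ^ l\<close> is $\sin^{l/(\alpha+1)}\phi$ with the convention $0^0 = 1$, which
  \<open>powr\<close> does not follow. The argument \<open>N\<close> stands for \<open>jacobi_index \<alpha> k l j\<close>, when that
  is a natural number.
\<close>

definition angular_part ::
  "nat \<Rightarrow> nat \<Rightarrow> nat \<Rightarrow> nat \<Rightarrow> nat \<Rightarrow> nat \<Rightarrow> real \<Rightarrow> real" where
  "angular_part \<alpha> n m N l j \<phi> =
     (let \<mu> = (real n - 2 + 2 * real l) / (2 * (real \<alpha> + 1));
          \<gamma> = real j + real m / 2
      in cos \<phi> ^ j * root (\<alpha> + 1) (sin \<phi>) ^ l * jacobi_poly N \<mu> (\<gamma> - 1) (cos (2 * \<phi>)))"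

text \<open>
  Polar coordinates are undefined where \<open>x = 0\<close> or \<open>y = 0\<close>; there \<open>sgn\<close> yields 0 and the functions
  below vanish. On the gauge sphere this is a null set.
\<close>

definition grushin_harmonic ::
  "nat \<Rightarrow> nat \<Rightarrow> nat \<Rightarrow> nat \<Rightarrow> nat \<Rightarrow> ('a \<Rightarrow> complex) \<Rightarrow> ('b \<Rightarrow> complex) \<Rightarrow>
   'a::euclidean_space \<times> 'b::euclidean_space \<Rightarrow> complex" where
  "grushin_harmonic \<alpha> k N l j Yl Zj = (\<lambda>(x, y).
     of_real (grushin_gauge \<alpha> (x, y) ^ k * angular_part \<alpha> DIM('a) DIM('b) N l j (polar_angle \<alpha> (x, y)))
       * Yl (sgn x) * Zj (sgn y))"

definition grushin_harmonics ::
  "nat \<Rightarrow> (nat \<Rightarrow> nat \<Rightarrow> 'a \<Rightarrow> complex) \<Rightarrow> (nat \<Rightarrow> nat \<Rightarrow> 'b \<Rightarrow> complex) \<Rightarrow> nat \<Rightarrow>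
   ('a::euclidean_space \<times> 'b::euclidean_space \<Rightarrow> complex) set" where
  "grushin_harmonics \<alpha> Y Z k =
     cspan {grushin_harmonic \<alpha> k N l j (Y l p) (Z j q) | N l j p q.
              l \<le> k \<and> j \<le> k \<and> jacobi_index \<alpha> k l j = real N \<and>
              p \<in> {1..harmonic_dim TYPE('a) l} \<and> q \<in> {1..harmonic_dim TYPE('b) j}}"

end

theory Submission
  imports Defs
begin

text \<open>
  On the gauge sphere \<open>|x|^(2(\<alpha>+1)) + (\<alpha>+1)^2 |y|^2 = 1\<close> the generators of all the $\mathcal{H}_k^\alpha$
  together span the functions $p(|x|^{2(\alpha+1)}) H(x) G(y)$, where $p$ is a polynomial and $H$, $G$ are
  solid harmonics. Since $t \mapsto t^{1/(\alpha+1)}$ is continuous, Weierstrass' theorem puts all functions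
  $|x|^{2i} |y|^{2i'} H(x) G(y)$ into the closure of this span, hence all polynomials, because
  $x_b H = H_1 + |x|^2 H_2$ with $H_1$, $H_2$ harmonic. So the span is dense by Stone-Weierstrass.

  Orthogonality reduces by Fubini to the three factors. For the spheres, rotation invariance gives
  $\int x_i \partial_j F = \int x_j \partial_i F$, hence
  $\int \partial_j F = (n + d - 1) \int x_j F$ for $F$ homogeneous of degree $d$; applied to
  $\sum_j \partial_j (P \partial_j Q)$ and with $P$, $Q$ exchanged, this yields
  $(l - l')(n + l + l' - 2) \int P Q = 0$. For the Jacobi polynomials, the moments are Beta integrals
  whose alternating sum is an $N$-th finite difference of a polynomial of lower degree.
\<close>

subsection \<open>Orthogonal decompositions of $L^2$\<close>

text \<open>On the gauge sphere the radius is 1, so the degree k no longer shows in the functions;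
  it survives only through k = l + (\<alpha> + 1) (j + 2 N). The claim therefore amounts to
  orthogonality and totality of one family indexed by (N, l, j, p, q): two members of different
  degree differ in l, in j or in N, and every triple (N, l, j) occurs in exactly one degree, with l,
  j <= k automatically. The obstacle to density is |x|^2. Put u = |x|^(2(\<alpha> + 1)) = sin^2 phi.
  The radial factors are polynomials in u, and so is |y|^2 = (1 - u) / (\<alpha> + 1)^2 on the gauge
  sphere, but |x|^2 = u^(1/(\<alpha> + 1)) is not if \<alpha> > 0. So the span itself misses some
  polynomials in (x, y), and the argument has to run in its L2 closure. The same u explains the
  exponents of the measure: together with the factors sin^(2l/(\<alpha> + 1)) phi and cos^(2j) phi
  of two harmonics, the angular density becomes half the Jacobi weight u^mu (1 - u)^(gamma - 1). The
  assumption n, m >= 2 makes mu and gamma - 1 nonnegative.\<close>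

context
begin

interpretation cfun: vector_space cfun_scale
  by (rule vector_space_cfun_scale)

lemma csubspace_cspan: "csubspace (cspan S)"
  by (simp add: csubspace_def cspan_def cfun.subspace_span)

lemma cspan_base: "f \<in> S \<Longrightarrow> f \<in> cspan S"
  by (simp add: cspan_def cfun.span_base)

lemma cspan_mono: "S \<subseteq> T \<Longrightarrow> cspan S \<subseteq> cspan T"
  by (simp add: cspan_def cfun.span_mono)

lemma csubspace_0: "csubspace V \<Longrightarrow> (\<lambda>x. 0) \<in> V"
  using cfun.subspace_0[of V] by (simp add: csubspace_def zero_fun_def)

lemma csubspace_add: "csubspace V \<Longrightarrow> f \<in> V \<Longrightarrow> g \<in> V \<Longrightarrow> (\<lambda>x. f x + g x) \<in> V"
  using cfun.subspace_add[of V f g] by (simp add: csubspace_def plus_fun_def)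

lemma csubspace_scale: "csubspace V \<Longrightarrow> f \<in> V \<Longrightarrow> (\<lambda>x. c * f x) \<in> V"
  using cfun.subspace_scale[of V f c] by (simp add: csubspace_def)

lemma csubspace_sum:
  "csubspace V \<Longrightarrow> (\<And>i. i \<in> I \<Longrightarrow> f i \<in> V) \<Longrightarrow> (\<lambda>x. \<Sum>i\<in>I. f i x) \<in> V"
  by (induction I rule: infinite_finite_induct) (auto intro: csubspace_0 csubspace_add)

lemma csubspaceI:
  assumes "(\<lambda>x. 0) \<in> V" "\<And>f g. f \<in> V \<Longrightarrow> g \<in> V \<Longrightarrow> (\<lambda>x. f x + g x) \<in> V"
    "\<And>c f. f \<in> V \<Longrightarrow> (\<lambda>x. c * f x) \<in> V"
  shows "csubspace V"
  using assms unfolding csubspace_def by (intro cfun.subspaceI) (auto simp: zero_fun_def plus_fun_def)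

lemma cspan_minimal: "S \<subseteq> V \<Longrightarrow> csubspace V \<Longrightarrow> cspan S \<subseteq> V"
  by (simp add: cspan_def csubspace_def cfun.span_minimal)

end

lemma cspan_image_finite:
  assumes "finite J" "h \<in> cspan (G ` J)"
  obtains c where "h = (\<lambda>x. \<Sum>i\<in>J. c i * G i x)"
proof -
  have "cspan (G ` J) \<subseteq> {h. \<exists>c. h = (\<lambda>x. \<Sum>i\<in>J. c i * G i x)}"
  proof (intro cspan_minimal csubspaceI)
    show "G ` J \<subseteq> {h. \<exists>c. h = (\<lambda>x. \<Sum>i\<in>J. c i * G i x)}"
    proof safe
      fix i assume "i \<in> J"
      then show "\<exists>c. G i = (\<lambda>x. \<Sum>j\<in>J. c j * G j x)"
        using assms(1) by (intro exI[of _ "\<lambda>j. if j = i then 1 else 0"]) (simp add: if_distrib[of "\<lambda>c. c * _"] cong: if_cong)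
    qed
    show "(\<lambda>x. 0) \<in> {h. \<exists>c. h = (\<lambda>x. \<Sum>i\<in>J. c i * G i x)}"
      by (auto intro: exI[of _ "\<lambda>_. 0"])
    fix f g assume "f \<in> {h. \<exists>c. h = (\<lambda>x. \<Sum>i\<in>J. c i * G i x)}" "g \<in> {h. \<exists>c. h = (\<lambda>x. \<Sum>i\<in>J. c i * G i x)}"
    then obtain c d where "f = (\<lambda>x. \<Sum>i\<in>J. c i * G i x)" "g = (\<lambda>x. \<Sum>i\<in>J. d i * G i x)"
      by blast
    then show "(\<lambda>x. f x + g x) \<in> {h. \<exists>c. h = (\<lambda>x. \<Sum>i\<in>J. c i * G i x)}"
      by (auto intro!: exI[of _ "\<lambda>i. c i + d i"] simp: sum.distrib distrib_right)
  next
    fix a f assume "f \<in> {h. \<exists>c. h = (\<lambda>x. \<Sum>i\<in>J. c i * G i x)}"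
    then obtain c where "f = (\<lambda>x. \<Sum>i\<in>J. c i * G i x)"
      by blast
    then show "(\<lambda>x. a * f x) \<in> {h. \<exists>c. h = (\<lambda>x. \<Sum>i\<in>J. c i * G i x)}"
      by (auto intro!: exI[of _ "\<lambda>i. a * c i"] simp: sum_distrib_left mult_ac)
  qed
  with assms(2) that show ?thesis
    by blast
qed

lemma L2_measurable: "f \<in> L2 M \<Longrightarrow> f \<in> borel_measurable M"
  by (simp add: L2_def)

lemma L2_integrable: "f \<in> L2 M \<Longrightarrow> integrable M (\<lambda>x. (cmod (f x))\<^sup>2)"
  by (simp add: L2_def)

lemma cmod_add_sq_le: "(cmod (a + b))\<^sup>2 \<le> 2 * (cmod a)\<^sup>2 + 2 * (cmod b)\<^sup>2"
proof -
  have "(cmod (a + b))\<^sup>2 \<le> (cmod a + cmod b)\<^sup>2"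
    by (intro power_mono norm_triangle_ineq) simp
  also have "\<dots> \<le> 2 * (cmod a)\<^sup>2 + 2 * (cmod b)\<^sup>2"
    using zero_le_power2[of "cmod a - cmod b"] by (simp add: power2_eq_square algebra_simps)
  finally show ?thesis .
qed

lemma csubspace_L2: "csubspace (L2 M)"
proof (rule csubspaceI)
  fix f g assume fg: "f \<in> L2 M" "g \<in> L2 M"
  note [measurable] = fg[THEN L2_measurable]
  have "integrable M (\<lambda>x. (cmod (f x + g x))\<^sup>2)"
  proof (rule Bochner_Integration.integrable_bound)
    show "integrable M (\<lambda>x. 2 * (cmod (f x))\<^sup>2 + 2 * (cmod (g x))\<^sup>2)"
      using fg[THEN L2_integrable] by auto
  qed (auto simp: cmod_add_sq_le)
  then show "(\<lambda>x. f x + g x) \<in> L2 M"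
    by (simp add: L2_def)
qed (auto simp: L2_def norm_mult power_mult_distrib)

lemma L2_diff: "f \<in> L2 M \<Longrightarrow> g \<in> L2 M \<Longrightarrow> (\<lambda>x. f x - g x) \<in> L2 M"
  using csubspace_add[OF csubspace_L2, of f M "\<lambda>x. -1 * g x"] csubspace_scale[OF csubspace_L2, of g M "-1"]
  by simp

lemma (in finite_measure) bounded_in_L2:
  assumes "f \<in> borel_measurable M" "\<And>x. x \<in> space M \<Longrightarrow> cmod (f x) \<le> B"
  shows "f \<in> L2 M"
proof -
  have "integrable M (\<lambda>x. (cmod (f x))\<^sup>2)"
    using assms by (intro integrable_const_bound[of _ "B\<^sup>2"]) (auto intro!: AE_I2 power_mono)
  with assms show ?thesis
    by (simp add: L2_def)
qed

lemma L2_inner_integrable: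
  assumes "f \<in> L2 M" "g \<in> L2 M"
  shows "integrable M (\<lambda>x. f x * cnj (g x))"
proof (rule Bochner_Integration.integrable_bound)
  note [measurable] = assms[THEN L2_measurable]
  show "integrable M (\<lambda>x. (cmod (f x))\<^sup>2 + (cmod (g x))\<^sup>2)"
    using assms[THEN L2_integrable] by auto
  have "(\<lambda>x. cnj (g x)) \<in> borel_measurable M"
    by (rule measurable_compose[OF _ borel_measurable_continuous_onI]) (auto intro: continuous_intros)
  then show "(\<lambda>x. f x * cnj (g x)) \<in> borel_measurable M"
    by measurable
  show "AE x in M. norm (f x * cnj (g x)) \<le> norm ((cmod (f x))\<^sup>2 + (cmod (g x))\<^sup>2)"
  proof (rule AE_I2)
    fix x
    have "2 * (cmod (f x) * cmod (g x)) \<le> (cmod (f x))\<^sup>2 + (cmod (g x))\<^sup>2"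
      using sum_squares_bound[of "cmod (f x)" "cmod (g x)"] by (simp add: mult.assoc)
    moreover have "0 \<le> cmod (f x) * cmod (g x)"
      by simp
    ultimately have "cmod (f x) * cmod (g x) \<le> (cmod (f x))\<^sup>2 + (cmod (g x))\<^sup>2"
      by linarith
    then show "norm (f x * cnj (g x)) \<le> norm ((cmod (f x))\<^sup>2 + (cmod (g x))\<^sup>2)"
      by (simp add: norm_mult)
  qed
qed

lemma L2_inner_diff_left:
  "\<lbrakk>f \<in> L2 M; g \<in> L2 M; h \<in> L2 M\<rbrakk> \<Longrightarrow> L2_inner M (\<lambda>x. f x - g x) h = L2_inner M f h - L2_inner M g h"
  by (simp add: L2_inner_def left_diff_distrib L2_inner_integrable)

lemma L2_inner_sum_left:
  "\<lbrakk>\<And>i. i \<in> I \<Longrightarrow> f i \<in> L2 M; h \<in> L2 M\<rbrakk> \<Longrightarrow> L2_inner M (\<lambda>x. \<Sum>i\<in>I. c i * f i x) h = (\<Sum>i\<in>I. c i * L2_inner M (f i) h)"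
  by (simp add: L2_inner_def sum_distrib_right mult.assoc L2_inner_integrable)

lemma L2_inner_sum_right:
  "\<lbrakk>\<And>i. i \<in> I \<Longrightarrow> f i \<in> L2 M; h \<in> L2 M\<rbrakk> \<Longrightarrow> L2_inner M h (\<lambda>x. \<Sum>i\<in>I. c i * f i x) = (\<Sum>i\<in>I. cnj (c i) * L2_inner M h (f i))"
  by (simp add: L2_inner_def sum_distrib_left mult.left_commute[of "h _"] L2_inner_integrable)

lemma L2_inner_self: "L2_inner M f f = of_real (LINT x|M. (cmod (f x))\<^sup>2)"
  unfolding L2_inner_def integral_complex_of_real[symmetric]
  by (simp only: complex_norm_square[symmetric])

lemma AE_eq_0_of_L2_inner_self:
  assumes "f \<in> L2 M" "L2_inner M f f = 0"
  shows "AE x in M. f x = 0"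
proof -
  have "(LINT x|M. (cmod (f x))\<^sup>2) = 0"
    using assms(2) by (simp add: L2_inner_self)
  then show ?thesis
    using integral_nonneg_eq_0_iff_AE[OF L2_integrable[OF assms(1)]] by simp
qed

lemma L2_pythagoras:
  assumes "f \<in> L2 M" "g \<in> L2 M" "L2_inner M f g = 0"
  shows "(LINT x|M. (cmod (f x + g x))\<^sup>2) = (LINT x|M. (cmod (f x))\<^sup>2) + (LINT x|M. (cmod (g x))\<^sup>2)"
proof -
  have "(cmod (a + b))\<^sup>2 = (cmod a)\<^sup>2 + (cmod b)\<^sup>2 + 2 * Re (a * cnj b)" for a b
    unfolding cmod_power2 by (simp add: power2_eq_square algebra_simps)
  moreover have "(LINT x|M. Re (f x * cnj (g x))) = 0"
    using assms by (simp add: L2_inner_def L2_inner_integrable integral_Re del: times_complex.sel)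
  ultimately show ?thesis
    using assms by (simp add: L2_integrable L2_inner_integrable del: times_complex.sel)
qed

text \<open>The sum is the orthogonal projection p of f. The error f - p is orthogonal to every
  \<open>G i\<close>, hence to p - h, and Pythagoras splits off the distance from p to h. The
  \<open>G i\<close> may be null vectors; their coefficient is then 0.\<close>

lemma L2_best_approximation:
  assumes J: "finite J" "\<And>i. i \<in> J \<Longrightarrow> G i \<in> L2 M"
    and orth: "\<And>i j. i \<in> J \<Longrightarrow> j \<in> J \<Longrightarrow> i \<noteq> j \<Longrightarrow> L2_inner M (G i) (G j) = 0"
    and f: "f \<in> L2 M" and h: "h \<in> cspan (G ` J)"
  shows "(LINT x|M. (cmod (f x - (\<Sum>i\<in>J. L2_inner M f (G i) / L2_inner M (G i) (G i) * G i x)))\<^sup>2)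
       \<le> (LINT x|M. (cmod (f x - h x))\<^sup>2)"
proof -
  define p where "p = (\<lambda>x. \<Sum>i\<in>J. L2_inner M f (G i) / L2_inner M (G i) (G i) * G i x)"
  have pL2: "p \<in> L2 M"
    unfolding p_def by (intro csubspace_sum csubspace_scale csubspace_L2 J)
  have o: "L2_inner M (\<lambda>x. f x - p x) (G i) = 0" if "i \<in> J" for i
  proof -
    have "L2_inner M p (G i) = (\<Sum>j\<in>J. L2_inner M f (G j) / L2_inner M (G j) (G j) * L2_inner M (G j) (G i))"
      using J(2) that unfolding p_def by (intro L2_inner_sum_left) auto
    also have "\<dots> = (\<Sum>j\<in>J. if j = i then L2_inner M f (G i) / L2_inner M (G i) (G i) * L2_inner M (G i) (G i) else 0)"
      using that by (intro sum.cong) (auto simp: orth)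
    also have "\<dots> = L2_inner M f (G i) / L2_inner M (G i) (G i) * L2_inner M (G i) (G i)"
      using that J(1) by simp
    also have "\<dots> = L2_inner M f (G i)"
    \<comment> \<open>If \<open>G i\<close> has norm 0, the quotient is 0 by the convention for
      division; the equation survives because \<open>G i\<close> vanishes almost everywhere, so that
      its inner product with f is 0 too.\<close>
    proof (cases "L2_inner M (G i) (G i) = 0")
      case True
      then have "AE x in M. G i x = 0"
        using AE_eq_0_of_L2_inner_self J(2) that by blast
      then have "L2_inner M f (G i) = 0"
        unfolding L2_inner_def by (intro integral_eq_zero_AE) auto
      with True show ?thesis
        by simp
    qed simp
    finally show ?thesis
      using f pL2 J(2)[OF that] by (simp add: L2_inner_diff_left)
  qed
  obtain c where c: "h = (\<lambda>x. \<Sum>i\<in>J. c i * G i x)"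
    using cspan_image_finite[OF J(1) h] .
  define d where "d i = L2_inner M f (G i) / L2_inner M (G i) (G i) - c i" for i
  have ph: "(\<lambda>x. p x - h x) = (\<lambda>x. \<Sum>i\<in>J. d i * G i x)"
    by (simp add: p_def c d_def left_diff_distrib sum_subtractf)
  have "L2_inner M (\<lambda>x. f x - p x) (\<lambda>x. p x - h x) = (\<Sum>i\<in>J. cnj (d i) * L2_inner M (\<lambda>x. f x - p x) (G i))"
    unfolding ph using J(2) f pL2 by (intro L2_inner_sum_right L2_diff)
  also have "\<dots> = 0"
    by (simp add: o)
  finally have 0: "L2_inner M (\<lambda>x. f x - p x) (\<lambda>x. p x - h x) = 0" .
  have hL2: "h \<in> L2 M"
    unfolding c by (intro csubspace_sum csubspace_scale csubspace_L2 J)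
  show ?thesis
    using L2_pythagoras[OF L2_diff[OF f pL2] L2_diff[OF pL2 hL2] 0]
    by (simp add: p_def)
qed

text \<open>Squared norms keep the estimates free of roots; the inequality
  \<open>L2_sq_diff_triangle\<close>, with its factor 2, takes the place of the triangle
  inequality.\<close>

definition L2_closure :: "'a measure \<Rightarrow> ('a \<Rightarrow> complex) set \<Rightarrow> ('a \<Rightarrow> complex) set" where
  "L2_closure M S = {f \<in> L2 M. \<forall>e>0. \<exists>h\<in>S. (LINT x|M. (cmod (f x - h x))\<^sup>2) < e}"

text \<open>The component of f in \<open>V k\<close> is its projection, a finite Fourier sum.
  Generators of different degree being orthogonal too, the partial sums of the components are again
  projections, onto the span of the first spaces; as best approximations they inherit convergence
  from density.\<close>

theorem L2_orthogonal_sumI: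
  fixes g :: "nat \<Rightarrow> 'i \<Rightarrow> 'a \<Rightarrow> complex"
  assumes fin: "\<And>k. finite (I k)"
    and V: "\<And>k. V k = cspan (g k ` I k)"
    and L2: "\<And>k i. i \<in> I k \<Longrightarrow> g k i \<in> L2 M"
    and orth: "\<And>k k' i i'. \<lbrakk>i \<in> I k; i' \<in> I k'; (k, i) \<noteq> (k', i')\<rbrakk> \<Longrightarrow> L2_inner M (g k i) (g k' i') = 0"
    and dense: "L2 M \<subseteq> L2_closure M (cspan (\<Union>k. V k))"
  shows "L2_orthogonal_sum M V"
proof -
  have VL2: "V k \<subseteq> L2 M" for k
    unfolding V using L2 by (intro cspan_minimal csubspace_L2) auto
  define c where "c f k i = L2_inner M f (g k i) / L2_inner M (g k i) (g k i)" for f k i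
  define u where "u f k = (\<lambda>x. \<Sum>i\<in>I k. c f k i * g k i x)" for f k
  have uV: "u f k \<in> V k" for f k
    unfolding u_def V by (intro csubspace_sum csubspace_scale csubspace_cspan cspan_base) auto
  have "L2_closed M (V k)" for k
    unfolding L2_closed_def
  proof (intro ballI impI)
    fix f assume f: "f \<in> L2 M" and approx: "\<forall>e>0. \<exists>g\<in>V k. L2_norm M (\<lambda>x. f x - g x) < e"
    \<comment> \<open>No element of \<open>V k\<close> is closer to f than the projection
      \<open>u f k\<close>, so f has distance 0 from it.\<close>
    have "(LINT x|M. (cmod (f x - u f k x))\<^sup>2) \<le> e" if e: "e > 0" for e
    proof -
      have "sqrt e > 0"
        using e by simp
      with approx obtain h where h: "h \<in> V k" "L2_norm M (\<lambda>x. f x - h x) < sqrt e"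
        by blast
      have "(LINT x|M. (cmod (f x - u f k x))\<^sup>2) \<le> (LINT x|M. (cmod (f x - h x))\<^sup>2)"
        unfolding u_def c_def using fin L2 orth f h(1)[unfolded V] by (intro L2_best_approximation) auto
      also have "\<dots> < e"
        using h(2) by (simp add: L2_norm_def)
      finally show ?thesis
        by simp
    qed
    then have "(LINT x|M. (cmod (f x - u f k x))\<^sup>2) = 0"
      by (intro antisym[OF field_le_epsilon] integral_nonneg_AE) auto
    then have "AE x in M. f x - u f k x = 0"
      using uV VL2 by (intro AE_eq_0_of_L2_inner_self L2_diff f) (auto simp: L2_inner_self)
    with uV show "\<exists>g\<in>V k. AE x in M. f x = g x"
      by (intro bexI[of _ "u f k"]) auto
  qed
  moreover have "L2_inner M f f' = 0" if kk': "k \<noteq> k'" and fV: "f \<in> V k" and f'V: "f' \<in> V k'" for k k' f f'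
  proof -
    obtain a where a: "f = (\<lambda>x. \<Sum>i\<in>I k. a i * g k i x)"
      using cspan_image_finite[OF fin fV[unfolded V]] .
    obtain b where b: "f' = (\<lambda>x. \<Sum>i\<in>I k'. b i * g k' i x)"
      using cspan_image_finite[OF fin f'V[unfolded V]] .
    have "L2_inner M f f' = (\<Sum>i\<in>I k. a i * L2_inner M (g k i) f')"
      unfolding a using L2 f'V VL2 by (intro L2_inner_sum_left) auto
    also have "\<dots> = (\<Sum>i\<in>I k. a i * (\<Sum>j\<in>I k'. cnj (b j) * L2_inner M (g k i) (g k' j)))"
      unfolding b using L2 by (intro sum.cong refl arg_cong2[of _ _ _ _ "(*)"] L2_inner_sum_right) auto
    also have "\<dots> = 0"
      using kk' by (auto intro!: sum.neutral simp: orth)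
    finally show ?thesis .
  qed
  moreover have "(\<lambda>K. L2_norm M (\<lambda>x. f x - (\<Sum>k<K. u f k x))) \<longlonglongrightarrow> 0" if f: "f \<in> L2 M" for f
  proof -
    have "(\<lambda>K. LINT x|M. (cmod (f x - (\<Sum>k<K. u f k x)))\<^sup>2) \<longlonglongrightarrow> 0"
    proof (rule LIMSEQ_I)
      fix e :: real assume "e > 0"
      with dense f obtain h where h: "h \<in> cspan (\<Union>k. V k)" "(LINT x|M. (cmod (f x - h x))\<^sup>2) < e"
        unfolding L2_closure_def by blast
      \<comment> \<open>An approximant involves only finitely many degrees: the spans of the first K
        spaces increase with K, so their union is already a subspace.\<close>
      have "cspan (\<Union>k. V k) \<subseteq> (\<Union>K. cspan (\<Union>k<K. V k))"
      proof (intro cspan_minimal csubspaceI)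
        show "(\<Union>k. V k) \<subseteq> (\<Union>K. cspan (\<Union>k<K. V k))"
        proof safe
          fix k f assume "f \<in> V k"
          then have "f \<in> cspan (\<Union>j<Suc k. V j)"
            by (intro cspan_base) auto
          then show "f \<in> (\<Union>K. cspan (\<Union> (V ` {..<K})))"
            by blast
        qed
      next
        fix f g assume "f \<in> (\<Union>K. cspan (\<Union>k<K. V k))" "g \<in> (\<Union>K. cspan (\<Union>k<K. V k))"
        then obtain K L where "f \<in> cspan (\<Union>k<K. V k)" "g \<in> cspan (\<Union>k<L. V k)"
          by blast
        moreover have "cspan (\<Union>k<K. V k) \<subseteq> cspan (\<Union>k<max K L. V k)" "cspan (\<Union>k<L. V k) \<subseteq> cspan (\<Union>k<max K L. V k)"
          by (intro cspan_mono; force)+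
        ultimately show "(\<lambda>x. f x + g x) \<in> (\<Union>K. cspan (\<Union>k<K. V k))"
          by (intro UN_I[of "max K L"] csubspace_add csubspace_cspan) auto
      qed (auto intro: csubspace_0 csubspace_scale csubspace_cspan)
      with h(1) obtain K0 where K0: "h \<in> cspan (\<Union>k<K0. V k)"
        by blast
      have "(LINT x|M. (cmod (f x - (\<Sum>k<K. u f k x)))\<^sup>2) < e" if "K \<ge> K0" for K
      proof -
        let ?J = "Sigma {..<K} I"
        have "cspan (\<Union>k<K0. V k) \<subseteq> cspan ((\<lambda>(k, i). g k i) ` ?J)"
        proof (intro cspan_minimal csubspace_cspan UN_least)
          fix k assume "k \<in> {..<K0}"
          with that show "V k \<subseteq> cspan ((\<lambda>(k, i). g k i) ` ?J)"
            unfolding V by (intro cspan_mono) force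
        qed
        with K0 have h': "h \<in> cspan ((\<lambda>(k, i). g k i) ` ?J)"
          by blast
        have "(\<lambda>x. \<Sum>k<K. u f k x) = (\<lambda>x. \<Sum>(k, i)\<in>?J. c f k i * g k i x)"
          by (simp add: u_def sum.Sigma fin)
        also have "\<dots> = (\<lambda>x. \<Sum>i\<in>?J. L2_inner M f ((\<lambda>(k, i). g k i) i) / L2_inner M ((\<lambda>(k, i). g k i) i) ((\<lambda>(k, i). g k i) i) * (\<lambda>(k, i). g k i) i x)"
          by (simp add: c_def case_prod_beta)
        finally have *: "(\<Sum>k<K. u f k x) = (\<Sum>i\<in>?J. L2_inner M f ((\<lambda>(k, i). g k i) i) / L2_inner M ((\<lambda>(k, i). g k i) i) ((\<lambda>(k, i). g k i) i) * (\<lambda>(k, i). g k i) i x)" for x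
          by (rule fun_cong)
        have "(LINT x|M. (cmod (f x - (\<Sum>k<K. u f k x)))\<^sup>2) \<le> (LINT x|M. (cmod (f x - h x))\<^sup>2)"
          unfolding *
        proof (rule L2_best_approximation[OF _ _ _ f h'])
          show "L2_inner M ((\<lambda>(k, i). g k i) i) ((\<lambda>(k, i). g k i) j) = 0" if "i \<in> ?J" "j \<in> ?J" "i \<noteq> j" for i j
            using that orth[of "snd i" "fst i" "snd j" "fst j"] by (cases i; cases j) auto
        qed (use fin L2 in auto)
        with h(2) show ?thesis
          by simp
      qed
      then show "\<exists>K0. \<forall>K\<ge>K0. norm ((LINT x|M. (cmod (f x - (\<Sum>k<K. u f k x)))\<^sup>2) - 0) < e"
        by (intro exI[of _ K0]) (simp add: integral_nonneg_AE)
    qed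
    from tendsto_real_sqrt[OF this] show ?thesis
      by (simp add: L2_norm_def)
  qed
  moreover have "csubspace (V k)" for k
    by (simp add: V csubspace_cspan)
  ultimately show ?thesis
    unfolding L2_orthogonal_sum_def using VL2 uV by (intro conjI allI ballI impI exI[of _ "u _"]) blast+
qed

section \<open>Closures in L2 and density of the continuous functions\<close>

lemma L2_sq_diff_triangle:
  assumes "f \<in> L2 M" "g \<in> L2 M" "h \<in> L2 M"
  shows "(LINT x|M. (cmod (f x - h x))\<^sup>2) \<le> 2 * (LINT x|M. (cmod (f x - g x))\<^sup>2) + 2 * (LINT x|M. (cmod (g x - h x))\<^sup>2)"
proof -
  have i: "integrable M (\<lambda>x. (cmod (f x - h x))\<^sup>2)" "integrable M (\<lambda>x. (cmod (f x - g x))\<^sup>2)"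
    "integrable M (\<lambda>x. (cmod (g x - h x))\<^sup>2)"
    using assms by (auto intro!: L2_integrable L2_diff)
  have "(LINT x|M. (cmod (f x - h x))\<^sup>2) \<le> (LINT x|M. 2 * (cmod (f x - g x))\<^sup>2 + 2 * (cmod (g x - h x))\<^sup>2)"
  proof (rule integral_mono)
    show "(cmod (f x - h x))\<^sup>2 \<le> 2 * (cmod (f x - g x))\<^sup>2 + 2 * (cmod (g x - h x))\<^sup>2" for x
      using cmod_add_sq_le[of "f x - g x" "g x - h x"] by simp
  qed (use i in auto)
  then show ?thesis
    using i by simp
qed

text \<open>Idempotence of the closure. It allows the successive approximations of the density proof
  to be chained, each stage using members of the closure found before.\<close>

lemma L2_closure_closed:
  assumes S: "S \<subseteq> L2 M" and f: "f \<in> L2 M"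
    and approx: "\<And>e. e > 0 \<Longrightarrow> \<exists>g\<in>L2_closure M S. (LINT x|M. (cmod (f x - g x))\<^sup>2) < e"
  shows "f \<in> L2_closure M S"
  unfolding L2_closure_def
proof (intro CollectI conjI f allI impI)
  fix e :: real assume "e > 0"
  \<comment> \<open>There are two errors, and each is doubled by the inequality for squares.\<close>
  then have "e / 4 > 0"
    by simp
  then obtain g where g: "g \<in> L2_closure M S" "(LINT x|M. (cmod (f x - g x))\<^sup>2) < e / 4"
    using approx by blast
  with \<open>e / 4 > 0\<close> obtain h where h: "h \<in> S" "(LINT x|M. (cmod (g x - h x))\<^sup>2) < e / 4"
    unfolding L2_closure_def by blast
  have "(LINT x|M. (cmod (f x - h x))\<^sup>2) < e"
    using L2_sq_diff_triangle[of f M g h] f g h S by (auto simp: L2_closure_def)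
  with h(1) show "\<exists>h\<in>S. (LINT x|M. (cmod (f x - h x))\<^sup>2) < e"
    by blast
qed

lemma L2_closure_superset: "S \<subseteq> L2 M \<Longrightarrow> S \<subseteq> L2_closure M S"
proof
  fix f assume "S \<subseteq> L2 M" "f \<in> S"
  then show "f \<in> L2_closure M S"
    unfolding L2_closure_def by (auto intro!: bexI[of _ f])
qed

lemma L2_AE_cong:
  assumes "g \<in> L2 M" "f \<in> borel_measurable M" "AE x in M. f x = g x"
  shows "f \<in> L2 M"
proof -
  note [measurable] = assms(2) L2_measurable[OF assms(1)]
  have "integrable M (\<lambda>x. (cmod (f x))\<^sup>2)"
    using assms(3) by (intro integrable_cong_AE_imp[OF L2_integrable[OF assms(1)]]) auto
  then show ?thesis
    using assms(2) by (simp add: L2_def)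
qed

text \<open>This permits a change of representative: from a harmonic to its continuous version, from
  a simple function to its canonical sum, and from a polynomial to an expression equal to it on the
  gauge sphere only.\<close>

lemma L2_closure_AE_cong:
  assumes S: "S \<subseteq> L2 M" and g: "g \<in> L2_closure M S" and f: "f \<in> borel_measurable M" and eq: "AE x in M. f x = g x"
  shows "f \<in> L2_closure M S"
proof (rule L2_closure_closed[OF S])
  have gL2: "g \<in> L2 M"
    using g by (simp add: L2_closure_def)
  note [measurable] = L2_measurable[OF gL2] f
  show "f \<in> L2 M"
    by (rule L2_AE_cong[OF gL2 f eq])
  have 0: "(LINT x|M. (cmod (f x - g x))\<^sup>2) = 0"
    using eq by (intro integral_eq_zero_AE) auto
  show "\<exists>g\<in>L2_closure M S. (LINT x|M. (cmod (f x - g x))\<^sup>2) < e" if "e > 0" for e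
    using that 0 by (intro bexI[OF _ g]) simp
qed

lemma csubspace_L2_closure:
  assumes "csubspace S" "S \<subseteq> L2 M"
  shows "csubspace (L2_closure M S)"
proof (rule csubspaceI)
  show "(\<lambda>x. 0) \<in> L2_closure M S"
    using L2_closure_superset[OF assms(2)] csubspace_0[OF assms(1)] by blast
next
  fix f g assume fg: "f \<in> L2_closure M S" "g \<in> L2_closure M S"
  then have fgL2: "f \<in> L2 M" "g \<in> L2 M"
    by (auto simp: L2_closure_def)
  show "(\<lambda>x. f x + g x) \<in> L2_closure M S"
    unfolding L2_closure_def
  proof (intro CollectI conjI csubspace_add csubspace_L2 fgL2 allI impI)
    fix e :: real assume "e > 0"
    then have "e / 4 > 0"
      by simp
    with fg obtain h k where hk: "h \<in> S" "k \<in> S" "(LINT x|M. (cmod (f x - h x))\<^sup>2) < e / 4"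
      "(LINT x|M. (cmod (g x - k x))\<^sup>2) < e / 4"
      unfolding L2_closure_def by blast
    have "(LINT x|M. (cmod (f x + g x - (h x + k x)))\<^sup>2)
      \<le> 2 * (LINT x|M. (cmod (f x + g x - (h x + g x)))\<^sup>2) + 2 * (LINT x|M. (cmod (h x + g x - (h x + k x)))\<^sup>2)"
      using hk fgL2 assms by (intro L2_sq_diff_triangle csubspace_add csubspace_L2) auto
    with hk have "(LINT x|M. (cmod (f x + g x - (h x + k x)))\<^sup>2) < e"
      by simp
    then show "\<exists>h\<in>S. (LINT x|M. (cmod (f x + g x - h x))\<^sup>2) < e"
      by (rule bexI[of _ "\<lambda>x. h x + k x"]) (intro csubspace_add assms(1) hk)
  qed
next
  fix c f assume f: "f \<in> L2_closure M S"
  then have fL2: "f \<in> L2 M"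
    by (auto simp: L2_closure_def)
  show "(\<lambda>x. c * f x) \<in> L2_closure M S"
    unfolding L2_closure_def
  proof (intro CollectI conjI csubspace_scale csubspace_L2 fL2 allI impI)
    fix e :: real assume "e > 0"
    \<comment> \<open>The summand 1 covers the case c = 0.\<close>
    then have "e / ((cmod c)\<^sup>2 + 1) > 0"
      by (simp add: add_nonneg_pos)
    with f obtain h where h: "h \<in> S" "(LINT x|M. (cmod (f x - h x))\<^sup>2) < e / ((cmod c)\<^sup>2 + 1)"
      unfolding L2_closure_def by blast
    have "(LINT x|M. (cmod (c * f x - c * h x))\<^sup>2) = (cmod c)\<^sup>2 * (LINT x|M. (cmod (f x - h x))\<^sup>2)"
      by (simp add: norm_mult power_mult_distrib flip: right_diff_distrib)
    also have "\<dots> \<le> ((cmod c)\<^sup>2 + 1) * (LINT x|M. (cmod (f x - h x))\<^sup>2)"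
      by (intro mult_right_mono integral_nonneg_AE) auto
    also have "\<dots> < e"
      using h(2) by (simp add: pos_less_divide_eq add_nonneg_pos mult.commute)
    finally show "\<exists>h\<in>S. (LINT x|M. (cmod (c * f x - h x))\<^sup>2) < e"
      by (rule bexI[of _ "\<lambda>x. c * h x"]) (intro csubspace_scale assms(1) h)
  qed
qed

text \<open>Dominated convergence for the squared errors. The bound \<open>w\<close> is on the
  square, so a constant or a multiple of |f|^2 will serve.\<close>

lemma L2_closure_dominated:
  assumes S: "S \<subseteq> L2 M" and s: "\<And>i. s i \<in> L2_closure M S" and f: "f \<in> L2 M"
    and lim: "\<And>x. x \<in> space M \<Longrightarrow> (\<lambda>i. s i x) \<longlonglongrightarrow> f x"
    and w: "integrable M w" "\<And>i x. x \<in> space M \<Longrightarrow> (cmod (f x - s i x))\<^sup>2 \<le> w x"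
  shows "f \<in> L2_closure M S"
proof (rule L2_closure_closed[OF S f])
  have m [measurable]: "f \<in> borel_measurable M" "s i \<in> borel_measurable M" for i
    using f s by (auto simp: L2_closure_def L2_def)
  have "(\<lambda>i. LINT x|M. (cmod (f x - s i x))\<^sup>2) \<longlonglongrightarrow> (LINT x|M. 0)"
  proof (rule integral_dominated_convergence)
    show "AE x in M. (\<lambda>i. (cmod (f x - s i x))\<^sup>2) \<longlonglongrightarrow> 0"
    proof (rule AE_I2)
      fix x assume "x \<in> space M"
      from lim[OF this] have "(\<lambda>i. (cmod (f x - s i x))\<^sup>2) \<longlonglongrightarrow> (cmod (f x - f x))\<^sup>2"
        by (intro tendsto_intros)
      then show "(\<lambda>i. (cmod (f x - s i x))\<^sup>2) \<longlonglongrightarrow> 0"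
        by simp
    qed
  qed (use w in auto)
  then have lim0: "(\<lambda>i. LINT x|M. (cmod (f x - s i x))\<^sup>2) \<longlonglongrightarrow> 0"
    by simp
  fix e :: real assume "e > 0"
  then obtain i where "(LINT x|M. (cmod (f x - s i x))\<^sup>2) < e"
    using order_tendstoD(2)[OF lim0] eventually_happens[of _ sequentially] by auto
  with s show "\<exists>g\<in>L2_closure M S. (LINT x|M. (cmod (f x - g x))\<^sup>2) < e"
    by blast
qed

text \<open>Tent functions decrease to the indicator of a compact set, inner regularity leads on to
  measurable sets, and simple functions to all of L2. The tent functions have values in [0, 1],
  which is why only continuous functions bounded by 1 are asked for.\<close>

lemma L2_closure_of_continuous:
  fixes M :: "'a::euclidean_space measure"
  assumes "finite_measure M" and sets_M: "sets M = sets (restrict_space borel \<Omega>)" and "\<Omega> \<in> sets borel"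
    and S: "S \<subseteq> L2 M" "csubspace S"
    and cont: "\<And>f. continuous_on UNIV f \<Longrightarrow> (\<And>x. cmod (f x) \<le> 1) \<Longrightarrow> f \<in> L2_closure M S"
  shows "L2 M \<subseteq> L2_closure M S"
proof
  interpret finite_measure M by fact
  have space_M: "space M = \<Omega>"
    using sets_eq_imp_space_eq[OF sets_M] by (simp add: space_restrict_space)
  have id[measurable]: "(\<lambda>x. x) \<in> measurable M borel"
    by (simp add: measurable_cong_sets[OF sets_M refl] measurable_restrict_space1)
  \<comment> \<open>Inner regularity concerns measures on the Borel sets of the whole space, so M is
    pushed forward along the inclusion of its carrier.\<close>
  define B where "B = distr M borel (\<lambda>x. x)"
  have B: "sets B = sets borel" "emeasure B (space B) \<noteq> \<infinity>"
    by (auto simp: B_def emeasure_distr)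
  have measB: "measure B A = measure M (A \<inter> \<Omega>)" if "A \<in> sets borel" for A
    using that by (simp add: B_def measure_distr space_M)
  have closed: "(\<lambda>x. indicator K x :: complex) \<in> L2_closure M S" if "compact K" for K
  \<comment> \<open>The distance to the empty set is 0 by convention, so the tent functions for it
    would be constantly 1.\<close>
  proof (cases "K = {}")
    case True
    then show ?thesis
      using csubspace_0[OF csubspace_L2_closure[OF S(2,1)]] by simp
  next
    case False
    have "closed K"
      using that by (simp add: compact_imp_closed)
    then have [measurable]: "K \<in> sets borel"
      by simp
    define s where "s i x = complex_of_real (max 0 (1 - real i * infdist x K))" for i x
    have s01: "max 0 (1 - real i * infdist x K) \<in> {0..1}" for i x
      by (simp add: infdist_nonneg)
    show ?thesis
    proof (rule L2_closure_dominated[OF S(1)])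
      show "s i \<in> L2_closure M S" for i
      proof (rule cont)
        show "continuous_on UNIV (s i)"
          unfolding s_def by (intro continuous_intros)
        show "cmod (s i x) \<le> 1" for x
          using s01[of i x] by (simp add: s_def)
      qed
      show "(\<lambda>x. indicator K x :: complex) \<in> L2 M"
        by (rule bounded_in_L2[of _ 1]) (auto simp: indicator_def)
      show "integrable M (\<lambda>x. 1 :: real)"
        by simp
      show "(cmod (indicator K x - s i x))\<^sup>2 \<le> 1" for i x
      proof -
        have "indicator K x - s i x = of_real (indicator K x - max 0 (1 - real i * infdist x K))"
          by (simp add: s_def of_real_indicator)
        then have "cmod (indicator K x - s i x) \<le> 1"
          using s01[of i x] by (simp only: norm_of_real) (auto simp: indicator_def)
        then show ?thesis
          by (simp add: power_le_one)
      qed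
      show "(\<lambda>i. s i x) \<longlonglongrightarrow> indicator K x" for x
      proof (cases "x \<in> K")
        case True
        then show ?thesis
          by (simp add: s_def)
      next
        case False
        then have pos: "infdist x K > 0"
          using \<open>closed K\<close> \<open>K \<noteq> {}\<close> by (metis in_closed_iff_infdist_zero infdist_nonneg less_eq_real_def)
        then obtain n where n: "real n * infdist x K > 1"
          using reals_Archimedean3 by blast
        have "s i x = 0" if "i \<ge> n" for i
        proof -
          have "real n * infdist x K \<le> real i * infdist x K"
            using that pos by (intro mult_right_mono) auto
          with n show ?thesis
            by (simp add: s_def)
        qed
        then have "eventually (\<lambda>i. s i x = 0) sequentially"
          by (auto simp: eventually_sequentially)
        then show ?thesis
          using False by (simp add: tendsto_eventually)
      qed
    qed
  qed
  have ind: "(\<lambda>x. indicator A x :: complex) \<in> L2_closure M S" if A: "A \<in> sets M" for A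
  proof (rule L2_closure_closed[OF S(1)])
    have A\<Omega>: "A \<subseteq> \<Omega>" and [measurable]: "A \<in> sets borel"
      using A \<open>\<Omega> \<in> sets borel\<close> by (auto simp: sets_M sets_restrict_space)
    note [measurable] = A
    show "(\<lambda>x. indicator A x :: complex) \<in> L2 M"
      by (rule bounded_in_L2[of _ 1]) (auto simp: indicator_def)
    fix e :: real assume "e > 0"
    interpret B: finite_measure B
      by (rule finite_measureI) (rule B)
    \<comment> \<open>If every compact subset fell short by at least e, so would their supremum,
      which is the measure of A.\<close>
    obtain K where K: "K \<subseteq> A" "compact K" "measure B A - e < measure B K"
    proof (rule ccontr)
      assume "\<not> thesis"
      with that have le: "measure B K \<le> measure B A - e" if "K \<subseteq> A" "compact K" for K
        using that by (meson not_less)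
      from le[of "{}"] have nonneg: "0 \<le> measure B A - e"
        by simp
      have "emeasure B A = (SUP K \<in> {K. K \<subseteq> A \<and> compact K}. emeasure B K)"
        using inner_regular[OF B(1,2), of A] B(1) by simp
      also have "\<dots> \<le> ennreal (measure B A - e)"
        unfolding B.emeasure_eq_measure by (intro SUP_least ennreal_leI le) auto
      finally show False
        using nonneg \<open>e > 0\<close> by (simp add: B.emeasure_eq_measure)
    qed
    have [measurable]: "K \<in> sets borel"
      using K(2) by (simp add: compact_imp_closed)
    have [measurable]: "K \<in> sets M"
      using K(1) A\<Omega> by (auto simp: sets_M sets_restrict_space image_iff intro!: bexI[of _ K])
    have "(LINT x|M. (cmod (indicator A x - indicator K x))\<^sup>2) = (LINT x|M. indicator (A - K) x)"
      using K(1) by (intro Bochner_Integration.integral_cong) (auto simp: indicator_def)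
    also have "\<dots> = measure M (A - K)"
      using A by simp
    also have "\<dots> = measure M A - measure M K"
      using A K(1) by (intro finite_measure_Diff) auto
    also have "\<dots> < e"
      using K A\<Omega> by (simp add: measB Int_absorb2 order.trans[OF K(1) A\<Omega>])
    finally show "\<exists>g\<in>L2_closure M S. (LINT x|M. (cmod (indicator A x - g x))\<^sup>2) < e"
      by (rule bexI[of _ "indicator K"]) (rule closed[OF K(2)])
  qed
  fix f assume f: "f \<in> L2 M"
  note [measurable] = L2_measurable[OF f]
  obtain s where s: "\<And>i. simple_function M (s i)" "\<And>x. x \<in> space M \<Longrightarrow> (\<lambda>i. s i x) \<longlonglongrightarrow> f x"
    "\<And>i x. x \<in> space M \<Longrightarrow> dist (s i x) 0 \<le> 2 * dist (f x) 0"
    using borel_measurable_implies_sequence_metric[OF L2_measurable[OF f], of 0] by blast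
  show "f \<in> L2_closure M S"
  proof (rule L2_closure_dominated[OF S(1) _ f s(2)])
    \<comment> \<open>The simple functions satisfy |s i| <= 2 |f|, hence |f - s i| <= 3 |f|, and 9
      is the square of 3.\<close>
    show "integrable M (\<lambda>x. 9 * (cmod (f x))\<^sup>2)"
      using L2_integrable[OF f] by simp
    show "(cmod (f x - s i x))\<^sup>2 \<le> 9 * (cmod (f x))\<^sup>2" if "x \<in> space M" for i x
    proof -
      have "cmod (f x - s i x) \<le> 3 * cmod (f x)"
        using norm_triangle_ineq4[of "f x" "s i x"] s(3)[OF that, of i] by simp
      then have "(cmod (f x - s i x))\<^sup>2 \<le> (3 * cmod (f x))\<^sup>2"
        by (intro power_mono) auto
      then show ?thesis
        by (simp add: power_mult_distrib)
    qed
    show "s i \<in> L2_closure M S" for i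
    proof (rule L2_closure_AE_cong[OF S(1)])
      have fin: "finite (s i ` space M)" and m: "\<And>y. s i -` {y} \<inter> space M \<in> sets M"
        using s(1)[of i] by (auto simp: simple_function_def intro: simple_functionD)
      show "(\<lambda>x. \<Sum>y\<in>s i ` space M. y * indicator (s i -` {y} \<inter> space M) x) \<in> L2_closure M S"
        by (intro csubspace_sum csubspace_scale csubspace_L2_closure S ind m)
      show "s i \<in> borel_measurable M"
        by (rule borel_measurable_simple_function) (rule s)
      show "AE x in M. s i x = (\<Sum>y\<in>s i ` space M. y * indicator (s i -` {y} \<inter> space M) x)"
      proof (rule AE_I2)
        fix x assume "x \<in> space M"
        then have "(\<Sum>y\<in>s i ` space M. y * indicator (s i -` {y} \<inter> space M) x) = (\<Sum>y\<in>s i ` space M. if y = s i x then y else 0)"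
          by (intro sum.cong) (auto simp: indicator_def)
        also have "\<dots> = s i x"
          using fin \<open>x \<in> space M\<close> by simp
        finally show "s i x = (\<Sum>y\<in>s i ` space M. y * indicator (s i -` {y} \<inter> space M) x)"
          by simp
      qed
    qed
  qed auto
qed

subsection \<open>Jacobi polynomials\<close>

text \<open>Pascal's rule. Up to sign these sums are iterated finite differences, so one order can
  be traded for one difference of f.\<close>

lemma alternating_binomial_sum_Suc:
  fixes f :: "nat \<Rightarrow> real"
  shows "(\<Sum>s\<le>Suc N. (-1) ^ s * real (Suc N choose s) * f s)
       = (\<Sum>s\<le>N. (-1) ^ s * real (N choose s) * (f s - f (Suc s)))"
proof -
  have "(\<Sum>s\<le>Suc N. (-1) ^ s * real (Suc N choose s) * f s)
      = f 0 + (\<Sum>s\<le>N. (-1) ^ Suc s * real (N choose Suc s) * f (Suc s))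
        - (\<Sum>s\<le>N. (-1) ^ s * real (N choose s) * f (Suc s))"
    by (simp add: sum.atMost_Suc_shift sum.distrib sum_subtractf sum_negf algebra_simps del: sum.atMost_Suc)
  also have "f 0 + (\<Sum>s\<le>N. (-1) ^ Suc s * real (N choose Suc s) * f (Suc s))
      = (\<Sum>s\<le>Suc N. (-1) ^ s * real (N choose s) * f s)"
    by (simp add: sum.atMost_Suc_shift del: sum.atMost_Suc)
  also have "\<dots> = (\<Sum>s\<le>N. (-1) ^ s * real (N choose s) * f s)"
    by simp
  finally show ?thesis
    by (simp add: sum_subtractf[symmetric] algebra_simps)
qed

text \<open>The rising factorial is a polynomial of degree i in s, and its difference in s is, up to
  sign, i times the rising factorial with x + 1 and i - 1. Order and degree fall together, and the
  degree reaches 0 first.\<close>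

lemma alternating_binomial_sum_pochhammer:
  fixes x :: real
  assumes "i < N"
  shows "(\<Sum>s\<le>N. (-1) ^ s * real (N choose s) * pochhammer (x + real s) i) = 0"
  using assms
proof (induction N arbitrary: x i)
  case (Suc N)
  show ?case
  proof (cases i)
    case 0
    then show ?thesis
      using alternating_binomial_sum_Suc[of N "\<lambda>_. 1"] by simp
  next
    case (Suc i')
    have *: "pochhammer y (Suc i') - pochhammer (y + 1) (Suc i') = - real (Suc i') * pochhammer (y + 1) i'"
      for y :: real
      by (simp only: pochhammer_rec[of y] pochhammer_rec'[of "y + 1"]) (simp add: algebra_simps)
    have "pochhammer (x + real s) i - pochhammer (x + real (Suc s)) i
        = - real i * pochhammer (x + 1 + real s) i'" for s
      using *[of "x + real s"] by (simp add: Suc add_ac)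
    then have "(\<Sum>s\<le>Suc N. (-1) ^ s * real (Suc N choose s) * pochhammer (x + real s) i)
        = - real i * (\<Sum>s\<le>N. (-1) ^ s * real (N choose s) * pochhammer (x + 1 + real s) i')"
      unfolding alternating_binomial_sum_Suc sum_distrib_left by (intro sum.cong) simp_all
    also have "\<dots> = 0"
      using Suc.IH[of i' "x + 1"] Suc.prems Suc by simp
    finally show ?thesis .
  qed
qed simp

text \<open>The variable u = (1 - z) / 2 carries [-1, 1] to [0, 1]. For z = cos (2 phi) it is sin^2
  phi, which on the gauge sphere is |x|^(2(\<alpha> + 1)).\<close>

lemma jacobi_poly_one_minus:
  "jacobi_poly N a b (1 - 2 * u) =
     (\<Sum>s\<le>N. ((real N + a) gchoose (N - s)) * ((real N + b) gchoose s) * (- u) ^ s * (1 - u) ^ (N - s))"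
proof -
  have "(1 - 2 * u - 1) / 2 = - u" "(1 - 2 * u + 1) / 2 = 1 - u"
    by simp_all
  then show ?thesis
    by (simp only: jacobi_poly_def)
qed

lemma has_integral_jacobi_moment:
  assumes ab: "a \<ge> 0" "b \<ge> 0" and "i < N"
  shows "((\<lambda>u. u powr a * (1 - u) powr b * (u ^ i * jacobi_poly N a b (1 - 2 * u))) has_integral 0) {0..1}"
proof -
  \<comment> \<open>\<open>K\<close> gathers the Gamma factors that are independent of s: the two
    arguments of each Beta value add up to a + b + N + i + 2. The other Gamma factors cancel against
    the generalised binomial coefficients, up to N choose s and a rising factorial of degree i in
    s.\<close>
  define K where "K = Gamma (real N + a + 1) * Gamma (real N + b + 1) / (fact N * Gamma (a + b + real N + real i + 2))"
  define c where "c s = ((real N + a) gchoose (N - s)) * ((real N + b) gchoose s) * (-1) ^ s" for s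
  have "c s * Beta (a + s + i + 1) (b + N - s + 1)
      = K * ((-1) ^ s * real (N choose s) * pochhammer (a + 1 + real s) i)" if "s \<le> N" for s
  proof -
    have g1: "((real N + a) gchoose (N - s)) = Gamma (real N + a + 1) / (fact (N - s) * Gamma (a + s + 1))"
    proof -
      have "real N + a + 1 \<notin> \<int>\<^sub>\<le>\<^sub>0"
        using ab by (auto elim!: nonpos_Ints_cases)
      from gbinomial_Gamma[OF this, of "N - s"] show ?thesis
        using that by (simp add: of_nat_diff add_ac)
    qed
    have g2: "((real N + b) gchoose s) = Gamma (real N + b + 1) / (fact s * Gamma (b + N - s + 1))"
    proof -
      have "real N + b + 1 \<notin> \<int>\<^sub>\<le>\<^sub>0"
        using ab by (auto elim!: nonpos_Ints_cases)
      from gbinomial_Gamma[OF this, of s] show ?thesis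
        using that by (simp add: add_ac)
    qed
    have g3: "pochhammer (a + 1 + real s) i = Gamma (a + s + i + 1) / Gamma (a + s + 1)"
    proof -
      have "a + 1 + real s \<notin> \<int>\<^sub>\<le>\<^sub>0"
        using ab by (auto elim!: nonpos_Ints_cases)
      from pochhammer_Gamma[OF this, of i] show ?thesis
        by (simp add: add_ac)
    qed
    have g4: "Gamma (b + N - s + 1) \<noteq> 0" "Gamma (a + s + 1) \<noteq> 0"
      using that ab by (auto intro!: less_imp_neq[symmetric] Gamma_real_pos)
    have g5: "real (N choose s) = fact N / (fact s * fact (N - s))"
      by (rule binomial_fact) fact
    have "Beta (a + s + i + 1) (b + N - s + 1)
        = Gamma (a + s + i + 1) * Gamma (b + N - s + 1) / Gamma (a + b + real N + real i + 2)"
      by (simp add: Beta_def algebra_simps)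
    then show ?thesis
      unfolding c_def K_def g1 g2 g3 g5 using g4 by (simp add: field_simps)
  qed
  then have "(\<Sum>s\<le>N. c s * Beta (a + s + i + 1) (b + N - s + 1))
      = K * (\<Sum>s\<le>N. (-1) ^ s * real (N choose s) * pochhammer (a + 1 + real s) i)"
    unfolding sum_distrib_left by (intro sum.cong) auto
  also have "\<dots> = 0"
    using alternating_binomial_sum_pochhammer[OF \<open>i < N\<close>] by simp
  finally have 0: "(\<Sum>s\<le>N. c s * Beta (a + s + i + 1) (b + N - s + 1)) = 0" .
  have "((\<lambda>u. \<Sum>s\<le>N. c s * (u powr (a + s + i) * (1 - u) powr (b + N - s)))
      has_integral (\<Sum>s\<le>N. c s * Beta (a + s + i + 1) (b + N - s + 1))) {0..1}"
  proof (intro has_integral_sum has_integral_mult_right)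
    fix s assume "s \<in> {..N}"
    then show "((\<lambda>u. u powr (a + s + i) * (1 - u) powr (b + N - s))
        has_integral Beta (a + s + i + 1) (b + N - s + 1)) {0..1}"
      using has_integral_Beta_real[of "a + s + i + 1" "b + N - s + 1"] ab by simp
  qed simp
  from this[unfolded 0] show ?thesis
  proof (rule has_integral_eq[rotated])
    fix u :: real assume "u \<in> {0..1}"
    then have u: "0 \<le> u" "0 \<le> 1 - u"
      by auto
    \<comment> \<open>This holds at the end points as well, because \<open>powr\<close> with base 0
      is 0 for every exponent.\<close>
    have p: "v powr x * v ^ k = v powr (x + real k)" if "v \<ge> 0" for v x :: real and k
      using that by (cases "v = 0") (auto simp: powr_add powr_realpow)
    have "c s * (u powr (a + s + i) * (1 - u) powr (b + N - s)) =
        u powr a * (1 - u) powr b * (u ^ i * (((real N + a) gchoose (N - s)) * ((real N + b) gchoose s) * (- u) ^ s * (1 - u) ^ (N - s)))"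
      if "s \<le> N" for s
    proof -
      have "u powr (a + s + i) = u powr a * u ^ s * u ^ i"
        using p[OF u(1)] by simp
      moreover have "(1 - u) powr (b + N - s) = (1 - u) powr b * (1 - u) ^ (N - s)"
        using p[OF u(2), of b "N - s"] that by (simp add: of_nat_diff add_diff_eq)
      ultimately show ?thesis
        by (simp add: c_def power_minus[of u])
    qed
    then show "(\<Sum>s\<le>N. c s * (u powr (a + s + i) * (1 - u) powr (b + N - s))) =
        u powr a * (1 - u) powr b * (u ^ i * jacobi_poly N a b (1 - 2 * u))"
      by (simp add: jacobi_poly_one_minus sum_distrib_left)
  qed
qed

text \<open>In the variable u all summands have degree N, with leading coefficient (-1)^N times a
  product of two positive binomial coefficients, so nothing cancels. The exact degree makes the
  Jacobi polynomials a basis of all polynomials, which the density proof exploits.\<close>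

lemma jacobi_poly_eq_poly:
  assumes "a \<ge> 0" "b \<ge> 0"
  obtains p :: "real poly" where "degree p = N" "coeff p N \<noteq> 0" "\<And>u. poly p u = jacobi_poly N a b (1 - 2 * u)"
proof -
  define c where "c s = ((real N + a) gchoose (N - s)) * ((real N + b) gchoose s)" for s
  define q where "q s = ([:0, -1:] ^ s * [:1, -1:] ^ (N - s) :: real poly)" for s
  define p where "p = (\<Sum>s\<le>N. smult (c s) (q s))"
  have q: "degree (q s) = N" "coeff (q s) N = (-1) ^ N" if "s \<le> N" for s
  proof -
    show 1: "degree (q s) = N"
      using that by (simp add: q_def degree_mult_eq degree_power_eq)
    have "lead_coeff (q s) = (-1) ^ s * (-1) ^ (N - s)"
      by (simp add: q_def lead_coeff_mult lead_coeff_power)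
    also have "\<dots> = (-1) ^ N"
      using that by (simp flip: power_add)
    finally show "coeff (q s) N = (-1) ^ N"
      by (simp add: 1)
  qed
  have pos: "(x gchoose k) > 0" if "x \<ge> real k" for x :: real and k
    using that by (auto simp: gbinomial_prod_rev intro!: divide_pos_pos prod_pos)
  have "c s > 0" if "s \<le> N" for s
    unfolding c_def using assms that by (intro mult_pos_pos pos) (auto simp: of_nat_diff)
  then have "sum c {..N} > 0"
    by (intro sum_pos) auto
  moreover have "coeff p N = sum c {..N} * (-1) ^ N"
    by (simp add: p_def coeff_sum q sum_distrib_right)
  ultimately have nz: "coeff p N \<noteq> 0"
    by simp
  show ?thesis
  proof
    have "degree p \<le> N"
      unfolding p_def by (intro degree_sum_le) (auto simp: q degree_smult_le intro: order.trans[OF degree_smult_le])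
    with nz show "degree p = N"
      by (simp add: le_antisym le_degree)
    show "poly p u = jacobi_poly N a b (1 - 2 * u)" for u
      unfolding jacobi_poly_one_minus by (simp add: p_def q_def c_def poly_sum mult_ac)
  qed (fact nz)
qed

lemma poly_eq_sum_of_degree_basis:
  fixes p :: "nat \<Rightarrow> 'a::field poly"
  assumes "\<And>i. degree (p i) = i" "\<And>i. coeff (p i) i \<noteq> 0" "degree q \<le> N"
  shows "\<exists>c. q = (\<Sum>i\<le>N. smult (c i) (p i))"
  using assms(3)
proof (induction N arbitrary: q)
  case 0
  have "p 0 = [:coeff (p 0) 0:]"
    using assms(1) degree_eq_zeroE[of "p 0"] by (metis coeff_pCons_0)
  moreover have "q = [:coeff q 0:]"
    using 0 by (metis coeff_pCons_0 degree_eq_zeroE le_zero_eq)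
  ultimately have "q = smult (coeff q 0 / coeff (p 0) 0) (p 0)"
    using assms(2)[of 0] by (metis (no_types, lifting) mult.right_neutral nonzero_eq_divide_eq smult_pCons smult_0_right)
  then show ?case
    by (intro exI[of _ "\<lambda>_. coeff q 0 / coeff (p 0) 0"]) simp
next
  case (Suc N)
  define d where "d = coeff q (Suc N) / coeff (p (Suc N)) (Suc N)"
  have "degree (q - smult d (p (Suc N))) \<le> N"
  proof (rule degree_le, intro allI impI)
    fix i assume "N < i"
    then show "coeff (q - smult d (p (Suc N))) i = 0"
      using Suc.prems assms(1)[of "Suc N"] assms(2)[of "Suc N"]
      by (cases "i = Suc N") (auto simp: d_def coeff_eq_0)
  qed
  from Suc.IH[OF this] obtain c where "q - smult d (p (Suc N)) = (\<Sum>i\<le>N. smult (c i) (p i))"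
    by auto
  then have "q = (\<Sum>i\<le>N. smult (c i) (p i)) + smult d (p (Suc N))"
    by (simp add: diff_eq_eq)
  then show ?case
    by (intro exI[of _ "c(Suc N := d)"]) simp
qed

lemma has_integral_jacobi_orthogonal:
  assumes ab: "a \<ge> 0" "b \<ge> 0" and "N \<noteq> N'"
  shows "((\<lambda>u. u powr a * (1 - u) powr b * (jacobi_poly N a b (1 - 2 * u) * jacobi_poly N' a b (1 - 2 * u)))
            has_integral 0) {0..1}"
  using assms(3)
\<comment> \<open>By symmetry the factor of smaller degree may be taken as the one that is expanded
  in powers of u.\<close>
proof (induction N' N rule: linorder_wlog)
  case (le N' N)
  then have "N' < N"
    by simp
  obtain p :: "real poly" where p: "degree p = N'" "\<And>u. poly p u = jacobi_poly N' a b (1 - 2 * u)"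
    using jacobi_poly_eq_poly[OF ab] by metis
  have "((\<lambda>u. \<Sum>i\<le>N'. coeff p i * (u powr a * (1 - u) powr b * (u ^ i * jacobi_poly N a b (1 - 2 * u))))
      has_integral (\<Sum>i\<le>N'. coeff p i * 0)) {0..1}"
    using \<open>N' < N\<close> ab by (intro has_integral_sum has_integral_mult_right has_integral_jacobi_moment) auto
  moreover have "jacobi_poly N' a b (1 - 2 * u) = (\<Sum>i\<le>N'. coeff p i * u ^ i)" for u
    by (simp add: poly_altdef p(1) flip: p(2))
  ultimately show ?case
    by (simp only: sum_distrib_left sum_distrib_right mult_ac mult_zero_left mult_zero_right sum.neutral_const)
next
  case (sym N' N)
  then show ?case
    by (simp add: mult.commute[of "jacobi_poly N a b _"])
qed

subsection \<open>Complex polynomial functions and solid harmonics\<close>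

lemma polynomial_function_complex_iff:
  fixes f :: "'a::real_normed_vector \<Rightarrow> complex"
  shows "polynomial_function f \<longleftrightarrow> real_polynomial_function (\<lambda>x. Re (f x)) \<and> real_polynomial_function (\<lambda>x. Im (f x))"
  by (subst polynomial_function_iff_Basis_inner) (simp add: Basis_complex_def real_polynomial_function_eq)

lemma polynomial_function_complex_mult [intro]:
  fixes f g :: "'a::real_normed_vector \<Rightarrow> complex"
  shows "polynomial_function f \<Longrightarrow> polynomial_function g \<Longrightarrow> polynomial_function (\<lambda>x. f x * g x)"
  by (auto simp: polynomial_function_complex_iff)

lemma polynomial_function_of_real [intro]:
  "real_polynomial_function f \<Longrightarrow> polynomial_function (\<lambda>x. complex_of_real (f x))"
  by (auto simp: polynomial_function_complex_iff)

lemma polynomial_function_cnj [intro]: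
  "polynomial_function f \<Longrightarrow> polynomial_function (\<lambda>x. cnj (f x))"
  by (auto simp: polynomial_function_complex_iff)

lemma polynomial_function_coord [intro]: "polynomial_function (\<lambda>x. complex_of_real (x \<bullet> b))"
  by (intro polynomial_function_of_real real_polynomial_function.intros(1) bounded_linear_inner_left)

text \<open>Real polynomial functions are generated by constants and bounded linear functionals.
  Here a functional is expanded in coordinates, and a complex polynomial is recombined from its real
  and imaginary parts. The cases carry \<open>polynomial_function\<close> along so that the rules of
  calculus apply to the parts.\<close>

lemma polynomial_function_complex_induct [consumes 1, case_names const coord add mult]:
  fixes f :: "'a::euclidean_space \<Rightarrow> complex"
  assumes "polynomial_function f"
    and const: "\<And>c. Q (\<lambda>x. c)"
    and coord: "\<And>b. b \<in> Basis \<Longrightarrow> Q (\<lambda>x. of_real (x \<bullet> b))"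
    and add: "\<And>f g. polynomial_function f \<Longrightarrow> polynomial_function g \<Longrightarrow> Q f \<Longrightarrow> Q g \<Longrightarrow> Q (\<lambda>x. f x + g x)"
    and mult: "\<And>f g. polynomial_function f \<Longrightarrow> polynomial_function g \<Longrightarrow> Q f \<Longrightarrow> Q g \<Longrightarrow> Q (\<lambda>x. f x * g x)"
  shows "Q f"
proof -
  have real: "Q (\<lambda>x. complex_of_real (p x))" if "real_polynomial_function p" for p :: "'a \<Rightarrow> real"
    using that
  proof induction
    case (linear p)
    have *: "Q (\<lambda>x. \<Sum>b\<in>A. of_real (p b) * of_real (x \<bullet> b))" if "finite A" "A \<subseteq> Basis" for A
      using that
    proof (induction A)
      case (insert b A)
      have "polynomial_function (\<lambda>x. complex_of_real (p b) * of_real (x \<bullet> b))" for b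
        by auto
      with insert have "Q (\<lambda>x. of_real (p b) * of_real (x \<bullet> b) + (\<Sum>b\<in>A. of_real (p b) * of_real (x \<bullet> b)))"
        by (intro add mult[OF _ _ const coord] polynomial_function_sum) auto
      with insert show ?case
        by simp
    qed (simp add: const)
    have p: "p x = (\<Sum>b\<in>Basis. p b * (x \<bullet> b))" for x
    proof -
      interpret bounded_linear p by fact
      have "p x = p (\<Sum>b\<in>Basis. (x \<bullet> b) *\<^sub>R b)"
        by (simp add: euclidean_representation)
      also have "\<dots> = (\<Sum>b\<in>Basis. p b * (x \<bullet> b))"
        by (simp add: sum scaleR mult.commute)
      finally show ?thesis .
    qed
    have "(\<lambda>x. complex_of_real (p x)) = (\<lambda>x. \<Sum>b\<in>Basis. of_real (p b) * of_real (x \<bullet> b))"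
      by (intro ext, subst p) simp
    with *[OF finite_Basis order.refl] show ?case
      by (simp only:)
  next
    case (add p q)
    with assms(4)[of "\<lambda>x. of_real (p x)" "\<lambda>x. of_real (q x)"] show ?case
      by (simp add: polynomial_function_of_real)
  next
    case (mult p q)
    with assms(5)[of "\<lambda>x. of_real (p x)" "\<lambda>x. of_real (q x)"] show ?case
      by (simp add: polynomial_function_of_real)
  qed (simp add: const)
  have "real_polynomial_function (\<lambda>x. Re (f x))" "real_polynomial_function (\<lambda>x. Im (f x))"
    using assms(1) by (auto simp: polynomial_function_complex_iff)
  note Re_Im = this[THEN polynomial_function_of_real] this[THEN real]
  have "Q (\<lambda>x. complex_of_real (Re (f x)) + \<i> * complex_of_real (Im (f x)))"
    by (rule add[OF Re_Im(1) _ Re_Im(3) mult[OF _ Re_Im(2) const Re_Im(4)]])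
       (intro polynomial_function_complex_mult Re_Im polynomial_function_const)+
  then show ?thesis
    by (simp only: complex_eq[symmetric])
qed

section \<open>Partial derivatives and the Laplacian of polynomials\<close>

lemma differentiable_coord: "(\<lambda>x. complex_of_real (x \<bullet> b)) differentiable at x"
  by (intro bounded_linear_imp_differentiable bounded_linear_compose[OF bounded_linear_of_real bounded_linear_inner_left])

lemma polynomial_function_differentiable [simp]:
  fixes f :: "'a::euclidean_space \<Rightarrow> complex"
  assumes "polynomial_function f"
  shows "f differentiable at x"
  using assms
  by (induction rule: polynomial_function_complex_induct)
     (simp_all add: differentiable_coord)

lemma partial_deriv_const [simp]: "partial_deriv b (\<lambda>x. c) = (\<lambda>x. 0)"
  by (simp add: partial_deriv_def frechet_derivative_const fun_eq_iff)

lemma partial_deriv_coord: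
  "partial_deriv b (\<lambda>x. of_real (x \<bullet> c)) = (\<lambda>x. of_real (b \<bullet> c))"
proof
  fix x
  have "((\<lambda>x. complex_of_real (x \<bullet> c)) has_derivative (\<lambda>x. of_real (x \<bullet> c))) (at x)"
    by (intro bounded_linear_imp_has_derivative bounded_linear_compose[OF bounded_linear_of_real bounded_linear_inner_left])
  from frechet_derivative_at[OF this, THEN fun_cong, of b, symmetric] show "partial_deriv b (\<lambda>x. of_real (x \<bullet> c)) x = of_real (b \<bullet> c)"
    by (simp only: partial_deriv_def)
qed

lemma partial_deriv_add:
  assumes "polynomial_function f" "polynomial_function g"
  shows "partial_deriv b (\<lambda>x. f x + g x) = (\<lambda>x. partial_deriv b f x + partial_deriv b g x)"
proof
  fix x
  have "((\<lambda>x. f x + g x) has_derivative (\<lambda>h. frechet_derivative f (at x) h + frechet_derivative g (at x) h)) (at x)"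
    using assms by (intro has_derivative_add) (simp_all flip: frechet_derivative_works)
  from frechet_derivative_at[OF this, THEN fun_cong, of b, symmetric] show "partial_deriv b (\<lambda>x. f x + g x) x = partial_deriv b f x + partial_deriv b g x"
    by (simp only: partial_deriv_def)
qed

lemma partial_deriv_mult:
  assumes "polynomial_function f" "polynomial_function g"
  shows "partial_deriv b (\<lambda>x. f x * g x) = (\<lambda>x. f x * partial_deriv b g x + partial_deriv b f x * g x)"
proof
  fix x
  have "((\<lambda>x. f x * g x) has_derivative (\<lambda>h. f x * frechet_derivative g (at x) h + frechet_derivative f (at x) h * g x)) (at x)"
    using assms by (intro has_derivative_mult) (simp_all flip: frechet_derivative_works)
  from frechet_derivative_at[OF this, THEN fun_cong, of b, symmetric]
  show "partial_deriv b (\<lambda>x. f x * g x) x = f x * partial_deriv b g x + partial_deriv b f x * g x"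
    by (simp only: partial_deriv_def)
qed

lemma partial_deriv_cmult:
  "polynomial_function f \<Longrightarrow> partial_deriv b (\<lambda>x. c * f x) = (\<lambda>x. c * partial_deriv b f x)"
  by (simp add: partial_deriv_mult)

lemma partial_deriv_cnj:
  assumes "polynomial_function f"
  shows "partial_deriv b (\<lambda>x. cnj (f x)) = (\<lambda>x. cnj (partial_deriv b f x))"
proof
  fix x
  have "((\<lambda>x. cnj (f x)) has_derivative (\<lambda>h. cnj (frechet_derivative f (at x) h))) (at x)"
    using assms by (intro bounded_linear.has_derivative[OF bounded_linear_cnj]) (simp flip: frechet_derivative_works)
  from frechet_derivative_at[OF this, THEN fun_cong, of b, symmetric] show "partial_deriv b (\<lambda>x. cnj (f x)) x = cnj (partial_deriv b f x)"
    by (simp only: partial_deriv_def)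
qed

lemma polynomial_function_partial_deriv [intro]:
  fixes f :: "'a::euclidean_space \<Rightarrow> complex"
  assumes "polynomial_function f"
  shows "polynomial_function (partial_deriv b f)"
  using assms
  by (induction rule: polynomial_function_complex_induct)
     (auto simp: partial_deriv_coord partial_deriv_add partial_deriv_mult)

text \<open>By induction on the polynomial: in the second derivative of a product, the two mixed
  terms trade places when a and b do.\<close>

lemma partial_deriv_commute:
  fixes f :: "'a::euclidean_space \<Rightarrow> complex"
  assumes "polynomial_function f"
  shows "partial_deriv a (partial_deriv b f) = partial_deriv b (partial_deriv a f)"
  using assms
proof (induction rule: polynomial_function_complex_induct)
  case (add f g)
  then show ?case
    by (simp add: partial_deriv_add polynomial_function_partial_deriv)
next
  case (mult f g)
  then show ?case
    by (subst partial_deriv_mult, simp, simp)+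
       (simp add: partial_deriv_mult partial_deriv_add polynomial_function_partial_deriv
          polynomial_function_complex_mult fun_eq_iff algebra_simps)
qed (simp_all add: partial_deriv_coord)

lemma partial_deriv_sum:
  fixes f :: "'i \<Rightarrow> 'a::euclidean_space \<Rightarrow> complex"
  assumes "finite I" "\<And>i. i \<in> I \<Longrightarrow> polynomial_function (f i)"
  shows "partial_deriv b (\<lambda>x. \<Sum>i\<in>I. f i x) = (\<lambda>x. \<Sum>i\<in>I. partial_deriv b (f i) x)"
  using assms by (induction I) (simp_all add: partial_deriv_add polynomial_function_sum)

lemma laplacian_coord: "laplacian (\<lambda>x. of_real (x \<bullet> b)) x = 0"
  by (simp add: laplacian_def partial_deriv_coord)

lemma laplacian_add:
  "polynomial_function f \<Longrightarrow> polynomial_function g \<Longrightarrow>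
    laplacian (\<lambda>x. f x + g x) x = laplacian f x + laplacian g x"
  by (simp add: laplacian_def partial_deriv_add polynomial_function_partial_deriv sum.distrib)

lemma laplacian_cmult:
  "polynomial_function f \<Longrightarrow> laplacian (\<lambda>x. c * f x) x = c * laplacian f x"
  by (simp add: laplacian_def partial_deriv_cmult polynomial_function_partial_deriv sum_distrib_left)

lemma laplacian_cnj:
  "polynomial_function f \<Longrightarrow> laplacian (\<lambda>x. cnj (f x)) x = cnj (laplacian f x)"
  by (simp add: laplacian_def partial_deriv_cnj polynomial_function_partial_deriv)

lemma laplacian_partial_deriv:
  fixes f :: "'a::euclidean_space \<Rightarrow> complex"
  assumes "polynomial_function f"
  shows "laplacian (partial_deriv b f) = partial_deriv b (laplacian f)"
proof -
  have "laplacian (partial_deriv b f) = (\<lambda>x. \<Sum>c\<in>Basis. partial_deriv b (partial_deriv c (partial_deriv c f)) x)"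
    using assms by (simp add: laplacian_def[abs_def] partial_deriv_commute[of _ _ b] polynomial_function_partial_deriv)
  also have "\<dots> = partial_deriv b (laplacian f)"
    unfolding laplacian_def[abs_def] using assms by (subst partial_deriv_sum) auto
  finally show ?thesis .
qed

lemma laplacian_mult:
  fixes f g :: "'a::euclidean_space \<Rightarrow> complex"
  assumes f: "polynomial_function f" and g: "polynomial_function g"
  shows "laplacian (\<lambda>x. f x * g x) x =
    f x * laplacian g x + 2 * (\<Sum>b\<in>Basis. partial_deriv b f x * partial_deriv b g x) + laplacian f x * g x"
proof -
  have "partial_deriv b (partial_deriv b (\<lambda>x. f x * g x)) x =
      f x * partial_deriv b (partial_deriv b g) x + 2 * (partial_deriv b f x * partial_deriv b g x)
      + partial_deriv b (partial_deriv b f) x * g x" for b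
    using f g by (simp add: partial_deriv_mult partial_deriv_add polynomial_function_partial_deriv
        polynomial_function_complex_mult algebra_simps)
  then show ?thesis
    by (simp add: laplacian_def sum.distrib sum_distrib_left sum_distrib_right)
qed

section \<open>Homogeneous polynomials and Euler's identity\<close>

lemma frechet_derivative_eq_sum_partial_deriv:
  fixes f :: "'a::euclidean_space \<Rightarrow> complex"
  assumes "polynomial_function f"
  shows "frechet_derivative f (at x) h = (\<Sum>b\<in>Basis. of_real (h \<bullet> b) * partial_deriv b f x)"
proof -
  interpret linear "frechet_derivative f (at x)"
    using assms by (intro linear_frechet_derivative) simp
  have "frechet_derivative f (at x) h = frechet_derivative f (at x) (\<Sum>b\<in>Basis. (h \<bullet> b) *\<^sub>R b)"
    by (simp add: euclidean_representation)
  then show ?thesis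
    by (simp add: sum scale partial_deriv_def scaleR_conv_of_real)
qed

definition homogeneous :: "nat \<Rightarrow> ('a::euclidean_space \<Rightarrow> complex) \<Rightarrow> bool" where
  "homogeneous l P \<longleftrightarrow> (\<forall>(t::real) x. P (t *\<^sub>R x) = of_real t ^ l * P x)"

lemma homogeneous_0_const:
  assumes "homogeneous 0 P"
  shows "\<exists>c. P = (\<lambda>x. c)"
proof (intro exI ext)
  fix x
  show "P x = P 0"
    using assms[unfolded homogeneous_def, rule_format, of 0 x] by simp
qed

lemma solid_harmonics_iff:
  "P \<in> solid_harmonics l \<longleftrightarrow> polynomial_function P \<and> homogeneous l P \<and> (\<forall>x. laplacian P x = 0)"
  by (simp add: solid_harmonics_def homogeneous_def)

text \<open>Both sides are the derivative of t -> P (t x) at t = 1.\<close>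

lemma euler_homogeneous:
  assumes P: "polynomial_function P" and "homogeneous l P"
  shows "(\<Sum>b\<in>Basis. of_real (x \<bullet> b) * partial_deriv b P x) = of_nat l * P x"
proof -
  have "((\<lambda>t. P (t *\<^sub>R x)) has_derivative (\<lambda>h. frechet_derivative P (at (1 *\<^sub>R x)) (h *\<^sub>R x))) (at 1)"
  proof (rule has_derivative_compose[where f = "\<lambda>t. t *\<^sub>R x" and g = P])
    show "((\<lambda>t. t *\<^sub>R x) has_derivative (\<lambda>h. h *\<^sub>R x)) (at 1)"
      by (auto intro!: derivative_eq_intros)
    show "(P has_derivative frechet_derivative P (at (1 *\<^sub>R x))) (at (1 *\<^sub>R x))"
      using P by (simp flip: frechet_derivative_works)
  qed
  moreover have "((\<lambda>t. P (t *\<^sub>R x)) has_derivative (\<lambda>h. of_real h * (of_nat l * P x))) (at 1)"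
  proof -
    have "((\<lambda>t. complex_of_real t ^ l * P x) has_derivative (\<lambda>h. of_real h * (of_nat l * P x))) (at 1)"
      by (auto intro!: derivative_eq_intros simp: mult_ac)
    then show ?thesis
      using assms(2) by (simp add: homogeneous_def)
  qed
  ultimately have "(\<lambda>h. frechet_derivative P (at (1 *\<^sub>R x)) (h *\<^sub>R x)) = (\<lambda>h. of_real h * (of_nat l * P x))"
    by (rule has_derivative_unique)
  from fun_cong[OF this, of 1] show ?thesis
    using P by (simp add: frechet_derivative_eq_sum_partial_deriv)
qed

lemma polynomial_function_continuous_on [intro]:
  fixes f :: "'a::euclidean_space \<Rightarrow> complex"
  shows "polynomial_function f \<Longrightarrow> continuous_on S f"
  by (simp add: continuous_on_polymonial_function)

text \<open>The chain rule yields the identity after division by t, and t = 0 is reached by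
  continuity. For l = 0 the truncated degree l - 1 = 0 is right as well: P is constant, and its
  derivative 0 is homogeneous of every degree.\<close>

lemma homogeneous_partial_deriv:
  assumes P: "polynomial_function P" and hom: "homogeneous l P"
  shows "homogeneous (l - 1) (partial_deriv b P)"
proof (cases l)
  case 0
  with hom obtain c where "P = (\<lambda>x. c)"
    using homogeneous_0_const by blast
  then show ?thesis
    by (simp add: homogeneous_def)
next
  case (Suc k)
  have nz: "partial_deriv b P (t *\<^sub>R x) = of_real t ^ k * partial_deriv b P x" if "t \<noteq> 0" for t :: real and x
  proof -
    have "((\<lambda>x. P (t *\<^sub>R x)) has_derivative (\<lambda>h. frechet_derivative P (at (t *\<^sub>R x)) (t *\<^sub>R h))) (at x)"
    proof (rule has_derivative_compose[where f = "\<lambda>x. t *\<^sub>R x" and g = P])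
      show "(P has_derivative frechet_derivative P (at (t *\<^sub>R x))) (at (t *\<^sub>R x))"
        using P by (simp flip: frechet_derivative_works)
    qed (auto intro!: derivative_eq_intros)
    moreover have "((\<lambda>x. P (t *\<^sub>R x)) has_derivative (\<lambda>h. of_real t ^ l * frechet_derivative P (at x) h)) (at x)"
      using hom P unfolding homogeneous_def
      by (auto intro!: has_derivative_mult_right simp flip: frechet_derivative_works)
    ultimately have "(\<lambda>h. frechet_derivative P (at (t *\<^sub>R x)) (t *\<^sub>R h)) = (\<lambda>h. of_real t ^ l * frechet_derivative P (at x) h)"
      by (rule has_derivative_unique)
    from fun_cong[OF this, of b] have "frechet_derivative P (at (t *\<^sub>R x)) (t *\<^sub>R b) = of_real t ^ l * partial_deriv b P x"
      by (simp add: partial_deriv_def)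
    moreover have "frechet_derivative P (at (t *\<^sub>R x)) (t *\<^sub>R b) = of_real t * partial_deriv b P (t *\<^sub>R x)"
      using P linear_scale[OF linear_frechet_derivative, of P "at (t *\<^sub>R x)" t b]
      by (simp add: partial_deriv_def scaleR_conv_of_real)
    ultimately show ?thesis
      using that by (simp add: Suc)
  qed
  have lim: "((\<lambda>t. partial_deriv b P (t *\<^sub>R x)) \<longlongrightarrow> partial_deriv b P (0 *\<^sub>R x)) (at (0::real))"
    "((\<lambda>t. of_real t ^ k * partial_deriv b P x) \<longlongrightarrow> of_real 0 ^ k * partial_deriv b P x) (at (0::real))" for x
  proof -
    have "continuous_on UNIV (\<lambda>t::real. partial_deriv b P (t *\<^sub>R x))"
      by (rule continuous_on_compose2[OF polynomial_function_continuous_on[OF polynomial_function_partial_deriv[OF P], of UNIV]])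
         (auto intro!: continuous_intros)
    then show "((\<lambda>t. partial_deriv b P (t *\<^sub>R x)) \<longlongrightarrow> partial_deriv b P (0 *\<^sub>R x)) (at (0::real))"
      by (auto simp: continuous_on_def dest: spec[of _ 0])
  qed (intro tendsto_intros)
  have "partial_deriv b P (t *\<^sub>R x) = of_real t ^ k * partial_deriv b P x" for t :: real and x
  proof (cases "t = 0")
    case True
    have "((\<lambda>t. partial_deriv b P (t *\<^sub>R x)) \<longlongrightarrow> of_real 0 ^ k * partial_deriv b P x) (at (0::real))"
      by (rule Lim_transform_eventually[OF lim(2)]) (auto simp: nz eventually_at_filter)
    with lim(1) True show ?thesis
      using tendsto_unique[OF trivial_limit_at] by blast
  qed (rule nz)
  then show ?thesis
    by (simp add: homogeneous_def Suc)
qed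

lemma solid_harmonics_partial_deriv:
  assumes "H \<in> solid_harmonics l"
  shows "partial_deriv b H \<in> solid_harmonics (l - 1)"
proof -
  have "laplacian H = (\<lambda>x. 0)"
    using assms by (auto simp: solid_harmonics_iff)
  then show ?thesis
    using assms by (auto simp: solid_harmonics_iff homogeneous_partial_deriv[simplified] laplacian_partial_deriv)
qed

lemma solid_harmonics_scale:
  "H \<in> solid_harmonics l \<Longrightarrow> (\<lambda>x. c * H x) \<in> solid_harmonics l"
  by (auto simp: solid_harmonics_iff homogeneous_def laplacian_cmult)

lemma solid_harmonics_cnj: "H \<in> solid_harmonics l \<Longrightarrow> (\<lambda>x. cnj (H x)) \<in> solid_harmonics l"
  by (auto simp: solid_harmonics_iff homogeneous_def laplacian_cnj)

section \<open>Solid harmonics multiplied by |x|^2 and by coordinates\<close>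

definition norm_sq :: "'a::euclidean_space \<Rightarrow> complex" where
  "norm_sq x = of_real ((norm x)\<^sup>2)"

lemma norm_sq_scaleR: "norm_sq (t *\<^sub>R x) = of_real t ^ 2 * norm_sq x"
  unfolding norm_sq_def of_real_power[symmetric] of_real_mult[symmetric] norm_scaleR power_mult_distrib power2_abs ..

lemma norm_sq_eq: "norm_sq = (\<lambda>x. \<Sum>b\<in>Basis. of_real (x \<bullet> b) * of_real (x \<bullet> b))"
  unfolding norm_sq_def power2_norm_eq_inner by (rule ext, subst euclidean_inner) simp

lemma polynomial_function_norm_sq [intro]: "polynomial_function norm_sq"
  unfolding norm_sq_eq by (intro polynomial_function_sum) auto

lemma partial_deriv_norm_sq:
  fixes b :: "'a::euclidean_space"
  assumes "b \<in> Basis"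
  shows "partial_deriv b norm_sq = (\<lambda>x. 2 * of_real (x \<bullet> b))"
proof -
  have "partial_deriv b (\<lambda>x. of_real (x \<bullet> c) * of_real (x \<bullet> c)) = (\<lambda>x. if c = b then 2 * of_real (x \<bullet> b) else 0)"
    if "c \<in> Basis" for c
    using assms that
    by (auto simp: partial_deriv_mult polynomial_function_coord partial_deriv_coord fun_eq_iff inner_Basis)
  then have "partial_deriv b norm_sq = (\<lambda>x. \<Sum>c\<in>Basis. if c = b then 2 * of_real (x \<bullet> b) else 0)"
    unfolding norm_sq_eq by (subst partial_deriv_sum) (auto intro!: polynomial_function_complex_mult)
  with assms show ?thesis
    by simp
qed

lemma laplacian_norm_sq: "laplacian (norm_sq :: 'a \<Rightarrow> complex) (x::'a::euclidean_space) = 2 * of_nat DIM('a)"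
  by (simp add: laplacian_def partial_deriv_norm_sq partial_deriv_cmult polynomial_function_coord partial_deriv_coord)

text \<open>Delta |x|^2 is 2 n, and the cross term of the product rule is 4 x . grad G, which equals
  4 l G by Euler's identity.\<close>

lemma laplacian_norm_sq_mult:
  fixes G :: "'a::euclidean_space \<Rightarrow> complex"
  assumes "G \<in> solid_harmonics l"
  shows "laplacian (\<lambda>x. norm_sq x * G x) x = 2 * of_nat (DIM('a) + 2 * l) * G x"
proof -
  have G: "polynomial_function G" "homogeneous l G" "laplacian G x = 0"
    using assms by (auto simp: solid_harmonics_iff)
  have "laplacian (\<lambda>x. norm_sq x * G x) x = 4 * (\<Sum>b\<in>Basis. of_real (x \<bullet> b) * partial_deriv b G x) + 2 * of_nat DIM('a) * G x"
    using G by (subst laplacian_mult)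
      (simp_all add: polynomial_function_norm_sq laplacian_norm_sq partial_deriv_norm_sq sum_distrib_left mult.assoc)
  then show ?thesis
    unfolding euler_homogeneous[OF G(1,2)] by (simp add: algebra_simps)
qed

text \<open>Since H is harmonic, Delta (x_b H) = 2 d_b H. The derivative d_b H is itself a solid
  harmonic, so a suitable multiple of |x|^2 d_b H has the same Laplacian and can be
  subtracted.\<close>

lemma coord_mult_solid_harmonic:
  fixes H :: "'a::euclidean_space \<Rightarrow> complex"
  assumes H: "H \<in> solid_harmonics l" and b: "b \<in> Basis"
  obtains H1 H2 where "H1 \<in> solid_harmonics (l + 1)" "H2 \<in> solid_harmonics (l - 1)"
    "\<And>x. of_real (x \<bullet> b) * H x = H1 x + norm_sq x * H2 x"
proof -
  have pH: "polynomial_function H" "homogeneous l H" "\<And>x. laplacian H x = 0"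
    using H by (auto simp: solid_harmonics_iff)
  \<comment> \<open>Chosen so that Delta (|x|^2 d_b H) = 2 D d_b H, with d_b H of degree l -
    1.\<close>
  define D where "D = of_nat (DIM('a) + 2 * (l - 1)) * (1::complex)"
  have D: "D \<noteq> 0"
    unfolding D_def mult_1_right of_nat_eq_0_iff using DIM_positive[where 'a = 'a] by auto
  define H2 where "H2 = (\<lambda>x. 1 / D * partial_deriv b H x)"
  have H2: "H2 \<in> solid_harmonics (l - 1)"
    unfolding H2_def by (intro solid_harmonics_scale solid_harmonics_partial_deriv H)
  then have pH2: "polynomial_function H2" "homogeneous (l - 1) H2"
    by (auto simp: solid_harmonics_iff)
  define H1 where "H1 = (\<lambda>x. of_real (x \<bullet> b) * H x + (-1) * (norm_sq x * H2 x))"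
  have lap1: "laplacian (\<lambda>x. of_real (x \<bullet> b) * H x) x = 2 * partial_deriv b H x" for x
  proof -
    have "(\<Sum>c\<in>Basis. complex_of_real (c \<bullet> b) * partial_deriv c H x) = partial_deriv b H x"
      using b by (simp add: inner_Basis if_distrib[of "\<lambda>r. of_real r * _"] cong: if_cong)
    then show ?thesis
      using pH by (simp add: laplacian_mult polynomial_function_coord partial_deriv_coord laplacian_coord)
  qed
  have p1: "polynomial_function (\<lambda>x. of_real (x \<bullet> b) * H x)" and p2: "polynomial_function (\<lambda>x. norm_sq x * H2 x)"
    using pH pH2 by auto
  have "laplacian H1 x = 0" for x
  proof -
    have "laplacian H1 x = 2 * partial_deriv b H x - laplacian (\<lambda>x. norm_sq x * H2 x) x"
      unfolding H1_def
      by (simp only: laplacian_add[OF p1 polynomial_function_complex_mult[OF polynomial_function_const p2]]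
          laplacian_cmult[OF p2] lap1) simp
    also have "\<dots> = 0"
      unfolding laplacian_norm_sq_mult[OF H2] using D unfolding H2_def D_def by (simp add: field_simps)
    finally show ?thesis .
  qed
  moreover have "polynomial_function H1"
    unfolding H1_def using pH pH2 by (intro polynomial_function_add polynomial_function_complex_mult) auto
  moreover have "homogeneous (l + 1) H1"
  \<comment> \<open>Here H is constant and \<open>H2\<close> is 0, so the truncation of l - 1 does
    no harm.\<close>
  proof (cases "l = 0")
    case True
    with pH(2) obtain c where "H = (\<lambda>x. c)"
      using homogeneous_0_const by blast
    then show ?thesis
      using pH(2) by (simp add: H1_def H2_def homogeneous_def True)
  next
    case False
    then show ?thesis
      using pH(2) pH2(2) by (cases l) (simp_all add: H1_def homogeneous_def power_mult_distrib algebra_simps norm_sq_scaleR power2_eq_square)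
  qed
  ultimately have "H1 \<in> solid_harmonics (l + 1)"
    by (simp add: solid_harmonics_iff)
  from this H2 show ?thesis
    by (rule that) (simp add: H1_def)
qed

subsection \<open>Orthogonality on the sphere\<close>

lemma sets_sphere_measure [simp, measurable_cong]:
  "sets (sphere_measure :: 'a::euclidean_space measure) = sets (restrict_space borel (sphere 0 1))"
  by (simp add: sphere_measure_def)

lemma space_sphere_measure [simp]: "space (sphere_measure :: 'a::euclidean_space measure) = sphere 0 1"
  by (simp add: sphere_measure_def space_scale_measure space_restrict_space)

lemma emeasure_sphere_measure:
  fixes A :: "'a::euclidean_space set"
  assumes "A \<in> sets sphere_measure"
  shows "emeasure sphere_measure A = of_nat DIM('a) * emeasure lborel {x \<in> cball 0 1 - {0}. sgn x \<in> A}"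
proof -
  have "emeasure (distr (restrict_space lborel (cball 0 1 - {0})) (restrict_space borel (sphere 0 1)) sgn) A
      = emeasure (restrict_space lborel (cball 0 1 - {0})) (sgn -` A \<inter> space (restrict_space lborel (cball 0 1 - {0 :: 'a})))"
    using assms by (intro emeasure_distr sgn_measurable_sphere) simp
  also have "sgn -` A \<inter> space (restrict_space lborel (cball 0 1 - {0 :: 'a})) = {x \<in> cball 0 1 - {0}. sgn x \<in> A}"
    by (auto simp: space_restrict_space)
  also have "emeasure (restrict_space lborel (cball 0 1 - {0})) \<dots> = emeasure lborel {x \<in> cball 0 1 - {0}. sgn x \<in> A}"
    by (rule emeasure_restrict_space) auto
  finally show ?thesis
    by (simp add: sphere_measure_def)
qed

lemma finite_measure_sphere_measure: "finite_measure (sphere_measure :: 'a::euclidean_space measure)"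
proof (rule finite_measureI)
  have "emeasure lborel {x \<in> cball 0 1 - {0}. sgn x \<in> (sphere 0 1 :: 'a set)} \<le> emeasure lborel (cball (0::'a) 1)"
    by (intro emeasure_mono) auto
  also have "\<dots> < \<infinity>"
    by (intro emeasure_bounded_finite) simp
  finally show "emeasure (sphere_measure :: 'a measure) (space sphere_measure) \<noteq> \<infinity>"
    by (subst emeasure_sphere_measure)
      (auto simp: ennreal_mult_eq_top_iff sets_restrict_space less_top[symmetric] image_iff intro!: bexI[of _ "sphere 0 1"])
qed

lemma continuous_on_measurable_sphere:
  fixes f :: "'a::euclidean_space \<Rightarrow> 'b::topological_space"
  assumes "continuous_on UNIV f"
  shows "f \<in> borel_measurable sphere_measure"
  using borel_measurable_continuous_onI[OF assms]
  by (simp add: measurable_cong_sets[OF sets_sphere_measure refl] measurable_restrict_space1)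

lemma integrable_sphere_continuous:
  fixes f :: "'a::euclidean_space \<Rightarrow> complex"
  assumes "continuous_on UNIV f"
  shows "integrable sphere_measure f"
proof -
  interpret finite_measure "sphere_measure :: 'a measure"
    by (rule finite_measure_sphere_measure)
  have "compact (f ` sphere 0 1)"
    using assms by (intro compact_continuous_image) (auto intro: continuous_on_subset)
  then obtain K where "\<And>x. x \<in> sphere 0 1 \<Longrightarrow> norm (f x) \<le> K"
    using compact_imp_bounded bounded_iff by (metis imageI)
  then show ?thesis
    using assms by (intro integrable_const_bound[of _ K] AE_I2 continuous_on_measurable_sphere) auto
qed

section \<open>Rotation invariance of the surface measure\<close>

definition shear :: "real \<Rightarrow> 'a \<Rightarrow> 'a \<Rightarrow> 'a \<Rightarrow> 'a::euclidean_space" where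
  "shear t i j x = x + (t * (x \<bullet> j)) *\<^sub>R i"

lemma continuous_on_shear [continuous_intros]: "continuous_on S f \<Longrightarrow> continuous_on S (\<lambda>x. shear t i j (f x))"
  unfolding shear_def by (intro continuous_intros)

lemma shear_measurable [measurable]: "shear t i j \<in> borel_measurable borel"
  by (intro borel_measurable_continuous_onI continuous_intros)

text \<open>A shear is a translation of the coordinate along i by an amount that depends on another
  coordinate only, so Fubini's theorem reduces the claim to translation invariance on the
  line.\<close>

lemma distr_lborel_shear:
  fixes i j :: "'a::euclidean_space"
  assumes ij: "i \<in> Basis" "j \<in> Basis" "i \<noteq> j"
  shows "distr lborel borel (shear t i j) = lborel"
proof (rule measure_eqI)
  fix A :: "'a set" assume "A \<in> sets (distr lborel borel (shear t i j))"
  then have A [measurable]: "A \<in> sets borel"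
    by simp
  interpret product_sigma_finite "\<lambda>_. lborel :: real measure"
    by standard
  define F where "F f = (\<Sum>b\<in>Basis. f b *\<^sub>R b)" for f :: "'a \<Rightarrow> real"
  have F [measurable]: "F \<in> measurable (\<Pi>\<^sub>M b\<in>Basis. lborel) borel"
    unfolding F_def by measurable
  have lb: "lborel = distr (\<Pi>\<^sub>M b\<in>Basis. lborel) borel F"
    unfolding lborel_def[where 'a = 'a] lborel_eq_real F_def ..
  have ins: "insert i (Basis - {i}) = Basis"
    using ij by auto
  have F_upd: "F (f(i := y)) = F (f(i := 0)) + y *\<^sub>R i" for f y
    using ij unfolding F_def by (simp add: sum.remove[of Basis i])
  have F_inner: "F f \<bullet> j = f j" for f
    using ij unfolding F_def by (simp add: inner_sum_left inner_Basis if_distrib cong: if_cong)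
  have shear_F: "shear t i j (F (f(i := y))) = F (f(i := t * f j + 1 * y))" for f y
    using ij by (subst (1 2) F_upd) (simp add: shear_def inner_add_left F_inner inner_Basis algebra_simps)
  \<comment> \<open>Fubini's theorem with the coordinate along \<open>i\<close> innermost.\<close>
  have split: "emeasure lborel B = (\<integral>\<^sup>+ f. (\<integral>\<^sup>+ y. indicator B (F (f(i := y))) \<partial>lborel) \<partial>(\<Pi>\<^sub>M b\<in>Basis - {i}. lborel))"
    if [measurable]: "B \<in> sets borel" for B
  proof -
    have [measurable]: "F \<in> measurable (\<Pi>\<^sub>M b\<in>insert i (Basis - {i}). lborel) borel"
      using F by (simp only: ins)
    have "emeasure lborel B = (\<integral>\<^sup>+ x. indicator B x \<partial>distr (\<Pi>\<^sub>M b\<in>Basis. lborel) borel F)"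
      unfolding lb[symmetric] by simp
    also have "\<dots> = (\<integral>\<^sup>+ f. indicator B (F f) \<partial>(\<Pi>\<^sub>M b\<in>insert i (Basis - {i}). lborel))"
      unfolding ins by (rule nn_integral_distr) measurable
    also have "\<dots> = (\<integral>\<^sup>+ f. (\<integral>\<^sup>+ y. indicator B (F (f(i := y))) \<partial>lborel) \<partial>(\<Pi>\<^sub>M b\<in>Basis - {i}. lborel))"
      by (rule product_nn_integral_insert) (simp, simp, measurable)
    finally show ?thesis .
  qed
  have "emeasure (distr lborel borel (shear t i j)) A = emeasure lborel (shear t i j -` A)"
    by (simp add: emeasure_distr)
  also have "\<dots> = (\<integral>\<^sup>+ f. (\<integral>\<^sup>+ y. indicator A (F (f(i := t * f j + 1 * y))) \<partial>lborel) \<partial>(\<Pi>\<^sub>M b\<in>Basis - {i}. lborel))"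
    using measurable_sets_borel[OF shear_measurable A]
    by (subst split) (auto simp: shear_F indicator_def intro!: nn_integral_cong)
  also have "\<dots> = (\<integral>\<^sup>+ f. (\<integral>\<^sup>+ y. indicator A (F (f(i := y))) \<partial>lborel) \<partial>(\<Pi>\<^sub>M b\<in>Basis - {i}. lborel))"
  proof (rule nn_integral_cong)
    fix f
    have "(\<lambda>y. F (f(i := 0)) + y *\<^sub>R i) \<in> borel_measurable borel"
      by measurable
    then have "(\<lambda>y. F (f(i := y))) \<in> borel_measurable borel"
      by (simp only: F_upd[symmetric])
    then have "(\<lambda>y. indicator A (F (f(i := y))) :: ennreal) \<in> borel_measurable borel"
      by measurable
    from nn_integral_real_affine[OF this, of 1 "t * f j"]
    show "(\<integral>\<^sup>+ y. indicator A (F (f(i := t * f j + 1 * y))) \<partial>lborel) = (\<integral>\<^sup>+ y. indicator A (F (f(i := y))) \<partial>lborel)"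
      by simp
  qed
  also have "\<dots> = emeasure lborel A"
    by (rule split[symmetric]) measurable
  finally show "emeasure (distr lborel borel (shear t i j)) A = emeasure lborel A" .
qed simp

text \<open>The rotation by the angle $2\arctan t$ in the plane of \<open>i\<close> and \<open>j\<close>, as a product of shears.\<close>

definition rot :: "real \<Rightarrow> 'a \<Rightarrow> 'a \<Rightarrow> 'a \<Rightarrow> 'a::euclidean_space" where
  "rot t i j = shear (- t) i j \<circ> shear (2 * t / (1 + t\<^sup>2)) j i \<circ> shear (- t) i j"

lemma rot_measurable [measurable]: "rot t i j \<in> borel_measurable borel"
  unfolding rot_def
  by (rule measurable_comp[OF shear_measurable measurable_comp[OF shear_measurable shear_measurable]])

lemma distr_lborel_rot:
  fixes i j :: "'a::euclidean_space"
  assumes "i \<in> Basis" "j \<in> Basis" "i \<noteq> j"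
  shows "distr lborel borel (rot t i j) = lborel"
proof -
  have "distr lborel borel (rot t i j) =
      distr (distr (distr lborel borel (shear (- t) i j)) borel (shear (2 * t / (1 + t\<^sup>2)) j i)) borel (shear (- t) i j)"
    unfolding rot_def by (simp add: distr_distr comp_assoc)
  then show ?thesis
    using assms by (simp add: distr_lborel_shear)
qed

context
  fixes i j :: "'a::euclidean_space"
  assumes ij: "i \<in> Basis" "j \<in> Basis" "i \<noteq> j"
begin

text \<open>For t = tan (theta/2) the three shears have the factors - tan (theta/2), sin theta and -
  tan (theta/2), the standard factorisation of the rotation by theta; everything stays rational in
  t. The displacement is written with the factor t pulled out, as the difference quotient at t = 0
  requires.\<close>

lemma rot_eq:
  "rot t i j x = x + (t / (1 + t\<^sup>2)) *\<^sub>R ((- 2 * (x \<bullet> j) - 2 * t * (x \<bullet> i)) *\<^sub>R i + (2 * (x \<bullet> i) - 2 * t * (x \<bullet> j)) *\<^sub>R j)"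
proof -
  have [simp]: "i \<bullet> i = 1" "j \<bullet> j = 1" "i \<bullet> j = 0" "j \<bullet> i = 0"
    using ij by (auto simp: inner_Basis)
  define s where "s = 2 * t / (1 + t\<^sup>2)"
  have pos: "1 + t\<^sup>2 > 0"
    by (simp add: add_pos_nonneg)
  have "rot t i j x = x + (- t * (x \<bullet> j) - t * (x \<bullet> j + s * (x \<bullet> i - t * (x \<bullet> j)))) *\<^sub>R i
      + (s * (x \<bullet> i - t * (x \<bullet> j))) *\<^sub>R j"
    unfolding rot_def s_def[symmetric] 
    by (simp add: shear_def inner_add_left inner_diff_left algebra_simps, simp flip: scaleR_add_left)
  also have "- t * (x \<bullet> j) - t * (x \<bullet> j + s * (x \<bullet> i - t * (x \<bullet> j))) = t / (1 + t\<^sup>2) * (- 2 * (x \<bullet> j) - 2 * t * (x \<bullet> i))"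
    using pos unfolding s_def by (simp add: field_simps power2_eq_square)
  also have "s * (x \<bullet> i - t * (x \<bullet> j)) = t / (1 + t\<^sup>2) * (2 * (x \<bullet> i) - 2 * t * (x \<bullet> j))"
    unfolding s_def by simp
  finally show ?thesis
    by (simp add: scaleR_add_right)
qed

lemma norm_rot: "norm (rot t i j x) = norm x"
proof -
  have [simp]: "i \<bullet> i = 1" "j \<bullet> j = 1" "i \<bullet> j = 0" "j \<bullet> i = 0"
    using ij by (auto simp: inner_Basis)
  have pos: "1 + t\<^sup>2 \<noteq> 0"
    by (metis add_pos_nonneg less_irrefl zero_le_power2 zero_less_one)
  define k u v where "k = t / (1 + t\<^sup>2)" and "u = x \<bullet> i" and "v = x \<bullet> j"
  have k: "k * (1 + t\<^sup>2) = t"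
    using pos by (simp add: k_def)
  have "rot t i j x \<bullet> rot t i j x
      = x \<bullet> x + 2 * (k * (- 2 * v - 2 * t * u)) * u + 2 * (k * (2 * u - 2 * t * v)) * v
        + (k * (- 2 * v - 2 * t * u))\<^sup>2 + (k * (2 * u - 2 * t * v))\<^sup>2"
    unfolding rot_eq k_def[symmetric] u_def[symmetric] v_def[symmetric]
    by (simp add: inner_add_left inner_add_right inner_commute[of i x] inner_commute[of j x] power2_eq_square
        algebra_simps flip: u_def v_def)
  also have "\<dots> = x \<bullet> x - 4 * k * (t - k * (1 + t\<^sup>2)) * (u\<^sup>2 + v\<^sup>2)"
    by (simp add: power2_eq_square algebra_simps)
  also have "\<dots> = x \<bullet> x"
    by (simp add: k)
  finally have "rot t i j x \<bullet> rot t i j x = x \<bullet> x" .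
  then show ?thesis
    by (simp add: norm_eq_sqrt_inner)
qed

lemma rot_scaleR: "rot t i j (c *\<^sub>R x) = c *\<^sub>R rot t i j x"
  unfolding rot_eq by (simp add: algebra_simps)

lemma sgn_rot: "sgn (rot t i j x) = rot t i j (sgn x)"
  by (simp add: sgn_div_norm norm_rot rot_scaleR)

text \<open>The rotation commutes with \<open>sgn\<close> and preserves the punctured ball, so it
  pulls the cone over A back to the cone over the preimage of A; on cones it preserves Lebesgue
  measure.\<close>

lemma distr_sphere_measure_rot: "distr sphere_measure sphere_measure (rot t i j) = sphere_measure"
proof (rule measure_eqI)
  have rotm [measurable]: "rot t i j \<in> measurable sphere_measure sphere_measure"
    unfolding measurable_cong_sets[OF refl sets_sphere_measure]
  proof (rule measurable_restrict_space2)
    show "rot t i j \<in> borel_measurable sphere_measure"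
      by (simp add: measurable_cong_sets[OF sets_sphere_measure refl] measurable_restrict_space1)
  qed (auto simp: norm_rot)
  fix A :: "'a set" assume "A \<in> sets (distr sphere_measure sphere_measure (rot t i j))"
  then have A [measurable]: "A \<in> sets sphere_measure"
    by simp
  then have [measurable]: "A \<in> sets borel"
    by (auto simp: sets_restrict_space)
  have [measurable]: "sgn \<in> borel_measurable (borel :: 'a measure)"
    unfolding sgn_div_norm by measurable
  have nz: "rot t i j x = 0 \<longleftrightarrow> x = 0" for x
    by (metis norm_rot norm_eq_zero)
  have "emeasure (distr sphere_measure sphere_measure (rot t i j)) A
      = emeasure sphere_measure {x \<in> sphere 0 1. rot t i j x \<in> A}"
    unfolding emeasure_distr[OF rotm A] by (auto intro!: arg_cong2[where f = emeasure])
  also have "\<dots> = of_nat DIM('a) * emeasure lborel {x \<in> cball 0 1 - {0}. sgn x \<in> {x \<in> sphere 0 1. rot t i j x \<in> A}}"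
    using measurable_sets[OF rotm A]
    by (intro emeasure_sphere_measure) (simp add: vimage_def Int_def conj_commute)
  also have "{x \<in> cball 0 1 - {0}. sgn x \<in> {x \<in> sphere 0 1. rot t i j x \<in> A}}
      = rot t i j -` {x \<in> cball 0 1 - {0}. sgn x \<in> A} \<inter> space lborel"
    by (auto simp: norm_rot sgn_rot norm_sgn nz)
  also have "emeasure lborel \<dots> = emeasure (distr lborel borel (rot t i j)) {x \<in> cball 0 1 - {0}. sgn x \<in> A}"
    by (rule emeasure_distr[symmetric]) measurable
  finally show "emeasure (distr sphere_measure sphere_measure (rot t i j)) A = emeasure sphere_measure A"
    using A by (simp only: distr_lborel_rot[OF ij] emeasure_sphere_measure)
qed simp

text \<open>With the difference quotient \<open>D\<close> continuous up to \<open>t = 0\<close>, no differentiation under the integral is needed.\<close>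

lemma polynomial_rot_difference:
  fixes F :: "'a \<Rightarrow> complex"
  assumes "polynomial_function F"
  shows "\<exists>D. continuous_on UNIV (\<lambda>(t, x). D t x) \<and> (\<forall>t x. F (rot t i j x) = F x + of_real t * D t x) \<and>
    (\<forall>x. D 0 x = 2 * (of_real (x \<bullet> i) * partial_deriv j F x - of_real (x \<bullet> j) * partial_deriv i F x))"
  using assms
proof (induction rule: polynomial_function_complex_induct)
  case (const c)
  show ?case
    by (intro exI[of _ "\<lambda>_ _. 0"]) simp
next
  case (coord b)
  define D where "D t x = complex_of_real (1 / (1 + t\<^sup>2) *
      ((- 2 * (x \<bullet> j) - 2 * t * (x \<bullet> i)) * (i \<bullet> b) + (2 * (x \<bullet> i) - 2 * t * (x \<bullet> j)) * (j \<bullet> b)))" for t x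
  have "1 + t\<^sup>2 \<noteq> 0" for t :: real
    by (metis add_pos_nonneg less_irrefl zero_le_power2 zero_less_one)
  then have "continuous_on UNIV (\<lambda>(t, x). D t x)"
    unfolding D_def case_prod_beta by (intro continuous_intros) auto
  moreover have "of_real (rot t i j x \<bullet> b) = of_real (x \<bullet> b) + of_real t * D t x" for t x
    unfolding D_def rot_eq of_real_mult[symmetric] of_real_add[symmetric] by (simp add: inner_add_left inner_diff_left)
  ultimately show ?case
    by (intro exI[of _ D]) (simp add: D_def partial_deriv_coord algebra_simps)
next
  case (add f g)
  then obtain D E where "continuous_on UNIV (\<lambda>(t, x). D t x)" "\<forall>t x. f (rot t i j x) = f x + of_real t * D t x"
    "\<forall>x. D 0 x = 2 * (of_real (x \<bullet> i) * partial_deriv j f x - of_real (x \<bullet> j) * partial_deriv i f x)"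
    "continuous_on UNIV (\<lambda>(t, x). E t x)" "\<forall>t x. g (rot t i j x) = g x + of_real t * E t x"
    "\<forall>x. E 0 x = 2 * (of_real (x \<bullet> i) * partial_deriv j g x - of_real (x \<bullet> j) * partial_deriv i g x)"
    by blast
  then show ?case
    unfolding partial_deriv_add[OF add(1,2)]
    by (intro exI[of _ "\<lambda>t x. D t x + E t x"]) (simp add: case_prod_beta continuous_on_add ring_distribs)
next
  case (mult f g)
  then obtain D E where DE: "continuous_on UNIV (\<lambda>(t, x). D t x)" "\<forall>t x. f (rot t i j x) = f x + of_real t * D t x"
    "\<forall>x. D 0 x = 2 * (of_real (x \<bullet> i) * partial_deriv j f x - of_real (x \<bullet> j) * partial_deriv i f x)"
    "continuous_on UNIV (\<lambda>(t, x). E t x)" "\<forall>t x. g (rot t i j x) = g x + of_real t * E t x"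
    "\<forall>x. E 0 x = 2 * (of_real (x \<bullet> i) * partial_deriv j g x - of_real (x \<bullet> j) * partial_deriv i g x)"
    by blast
  have "continuous_on UNIV (\<lambda>z. f (snd z))" "continuous_on UNIV (\<lambda>z. g (snd z))"
    using mult by (auto intro!: continuous_on_compose2[of UNIV _ _ snd] continuous_intros polynomial_function_continuous_on)
  \<comment> \<open>Writing f', g' for the rotated functions, f' g' - f g = (f' - f) g' + f (g' -
    g), where g' = g + t E.\<close>
  with DE(1,4) have "continuous_on UNIV (\<lambda>(t, x). D t x * (g x + of_real t * E t x) + f x * E t x)"
    unfolding case_prod_beta by (intro continuous_intros) auto
  then show ?case
    by (intro exI[of _ "\<lambda>t x. D t x * (g x + of_real t * E t x) + f x * E t x"] conjI allI)
       (simp_all add: partial_deriv_mult[OF mult(1,2)] DE(2,3,5,6)[rule_format] ring_distribs mult_ac)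
qed

text \<open>By invariance, F and its composition with \<open>rot t i j\<close> have the same
  integral, so that of the quotient \<open>D t\<close> is 0 for t ~= 0. Dominated convergence
  carries this to t = 0, where \<open>D\<close> is twice the infinitesimal rotation x_i d_j - x_j
  d_i applied to F.\<close>

lemma integral_sphere_rotation_field:
  fixes F :: "'a \<Rightarrow> complex"
  assumes F: "polynomial_function F"
  shows "(LINT x|sphere_measure. of_real (x \<bullet> i) * partial_deriv j F x) = (LINT x|sphere_measure. of_real (x \<bullet> j) * partial_deriv i F x)"
proof -
  interpret finite_measure "sphere_measure :: 'a measure"
    by (rule finite_measure_sphere_measure)
  obtain D where D: "continuous_on UNIV (\<lambda>(t, x). D t x)" "\<And>t x. F (rot t i j x) = F x + of_real t * D t x"
    "\<And>x. D 0 x = 2 * (of_real (x \<bullet> i) * partial_deriv j F x - of_real (x \<bullet> j) * partial_deriv i F x)"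
    using polynomial_rot_difference[OF F] by blast
  have cD: "continuous_on UNIV (D t)" for t
    using continuous_on_compose2[OF D(1), of UNIV "\<lambda>x. (t, x)"] by (simp add: continuous_intros)
  have cF: "continuous_on UNIV F"
    using F by auto
  have D0: "(LINT x|sphere_measure. D t x) = 0" if "t \<noteq> 0" for t
  proof -
    have "(LINT x|sphere_measure. F x) = (LINT x|distr sphere_measure sphere_measure (rot t i j). F x)"
      by (simp add: distr_sphere_measure_rot)
    also have "\<dots> = (LINT x|sphere_measure. F (rot t i j x))"
    proof (rule integral_distr)
      show "rot t i j \<in> measurable sphere_measure sphere_measure"
        unfolding measurable_cong_sets[OF refl sets_sphere_measure]
      proof (rule measurable_restrict_space2)
        show "rot t i j \<in> borel_measurable sphere_measure"
          by (simp add: measurable_cong_sets[OF sets_sphere_measure refl] measurable_restrict_space1)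
      qed (auto simp: norm_rot)
    qed (rule continuous_on_measurable_sphere[OF cF])
    also have "\<dots> = (LINT x|sphere_measure. F x) + of_real t * (LINT x|sphere_measure. D t x)"
      by (simp add: D(2) integrable_sphere_continuous cF cD)
    finally show ?thesis
      using that by simp
  qed
  have "compact ((\<lambda>(t, x). D t x) ` ({0..1} \<times> sphere 0 1))"
    by (intro compact_continuous_image continuous_on_subset[OF D(1)] compact_Times) auto
  then obtain K where bound: "\<forall>z\<in>(\<lambda>(t, x). D t x) ` ({0..1} \<times> sphere 0 1). norm z \<le> K"
    using compact_imp_bounded bounded_iff by metis
  have K: "norm (D t x) \<le> K" if "t \<in> {0..1}" "x \<in> sphere 0 1" for t x
    using bspec[OF bound, of "D t x"] that by force
  have "(\<lambda>n. LINT x|sphere_measure. D (inverse (real (Suc n))) x) \<longlonglongrightarrow> (LINT x|sphere_measure. D 0 x)"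
  proof (rule integral_dominated_convergence)
    show "integrable (sphere_measure :: 'a measure) (\<lambda>x. K)"
      by (rule integrable_const)
    show "AE x in sphere_measure. norm (D (inverse (real (Suc n))) x) \<le> K" for n
      by (intro AE_I2 K) (auto simp: field_simps)
    show "AE x in sphere_measure. (\<lambda>n. D (inverse (real (Suc n))) x) \<longlonglongrightarrow> D 0 x"
    proof (rule AE_I2)
      fix x :: 'a
      have "continuous_on UNIV (\<lambda>t. D t x)"
        using continuous_on_compose2[OF D(1), of UNIV "\<lambda>t. (t, x)"] by (simp add: continuous_intros)
      then have "isCont (\<lambda>t. D t x) 0"
        by (simp add: continuous_on_eq_continuous_at)
      then show "(\<lambda>n. D (inverse (real (Suc n))) x) \<longlonglongrightarrow> D 0 x"
        by (rule isCont_tendsto_compose) (rule LIMSEQ_inverse_real_of_nat)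
    qed
  qed (intro continuous_on_measurable_sphere cD)+
  then have "(LINT x|sphere_measure. D 0 x) = 0"
    by (simp add: D0 LIMSEQ_const_iff del: of_nat_Suc)
  moreover have "integrable sphere_measure (\<lambda>x. of_real (x \<bullet> b) * partial_deriv c F x)" for b c
    using F by (intro integrable_sphere_continuous continuous_intros polynomial_function_continuous_on) auto
  ultimately show ?thesis
    by (simp add: D(3))
qed

end

text \<open>The rotation identity is applied to x_i G and summed over i. Since |x| = 1, one side
  becomes d_j G + x_j G; by Euler's identity the other becomes (n + d) x_j G. The -1 is the term x_j
  G moved across.\<close>

lemma integral_sphere_partial_deriv:
  fixes G :: "'a::euclidean_space \<Rightarrow> complex"
  assumes G: "polynomial_function G" "homogeneous d G" and j: "j \<in> Basis"
  shows "(LINT x|sphere_measure. partial_deriv j G x) =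
    (of_nat DIM('a) + of_nat d - 1) * (LINT x|sphere_measure. of_real (x \<bullet> j) * G x)"
proof -
  have int: "integrable sphere_measure (\<lambda>x. f x)" if "polynomial_function f" for f :: "'a \<Rightarrow> complex"
    using that by (intro integrable_sphere_continuous polynomial_function_continuous_on)
  have sum_sq: "(\<Sum>i\<in>Basis. of_real (x \<bullet> i) * of_real (x \<bullet> i)) = (1 :: complex)" if "x \<in> sphere 0 1" for x :: 'a
    using that fun_cong[OF norm_sq_eq, of x] by (simp add: norm_sq_def)
  have "(\<Sum>i\<in>Basis. LINT x|sphere_measure. of_real (x \<bullet> i) * partial_deriv j (\<lambda>x. of_real (x \<bullet> i) * G x) x)
      = (\<Sum>i\<in>Basis. LINT x|sphere_measure. of_real (x \<bullet> j) * partial_deriv i (\<lambda>x. of_real (x \<bullet> i) * G x) x)"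
  proof (rule sum.cong)
    fix i :: 'a assume "i \<in> Basis"
    then show "(LINT x|sphere_measure. of_real (x \<bullet> i) * partial_deriv j (\<lambda>x. of_real (x \<bullet> i) * G x) x)
      = (LINT x|sphere_measure. of_real (x \<bullet> j) * partial_deriv i (\<lambda>x. of_real (x \<bullet> i) * G x) x)"
      using integral_sphere_rotation_field[of i j "\<lambda>x. of_real (x \<bullet> i) * G x"] G j
        polynomial_function_complex_mult[OF polynomial_function_coord G(1)]
      by (cases "i = j") simp_all
  qed simp
  also have "(\<Sum>i\<in>Basis. LINT x|sphere_measure. of_real (x \<bullet> i) * partial_deriv j (\<lambda>x. of_real (x \<bullet> i) * G x) x)
      = (LINT x|sphere_measure. (\<Sum>i\<in>Basis. of_real (x \<bullet> i) * partial_deriv j (\<lambda>x. of_real (x \<bullet> i) * G x) x))"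
    using G by (subst Bochner_Integration.integral_sum)
      (auto intro!: int polynomial_function_complex_mult polynomial_function_partial_deriv polynomial_function_coord)
  also have "\<dots> = (LINT x|sphere_measure. partial_deriv j G x + of_real (x \<bullet> j) * G x)"
  proof (rule Bochner_Integration.integral_cong)
    fix x :: 'a assume x: "x \<in> space sphere_measure"
    have "(\<Sum>i\<in>Basis. of_real (x \<bullet> i) * partial_deriv j (\<lambda>x. of_real (x \<bullet> i) * G x) x)
        = (\<Sum>i\<in>Basis. of_real (x \<bullet> i) * of_real (x \<bullet> i) * partial_deriv j G x + (if i = j then of_real (x \<bullet> j) * G x else 0))"
      using G(1) j by (intro sum.cong) (auto simp: partial_deriv_mult polynomial_function_coord partial_deriv_coord inner_Basis algebra_simps)
    also have "\<dots> = partial_deriv j G x + of_real (x \<bullet> j) * G x"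
      using j x by (simp add: sum.distrib sum_sq flip: sum_distrib_right)
    finally show "(\<Sum>i\<in>Basis. of_real (x \<bullet> i) * partial_deriv j (\<lambda>x. of_real (x \<bullet> i) * G x) x)
        = partial_deriv j G x + of_real (x \<bullet> j) * G x" .
  qed simp
  also have "(\<Sum>i\<in>Basis. LINT x|sphere_measure. of_real (x \<bullet> j) * partial_deriv i (\<lambda>x. of_real (x \<bullet> i) * G x) x)
      = (LINT x|sphere_measure. (\<Sum>i\<in>Basis. of_real (x \<bullet> j) * partial_deriv i (\<lambda>x. of_real (x \<bullet> i) * G x) x))"
    using G by (subst Bochner_Integration.integral_sum)
      (auto intro!: int polynomial_function_complex_mult polynomial_function_partial_deriv polynomial_function_coord)
  also have "\<dots> = (LINT x|sphere_measure. (of_nat DIM('a) + of_nat d) * (of_real (x \<bullet> j) * G x))"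
  proof (rule Bochner_Integration.integral_cong)
    fix x :: 'a
    have "(\<Sum>i\<in>Basis. of_real (x \<bullet> j) * partial_deriv i (\<lambda>x. of_real (x \<bullet> i) * G x) x)
        = of_real (x \<bullet> j) * (\<Sum>i\<in>Basis. G x + of_real (x \<bullet> i) * partial_deriv i G x)"
      unfolding sum_distrib_left using G(1)
      by (intro sum.cong) (auto simp: partial_deriv_mult polynomial_function_coord partial_deriv_coord inner_Basis algebra_simps)
    then show "(\<Sum>i\<in>Basis. of_real (x \<bullet> j) * partial_deriv i (\<lambda>x. of_real (x \<bullet> i) * G x) x)
        = (of_nat DIM('a) + of_nat d) * (of_real (x \<bullet> j) * G x)"
      using euler_homogeneous[OF G] by (simp add: sum.distrib algebra_simps)
  qed simp
  also have "\<dots> = (of_nat DIM('a) + of_nat d) * (LINT x|sphere_measure. of_real (x \<bullet> j) * G x)"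
    by (rule integral_mult_right_zero)
  also have "(LINT x|sphere_measure. partial_deriv j G x + of_real (x \<bullet> j) * G x)
      = (LINT x|sphere_measure. partial_deriv j G x) + (LINT x|sphere_measure. of_real (x \<bullet> j) * G x)"
    using G by (intro Bochner_Integration.integral_add int) auto
  finally show ?thesis
    by (simp add: left_diff_distrib eq_diff_eq)
qed

lemma integral_sphere_solid_harmonics_mult:
  fixes P Q :: "'a::euclidean_space \<Rightarrow> complex"
  assumes P: "P \<in> solid_harmonics l" and Q: "Q \<in> solid_harmonics l'" and "l \<noteq> l'" and dim: "DIM('a) \<ge> 2"
  shows "(LINT x|sphere_measure. P x * Q x) = 0"
proof -
  have int: "integrable sphere_measure (\<lambda>x. f x)" if "polynomial_function f" for f :: "'a \<Rightarrow> complex"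
    using that by (intro integrable_sphere_continuous polynomial_function_continuous_on)
  \<comment> \<open>The product P d_b Q has degree l + l' - 1, whence the first factor; Euler's
    identity for Q supplies l'. The left side is symmetric in P and Q while the factor l' is not, so
    exchanging them compares l' with l.\<close>
  have grad: "(LINT x|sphere_measure. (\<Sum>b\<in>Basis. partial_deriv b P x * partial_deriv b Q x))
      = (of_nat DIM('a) + of_nat (l + l') - 2) * of_nat l' * (LINT x|sphere_measure. P x * Q x)"
    if P: "P \<in> solid_harmonics l" and Q: "Q \<in> solid_harmonics l'" for P Q :: "'a \<Rightarrow> complex" and l l'
  \<comment> \<open>Here l' - 1 is truncated; but Q is constant and both sides are 0.\<close>
  proof (cases "l' = 0")
    case True
    with Q obtain c where "Q = (\<lambda>x. c)"
      using homogeneous_0_const by (auto simp: solid_harmonics_iff)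
    with True show ?thesis
      by simp
  next
    case False
    have P': "polynomial_function P" "homogeneous l P" and Q': "polynomial_function Q" "homogeneous l' Q" "\<And>x. laplacian Q x = 0"
      using P Q by (auto simp: solid_harmonics_iff)
    have hom: "homogeneous (l + (l' - 1)) (\<lambda>x. P x * partial_deriv b Q x)" for b
      using P' homogeneous_partial_deriv[OF Q'(1,2), of b] by (simp add: homogeneous_def power_add mult_ac)
    have "(LINT x|sphere_measure. (\<Sum>b\<in>Basis. partial_deriv b P x * partial_deriv b Q x))
        = (LINT x|sphere_measure. (\<Sum>b\<in>Basis. partial_deriv b (\<lambda>x. P x * partial_deriv b Q x) x))"
    proof (rule Bochner_Integration.integral_cong)
      fix x
      have "(\<Sum>b\<in>Basis. partial_deriv b (\<lambda>x. P x * partial_deriv b Q x) x)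
          = P x * laplacian Q x + (\<Sum>b\<in>Basis. partial_deriv b P x * partial_deriv b Q x)"
        using P'(1) Q'(1) by (simp add: partial_deriv_mult polynomial_function_partial_deriv laplacian_def sum.distrib sum_distrib_left)
      then show "(\<Sum>b\<in>Basis. partial_deriv b P x * partial_deriv b Q x)
          = (\<Sum>b\<in>Basis. partial_deriv b (\<lambda>x. P x * partial_deriv b Q x) x)"
        using Q' by simp
    qed simp
    also have "\<dots> = (\<Sum>b\<in>Basis. LINT x|sphere_measure. partial_deriv b (\<lambda>x. P x * partial_deriv b Q x) x)"
      using P' Q' by (intro Bochner_Integration.integral_sum int) auto
    also have "\<dots> = (\<Sum>b\<in>Basis. (of_nat DIM('a) + of_nat (l + (l' - 1)) - 1)
        * (LINT x|sphere_measure. of_real (x \<bullet> b) * (P x * partial_deriv b Q x)))"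
      using P' Q' by (intro sum.cong integral_sphere_partial_deriv hom) auto
    also have "\<dots> = (of_nat DIM('a) + of_nat (l + (l' - 1)) - 1)
        * (LINT x|sphere_measure. (\<Sum>b\<in>Basis. of_real (x \<bullet> b) * (P x * partial_deriv b Q x)))"
      unfolding sum_distrib_left[symmetric] using P' Q'
      by (subst Bochner_Integration.integral_sum) (auto intro!: int polynomial_function_complex_mult)
    also have "(\<lambda>x. \<Sum>b\<in>Basis. of_real (x \<bullet> b) * (P x * partial_deriv b Q x)) = (\<lambda>x. of_nat l' * (P x * Q x))"
    proof
      fix x
      have "(\<Sum>b\<in>Basis. of_real (x \<bullet> b) * (P x * partial_deriv b Q x)) = P x * (\<Sum>b\<in>Basis. of_real (x \<bullet> b) * partial_deriv b Q x)"
        by (simp add: sum_distrib_left mult_ac)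
      then show "(\<Sum>b\<in>Basis. of_real (x \<bullet> b) * (P x * partial_deriv b Q x)) = of_nat l' * (P x * Q x)"
        by (simp add: euler_homogeneous[OF Q'(1,2)])
    qed
    finally show ?thesis
      using False by (cases l') simp_all
  qed
  have "(of_nat DIM('a) + of_nat (l + l') - 2) * of_nat l' * (LINT x|sphere_measure. P x * Q x)
      = (of_nat DIM('a) + of_nat (l' + l) - 2) * of_nat l * (LINT x|sphere_measure. Q x * P x)"
    unfolding grad[OF P Q, symmetric] grad[OF Q P, symmetric] by (simp add: mult.commute)
  then have "(of_nat DIM('a) + of_nat (l + l') - 2) * (of_nat l' - of_nat l) * (LINT x|sphere_measure. P x * Q x) = 0"
    by (simp add: algebra_simps)
  \<comment> \<open>As l + l' >= 1 and n >= 2, the factor n + l + l' - 2 is positive.\<close>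
  moreover have "of_nat DIM('a) + of_nat (l + l') - (2 :: complex) = of_nat (DIM('a) + (l + l') - 2)"
    using dim by (simp add: of_nat_diff)
  then have "of_nat DIM('a) + of_nat (l + l') - (2 :: complex) \<noteq> 0"
    using dim \<open>l \<noteq> l'\<close> by (simp only: of_nat_eq_0_iff)
  ultimately show ?thesis
    using \<open>l \<noteq> l'\<close> by (simp only: mult_eq_0_iff) simp
qed

subsection \<open>The gauge sphere\<close>

lemma gauge_sphere_iff:
  "(x, y) \<in> gauge_sphere \<alpha> \<longleftrightarrow> norm x ^ (2 * (\<alpha> + 1)) + ((real \<alpha> + 1) * norm y)\<^sup>2 = 1"
proof -
  have "0 \<le> norm x ^ (2 * (\<alpha> + 1)) + (real \<alpha> + 1)\<^sup>2 * (norm y)\<^sup>2"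
    by (intro add_nonneg_nonneg mult_nonneg_nonneg zero_le_power) auto
  then have "root (2 * (\<alpha> + 1)) (norm x ^ (2 * (\<alpha> + 1)) + (real \<alpha> + 1)\<^sup>2 * (norm y)\<^sup>2) = 1
      \<longleftrightarrow> norm x ^ (2 * (\<alpha> + 1)) + (real \<alpha> + 1)\<^sup>2 * (norm y)\<^sup>2 = 1"
    by (intro real_root_eq_1_iff) simp
  then show ?thesis
    by (simp only: gauge_sphere_def grushin_gauge_def mem_Collect_eq case_prod_conv power_mult_distrib)
qed

lemma gauge_sphere_norm_le:
  assumes "(x, y) \<in> gauge_sphere \<alpha>"
  shows "norm x \<le> 1" "(real \<alpha> + 1) * norm y \<le> 1" "norm y \<le> 1"
proof -
  have eq: "norm x ^ (2 * (\<alpha> + 1)) + ((real \<alpha> + 1) * norm y)\<^sup>2 = 1"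
    using assms by (simp only: gauge_sphere_iff)
  then have "norm x ^ (2 * (\<alpha> + 1)) \<le> 1"
    by (metis add_increasing2 le_add_same_cancel1 zero_le_power2)
  then show "norm x \<le> 1"
    by (metis linorder_not_le one_less_power zero_less_Suc Suc_eq_plus1 nat_0_less_mult_iff pos2)
  have "((real \<alpha> + 1) * norm y)\<^sup>2 \<le> 1"
    using eq by (metis le_add_same_cancel2 norm_ge_zero zero_le_power)
  then show y: "(real \<alpha> + 1) * norm y \<le> 1"
    by (simp add: abs_square_le_1)
  have "1 * norm y \<le> (real \<alpha> + 1) * norm y"
    by (intro mult_right_mono) auto
  with y show "norm y \<le> 1"
    by simp
qed

lemma compact_gauge_sphere: "compact (gauge_sphere \<alpha> :: ('a::euclidean_space \<times> 'b::euclidean_space) set)"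
proof -
  have eq: "gauge_sphere \<alpha> = {z :: 'a \<times> 'b. norm (fst z) ^ (2 * (\<alpha> + 1)) + ((real \<alpha> + 1) * norm (snd z))\<^sup>2 = 1}"
    by (auto simp only: gauge_sphere_iff set_eq_iff mem_Collect_eq split_paired_all fst_conv snd_conv)
  have "closed (gauge_sphere \<alpha> :: ('a \<times> 'b) set)"
    unfolding eq by (intro closed_Collect_eq continuous_intros)
  moreover have "gauge_sphere \<alpha> \<subseteq> cball (0::'a) 1 \<times> cball (0::'b) 1"
    using gauge_sphere_norm_le by force
  moreover have "bounded (cball (0::'a) 1 \<times> cball (0::'b) 1)"
    by (intro bounded_Times bounded_cball)
  ultimately show ?thesis
    using bounded_subset compact_eq_bounded_closed by blast
qed

text \<open>The angle arccos ((\<alpha> + 1) |y|) meets the defining conditions, as the equation of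
  the gauge sphere forces its sine to be |x|^(\<alpha> + 1). It is the only one because cos is
  injective on [0, pi]. Points with x = 0 or y = 0 are included.\<close>

lemma polar_angle_gauge_sphere:
  assumes "(x, y) \<in> gauge_sphere \<alpha>"
  shows "polar_angle \<alpha> (x, y) \<in> {0..pi/2}"
    and "cos (polar_angle \<alpha> (x, y)) = (real \<alpha> + 1) * norm y"
    and "root (\<alpha> + 1) (sin (polar_angle \<alpha> (x, y))) = norm x"
    and "cos (2 * polar_angle \<alpha> (x, y)) = 1 - 2 * norm x ^ (2 * (\<alpha> + 1))"
proof -
  define \<theta> where "\<theta> = arccos ((real \<alpha> + 1) * norm y)"
  have gauge: "grushin_gauge \<alpha> (x, y) = 1"
    using assms by (simp add: gauge_sphere_def)
  have eq: "norm x ^ (2 * (\<alpha> + 1)) + ((real \<alpha> + 1) * norm y)\<^sup>2 = 1"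
    using assms by (simp only: gauge_sphere_iff)
  have c: "0 \<le> (real \<alpha> + 1) * norm y" "(real \<alpha> + 1) * norm y \<le> 1"
    using gauge_sphere_norm_le[OF assms] by auto
  then have c': "- 1 \<le> (real \<alpha> + 1) * norm y"
    by linarith
  have cos: "cos \<theta> = (real \<alpha> + 1) * norm y"
    unfolding \<theta>_def by (rule cos_arccos[OF c' c(2)])
  have \<theta>: "\<theta> \<in> {0..pi/2}"
    using c c' arccos_le_pi2[of "(real \<alpha> + 1) * norm y"] arccos_lbound[of "(real \<alpha> + 1) * norm y"]
    unfolding \<theta>_def by auto
  then have "sin \<theta> \<ge> 0"
    by (intro sin_ge_zero) auto
  moreover have "(sin \<theta>)\<^sup>2 = (norm x ^ (\<alpha> + 1))\<^sup>2"
    unfolding sin_squared_eq cos using eq by (simp add: power_mult[symmetric] mult.commute del: power_Suc)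
  ultimately have sin: "sin \<theta> = norm x ^ (\<alpha> + 1)"
    by (simp del: power_Suc)
  have "polar_angle \<alpha> (x, y) = \<theta>"
    unfolding polar_angle_def case_prod_conv gauge
  proof (rule the_equality)
    show "\<theta> \<in> {0..pi/2} \<and> norm x = 1 * root (\<alpha> + 1) (sin \<theta>) \<and> norm y = 1 / (real \<alpha> + 1) * 1 ^ (\<alpha> + 1) * cos \<theta>"
      using \<theta> by (simp add: sin cos real_root_power_cancel del: power_Suc)
  next
    fix \<phi> assume \<phi>: "\<phi> \<in> {0..pi/2} \<and> norm x = 1 * root (\<alpha> + 1) (sin \<phi>) \<and> norm y = 1 / (real \<alpha> + 1) * 1 ^ (\<alpha> + 1) * cos \<phi>"
    then have "cos \<phi> = cos \<theta>"
      by (simp add: cos)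
    moreover have "0 \<le> \<phi>" "\<phi> \<le> pi" "0 \<le> \<theta>" "\<theta> \<le> pi"
      using conjunct1[OF \<phi>] \<theta> by auto
    ultimately show "\<phi> = \<theta>"
      by (rule cos_inj_pi[rotated 4])
  qed
  then show "polar_angle \<alpha> (x, y) \<in> {0..pi/2}" "cos (polar_angle \<alpha> (x, y)) = (real \<alpha> + 1) * norm y"
    "root (\<alpha> + 1) (sin (polar_angle \<alpha> (x, y))) = norm x"
    using \<theta> cos by (simp_all add: sin real_root_power_cancel del: power_Suc)
  show "cos (2 * polar_angle \<alpha> (x, y)) = 1 - 2 * norm x ^ (2 * (\<alpha> + 1))"
    unfolding \<open>polar_angle \<alpha> (x, y) = \<theta>\<close> cos_double_sin sin by (simp add: power_mult[symmetric] mult.commute del: power_Suc)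
qed

text \<open>The argument u stands for sin^2 phi, so 1 - 2 u is cos (2 phi). As a function of u this
  is a polynomial of degree N.\<close>

definition jacobi_factor :: "nat \<Rightarrow> nat \<Rightarrow> nat \<Rightarrow> nat \<Rightarrow> nat \<Rightarrow> nat \<Rightarrow> real \<Rightarrow> real" where
  "jacobi_factor \<alpha> n m N l j u =
     jacobi_poly N ((real n - 2 + 2 * real l) / (2 * (real \<alpha> + 1))) (real j + real m / 2 - 1) (1 - 2 * u)"

lemma continuous_on_jacobi_factor [continuous_intros]:
  "continuous_on S f \<Longrightarrow> continuous_on S (\<lambda>x. jacobi_factor \<alpha> n m N l j (f x))"
  unfolding jacobi_factor_def jacobi_poly_def by (intro continuous_intros) auto

lemma angular_part_eq:
  "angular_part \<alpha> n m N l j \<phi> = cos \<phi> ^ j * root (\<alpha> + 1) (sin \<phi>) ^ l * jacobi_factor \<alpha> n m N l j ((sin \<phi>)\<^sup>2)"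
  by (simp add: angular_part_def jacobi_factor_def Let_def cos_double_sin)

lemma continuous_on_angular_part: "continuous_on S (angular_part \<alpha> n m N l j)"
  unfolding angular_part_eq[abs_def] by (intro continuous_intros)

text \<open>The continuous representative of a Grushin harmonic on the gauge sphere.\<close>

definition grushin_product ::
  "nat \<Rightarrow> nat \<Rightarrow> nat \<Rightarrow> nat \<Rightarrow> ('a \<Rightarrow> complex) \<Rightarrow> ('b \<Rightarrow> complex) \<Rightarrow> 'a::euclidean_space \<times> 'b::euclidean_space \<Rightarrow> complex" where
  "grushin_product \<alpha> N l j H G = (\<lambda>(x, y).
     of_real ((real \<alpha> + 1) ^ j * jacobi_factor \<alpha> DIM('a) DIM('b) N l j (norm x ^ (2 * (\<alpha> + 1)))) * H x * G y)"

abbreviation sphere_restriction :: "('a::real_normed_vector \<Rightarrow> complex) \<Rightarrow> 'a \<Rightarrow> complex" where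
  "sphere_restriction \<equiv> (\<lambda>P x. if x \<in> sphere 0 1 then P x else 0)"

lemma homogeneous_sgn: "homogeneous l H \<Longrightarrow> H x = of_real (norm x) ^ l * H (sgn x)"
proof -
  assume "homogeneous l H"
  then have "H (norm x *\<^sub>R sgn x) = of_real (norm x) ^ l * H (sgn x)"
    by (simp add: homogeneous_def)
  moreover have "norm x *\<^sub>R sgn x = x"
    by (cases "x = 0") (simp_all add: sgn_div_norm)
  ultimately show ?thesis
    by simp
qed

text \<open>The powers |x|^l and |y|^j in the angular part turn the spherical harmonics at
  \<open>sgn x\<close> and \<open>sgn y\<close> into the solid ones at x and y. The constant
  (\<alpha> + 1)^j comes from cos phi = (\<alpha> + 1) |y|.\<close>

lemma grushin_harmonic_gauge_sphere:
  fixes H :: "'a::euclidean_space \<Rightarrow> complex" and G :: "'b::euclidean_space \<Rightarrow> complex"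
  assumes H: "homogeneous l H" and G: "homogeneous j G" and z: "(x, y) \<in> gauge_sphere \<alpha>"
  shows "grushin_harmonic \<alpha> k N l j (sphere_restriction H) (sphere_restriction G) (x, y) =
    (if x \<noteq> 0 \<and> y \<noteq> 0 then grushin_product \<alpha> N l j H G (x, y) else 0)"
proof (cases "x \<noteq> 0 \<and> y \<noteq> 0")
  case True
  have gauge: "grushin_gauge \<alpha> (x, y) = 1"
    using z by (simp add: gauge_sphere_def)
  have "angular_part \<alpha> DIM('a) DIM('b) N l j (polar_angle \<alpha> (x, y)) =
      (real \<alpha> + 1) ^ j * norm y ^ j * norm x ^ l * jacobi_factor \<alpha> DIM('a) DIM('b) N l j (norm x ^ (2 * (\<alpha> + 1)))"
    unfolding angular_part_def Let_def jacobi_factor_def polar_angle_gauge_sphere[OF z] power_mult_distrib ..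
  then show ?thesis
    using True homogeneous_sgn[OF H, of x] homogeneous_sgn[OF G, of y]
    by (simp add: grushin_harmonic_def gauge grushin_product_def norm_sgn)
qed (auto simp: grushin_harmonic_def)

lemma continuous_on_grushin_product:
  assumes "continuous_on UNIV H" "continuous_on UNIV G"
  shows "continuous_on S (grushin_product \<alpha> N l j H G)"
  unfolding grushin_product_def case_prod_beta
  by (intro continuous_intros continuous_on_compose2[OF assms(1)] continuous_on_compose2[OF assms(2)]) auto

text \<open>In the parameters the function separates into three factors, ready for Fubini's theorem.
  The constant (\<alpha> + 1)^j cancels against the scaling of the y-component in the
  parametrisation.\<close>

lemma grushin_product_param:
  assumes H: "homogeneous l H" and G: "homogeneous j G" and "\<phi> \<in> {0..pi/2}" "norm \<omega>1 = 1"
  shows "grushin_product \<alpha> N l j H G (gauge_sphere_param \<alpha> (\<phi>, \<omega>1, \<omega>2)) =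
    of_real (angular_part \<alpha> DIM('a::euclidean_space) DIM('b::euclidean_space) N l j \<phi>) * H (\<omega>1 :: 'a) * G (\<omega>2 :: 'b)"
proof -
  have s: "sin \<phi> \<ge> 0"
    using assms by (intro sin_ge_zero) auto
  have r: "root (\<alpha> + 1) (sin \<phi>) ^ (2 * (\<alpha> + 1)) = (sin \<phi>)\<^sup>2"
    using s by (subst mult.commute, subst power_mult) (simp add: real_root_pow_pos2 del: power_Suc)
  have "norm (root (\<alpha> + 1) (sin \<phi>) *\<^sub>R \<omega>1) = root (\<alpha> + 1) (sin \<phi>)"
    using s assms(4) by (simp add: real_root_ge_zero)
  moreover have "H (root (\<alpha> + 1) (sin \<phi>) *\<^sub>R \<omega>1) = of_real (root (\<alpha> + 1) (sin \<phi>)) ^ l * H \<omega>1"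
    "G ((1 / (real \<alpha> + 1) * cos \<phi>) *\<^sub>R \<omega>2) = of_real (1 / (real \<alpha> + 1) * cos \<phi>) ^ j * G \<omega>2"
    using H G unfolding homogeneous_def by blast+
  ultimately have "grushin_product \<alpha> N l j H G (gauge_sphere_param \<alpha> (\<phi>, \<omega>1, \<omega>2)) =
      of_real ((real \<alpha> + 1) ^ j * jacobi_factor \<alpha> DIM('a) DIM('b) N l j ((sin \<phi>)\<^sup>2))
      * (of_real (root (\<alpha> + 1) (sin \<phi>)) ^ l * H \<omega>1) * (of_real (1 / (real \<alpha> + 1) * cos \<phi>) ^ j * G \<omega>2)"
    unfolding grushin_product_def gauge_sphere_param_def case_prod_conv by (simp only: r)
  also have "\<dots> = of_real (((real \<alpha> + 1) * (1 / (real \<alpha> + 1) * cos \<phi>)) ^ j * root (\<alpha> + 1) (sin \<phi>) ^ l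
      * jacobi_factor \<alpha> DIM('a) DIM('b) N l j ((sin \<phi>)\<^sup>2)) * H \<omega>1 * G \<omega>2"
    unfolding power_mult_distrib[of "real \<alpha> + 1"] by (simp only: of_real_mult of_real_power mult_ac)
  also have "(real \<alpha> + 1) * (1 / (real \<alpha> + 1) * cos \<phi>) = cos \<phi>"
    by simp
  finally show ?thesis
    by (simp only: angular_part_eq)
qed

section \<open>The angular measure and orthogonality of the angular parts\<close>

lemma sets_angle_measure [simp, measurable_cong]:
  "sets (angle_measure \<alpha> n m) = sets (restrict_space borel {0..pi/2})"
  unfolding angle_measure_def sets_density by (rule sets_restrict_space_cong) simp

lemma space_angle_measure [simp]: "space (angle_measure \<alpha> n m) = {0..pi/2}"
  by (simp add: angle_measure_def space_restrict_space)

lemma borel_measurable_angle_measure: "f \<in> borel_measurable borel \<Longrightarrow> f \<in> borel_measurable (angle_measure \<alpha> n m)"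
  by (simp add: measurable_cong_sets[OF sets_angle_measure refl] measurable_restrict_space1)

definition angle_weight :: "nat \<Rightarrow> nat \<Rightarrow> nat \<Rightarrow> real \<Rightarrow> real" where
  "angle_weight \<alpha> n m \<phi> = sin \<phi> powr ((real n - 2) / (real \<alpha> + 1) + 1) * cos \<phi> ^ (m - 1)"

lemma angle_measure_eq: "angle_measure \<alpha> n m = density (restrict_space lborel {0..pi/2}) (\<lambda>\<phi>. ennreal (angle_weight \<alpha> n m \<phi>))"
  by (simp add: angle_measure_def angle_weight_def)

lemma angle_weight_measurable [measurable]: "angle_weight \<alpha> n m \<in> borel_measurable borel"
  unfolding angle_weight_def[abs_def] by measurable

lemma angle_weight_bounds:
  assumes "\<phi> \<in> {0..pi/2}" "n \<ge> 2"
  shows "0 \<le> angle_weight \<alpha> n m \<phi>" "angle_weight \<alpha> n m \<phi> \<le> 1"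
proof -
  have sc: "0 \<le> sin \<phi>" "0 \<le> cos \<phi>"
    using assms by (auto intro: sin_ge_zero cos_ge_zero)
  then show "0 \<le> angle_weight \<alpha> n m \<phi>"
    by (simp add: angle_weight_def)
  have "(real n - 2) / (real \<alpha> + 1) + 1 \<ge> 0"
    using assms(2) by (intro add_nonneg_nonneg divide_nonneg_nonneg) auto
  then have "sin \<phi> powr ((real n - 2) / (real \<alpha> + 1) + 1) \<le> 1"
    using sc by (intro powr_le1) auto
  moreover have "cos \<phi> ^ (m - 1) \<le> 1"
    using sc by (intro power_le_one) auto
  ultimately show "angle_weight \<alpha> n m \<phi> \<le> 1"
    using sc unfolding angle_weight_def by (intro mult_le_one) auto
qed

lemma finite_measure_angle_measure:
  assumes "n \<ge> 2"
  shows "finite_measure (angle_measure \<alpha> n m)"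
proof (rule finite_measureI)
  have "emeasure (angle_measure \<alpha> n m) (space (angle_measure \<alpha> n m))
      = (\<integral>\<^sup>+\<phi>. ennreal (angle_weight \<alpha> n m \<phi>) \<partial>restrict_space lborel {0..pi/2})"
    unfolding angle_measure_eq
    by (subst emeasure_density) (auto intro!: nn_integral_cong measurable_restrict_space1 simp: space_restrict_space sets_restrict_space)
  also have "\<dots> \<le> (\<integral>\<^sup>+\<phi>. 1 \<partial>restrict_space lborel {0..pi/2})"
    using angle_weight_bounds(2)[OF _ assms] by (intro nn_integral_mono) (simp add: space_restrict_space)
  also have "\<dots> = emeasure lborel {0..pi/2}"
    by (simp add: space_restrict_space emeasure_restrict_space)
  also have "\<dots> < \<infinity>"
    by simp
  finally show "emeasure (angle_measure \<alpha> n m) (space (angle_measure \<alpha> n m)) \<noteq> \<infinity>"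
    by simp
qed

text \<open>The density itself is 0 at the exceptional angles: \<open>powr\<close> has base 0 where
  sin vanishes, and m >= 2 gives cos a positive exponent.\<close>

lemma AE_angle_measure_interior:
  assumes "m \<ge> 2"
  shows "AE \<phi> in angle_measure \<alpha> n m. sin \<phi> \<noteq> 0 \<and> cos \<phi> \<noteq> 0"
  unfolding angle_measure_eq using assms
  by (subst AE_density) (auto intro!: measurable_restrict_space1 AE_I2 simp: angle_weight_def power_0_left)

lemma integral_angle_measure:
  fixes f :: "real \<Rightarrow> real"
  assumes [measurable]: "f \<in> borel_measurable borel" and n: "n \<ge> 2"
  shows "(LINT \<phi>|angle_measure \<alpha> n m. f \<phi>) = (LBINT \<phi>. (angle_weight \<alpha> n m \<phi> * f \<phi>) * indicator {0..pi/2} \<phi>)"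
proof -
  have "(LINT \<phi>|angle_measure \<alpha> n m. f \<phi>) = (LINT \<phi>|restrict_space lborel {0..pi/2}. angle_weight \<alpha> n m \<phi> *\<^sub>R f \<phi>)"
    unfolding angle_measure_eq using angle_weight_bounds(1)[OF _ n]
    by (intro integral_density) (auto intro!: measurable_restrict_space1 AE_I2 simp: space_restrict_space)
  then show ?thesis
    by (simp add: integral_restrict_space mult.commute)
qed

text \<open>Substitution u = sin^2 phi. The exponents of sin add up to (n - 2)/(\<alpha> + 1) + 1 +
  2 l/(\<alpha> + 1) = 2 mu + 1, those of cos to m - 1 + 2 j = 2 (gamma - 1) + 1, and the surplus
  sin phi cos phi is half of du/dphi. With l and j shared, both Jacobi polynomials belong to the
  same weight.\<close>

lemma angular_part_orthogonal:
  assumes nm: "n \<ge> 2" "m \<ge> 2" and "N \<noteq> N'"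
  shows "(LINT \<phi>|angle_measure \<alpha> n m. angular_part \<alpha> n m N l j \<phi> * angular_part \<alpha> n m N' l j \<phi>) = 0"
proof -
  define \<mu> where "\<mu> = (real n - 2 + 2 * real l) / (2 * (real \<alpha> + 1))"
  define \<nu> where "\<nu> = real j + real m / 2 - 1"
  have \<mu>: "\<mu> \<ge> 0" and \<nu>: "\<nu> \<ge> 0"
    using nm by (auto simp: \<mu>_def \<nu>_def)
  define J where "J u = jacobi_poly N \<mu> \<nu> (1 - 2 * u) * jacobi_poly N' \<mu> \<nu> (1 - 2 * u)" for u
  define h where "h u = u powr \<mu> * (1 - u) powr \<nu> * J u" for u
  have J_cont: "continuous_on S J" for S
    unfolding J_def jacobi_poly_def by (intro continuous_intros) auto
  then have J_meas [measurable]: "J \<in> borel_measurable borel"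
    by (rule borel_measurable_continuous_onI)
  have "(h has_integral 0) {0..1}"
    unfolding h_def J_def by (rule has_integral_jacobi_orthogonal[OF \<mu> \<nu> \<open>N \<noteq> N'\<close>])
  then have int0: "integral {0..1} h = 0"
    by (rule integral_unique)
  \<comment> \<open>Both exponents are nonnegative, so the weight is at most 1 on [0, 1] and h is
    bounded.\<close>
  have si: "set_integrable lborel {0..1} h"
  proof -
    have "compact (J ` {0..1})"
      by (intro compact_continuous_image J_cont) simp
    then obtain K where bound: "\<forall>z\<in>J ` {0..1}. norm z \<le> K"
      using compact_imp_bounded bounded_iff by metis
    have K: "\<bar>J u\<bar> \<le> K" if "u \<in> {0..1}" for u
      using bspec[OF bound, of "J u"] that by auto
    have le: "norm (indicator {0..1} u *\<^sub>R h u) \<le> norm (indicator {0..1} u * K)" for u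
    proof (cases "u \<in> {0..1}")
      case True
      then have "u powr \<mu> * (1 - u) powr \<nu> \<le> 1"
        using \<mu> \<nu> by (intro mult_le_one powr_le1) auto
      then have "\<bar>h u\<bar> \<le> 1 * K"
        unfolding h_def abs_mult[of _ "J u"] using K[OF True] by (intro mult_mono) auto
      with True show ?thesis
        by simp
    qed simp
    have K_int: "integrable lborel (\<lambda>u::real. indicator {0..1} u * K)"
      by (rule integrable_mult_left, rule integrable_real_indicator) simp_all
    have "h \<in> borel_measurable borel"
      unfolding h_def by measurable
    then show ?thesis
      unfolding set_integrable_def
      by (intro Bochner_Integration.integrable_bound[OF K_int] AE_I2 le) simp
  qed
  have pt: "angle_weight \<alpha> n m \<phi> * (angular_part \<alpha> n m N l j \<phi> * angular_part \<alpha> n m N' l j \<phi>)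
      = 1 / 2 * (h ((sin \<phi>)\<^sup>2) * (2 * sin \<phi> * cos \<phi>))" if \<phi>: "\<phi> \<in> {0..pi/2}" for \<phi>
  proof -
    have sc: "0 \<le> sin \<phi>" "0 \<le> cos \<phi>"
      using \<phi> by (auto intro: sin_ge_zero cos_ge_zero)
    show ?thesis
    \<comment> \<open>At the end points both sides are 0; in the interior the bases are positive and
      the laws for \<open>powr\<close> apply.\<close>
    proof (cases "sin \<phi> = 0 \<or> cos \<phi> = 0")
      case True
      then show ?thesis
        using nm by (auto simp: angle_weight_def)
    next
      case False
      with sc have pos: "sin \<phi> > 0" "cos \<phi> > 0"
        by auto
      define s c where "s = sin \<phi>" and "c = cos \<phi>"
      have sc: "s > 0" "c > 0"
        using pos by (auto simp: s_def c_def)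
      have r: "root (\<alpha> + 1) s ^ l = s powr (real l / (real \<alpha> + 1))"
        using sc by (simp add: root_powr_inverse powr_realpow[symmetric] powr_powr add.commute)
      have s_eq: "s powr ((real n - 2) / (real \<alpha> + 1) + 1) * (root (\<alpha> + 1) s ^ l * root (\<alpha> + 1) s ^ l) = (s\<^sup>2) powr \<mu> * s"
      proof -
        have "s powr ((real n - 2) / (real \<alpha> + 1) + 1) * (root (\<alpha> + 1) s ^ l * root (\<alpha> + 1) s ^ l)
            = s powr ((real n - 2) / (real \<alpha> + 1) + 1 + (real l / (real \<alpha> + 1) + real l / (real \<alpha> + 1)))"
          by (simp only: r powr_add)
        also have "(real n - 2) / (real \<alpha> + 1) + 1 + (real l / (real \<alpha> + 1) + real l / (real \<alpha> + 1)) = 2 * \<mu> + 1"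
          by (simp add: \<mu>_def divide_simps, simp add: algebra_simps)
        also have "s powr (2 * \<mu> + 1) = (s\<^sup>2) powr \<mu> * s"
          using sc by (simp add: powr_add powr_powr flip: powr_numeral)
        finally show ?thesis .
      qed
      have c_eq: "c ^ (m - 1) * (c ^ j * c ^ j) = (c\<^sup>2) powr \<nu> * c"
      proof -
        have "c ^ (m - 1) * (c ^ j * c ^ j) = c powr (real (m - 1) + (real j + real j))"
          using sc by (simp only: powr_add powr_realpow)
        also have "real (m - 1) + (real j + real j) = 2 * \<nu> + 1"
          using nm by (simp add: \<nu>_def of_nat_diff)
        also have "c powr (2 * \<nu> + 1) = (c\<^sup>2) powr \<nu> * c"
          using sc by (simp add: powr_add powr_powr flip: powr_numeral)
        finally show ?thesis .
      qed
      have c2: "c\<^sup>2 = 1 - s\<^sup>2"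
        by (simp add: s_def c_def cos_squared_eq)
      have "angle_weight \<alpha> n m \<phi> * (angular_part \<alpha> n m N l j \<phi> * angular_part \<alpha> n m N' l j \<phi>)
          = (s powr ((real n - 2) / (real \<alpha> + 1) + 1) * (root (\<alpha> + 1) s ^ l * root (\<alpha> + 1) s ^ l))
            * (c ^ (m - 1) * (c ^ j * c ^ j)) * J (s\<^sup>2)"
        unfolding angle_weight_def angular_part_eq jacobi_factor_def J_def s_def[symmetric] c_def[symmetric] \<mu>_def[symmetric] \<nu>_def[symmetric]
        by (simp only: mult_ac)
      also have "\<dots> = 1 / 2 * (h (s\<^sup>2) * (2 * s * c))"
        unfolding s_eq c_eq h_def by (simp add: c2)
      finally show ?thesis
        by (simp only: s_def c_def)
    qed
  qed
  have "(LINT \<phi>|angle_measure \<alpha> n m. angular_part \<alpha> n m N l j \<phi> * angular_part \<alpha> n m N' l j \<phi>)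
      = (LBINT \<phi>. angle_weight \<alpha> n m \<phi> * (angular_part \<alpha> n m N l j \<phi> * angular_part \<alpha> n m N' l j \<phi>) * indicator {0..pi/2} \<phi>)"
    by (intro integral_angle_measure nm borel_measurable_continuous_onI continuous_intros continuous_on_angular_part)
  also have "\<dots> = (LBINT \<phi>. 1 / 2 * (h ((sin \<phi>)\<^sup>2) * (2 * sin \<phi> * cos \<phi>) * indicator {0..pi/2} \<phi>))"
    using pt by (intro Bochner_Integration.integral_cong) (auto simp: indicator_def)
  also have "\<dots> = 1 / 2 * (LBINT \<phi>. h ((sin \<phi>)\<^sup>2) * (2 * sin \<phi> * cos \<phi>) * indicator {0..pi/2} \<phi>)"
    by (rule integral_mult_right_zero)
  also have "(LBINT \<phi>. h ((sin \<phi>)\<^sup>2) * (2 * sin \<phi> * cos \<phi>) * indicator {0..pi/2} \<phi>)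
      = (LBINT u. h u * indicator {(sin 0)\<^sup>2..(sin (pi/2))\<^sup>2} u)"
  proof (rule integral_substitution(2)[symmetric, where g = "\<lambda>\<phi>. (sin \<phi>)\<^sup>2"])
    show "set_integrable lborel {(sin 0)\<^sup>2..(sin (pi/2))\<^sup>2} h"
      using si by simp
    show "0 \<le> 2 * sin \<phi> * cos \<phi>" if "\<phi> \<in> {0..pi/2}" for \<phi>
      using that by (auto intro!: mult_nonneg_nonneg sin_ge_zero cos_ge_zero)
  qed (auto intro!: derivative_eq_intros continuous_intros)
  also have "\<dots> = (LINT u:{0..1}|lborel. h u)"
    by (simp add: set_lebesgue_integral_def mult.commute)
  also have "\<dots> = 0"
    using set_borel_integral_eq_integral(2)[OF si] int0 by simp
  finally show ?thesis
    by simp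
qed

lemma (in pair_sigma_finite) integral_pair_mult:
  fixes f :: "'a \<Rightarrow> complex" and g :: "'b \<Rightarrow> complex"
  assumes f: "integrable M1 f" and g: "integrable M2 g"
  shows "integrable (M1 \<Otimes>\<^sub>M M2) (\<lambda>z. f (fst z) * g (snd z))"
    and "(LINT z|(M1 \<Otimes>\<^sub>M M2). f (fst z) * g (snd z)) = (LINT x|M1. f x) * (LINT y|M2. g y)"
proof -
  have [measurable]: "f \<in> borel_measurable M1" "g \<in> borel_measurable M2"
    using f g by auto
  show int: "integrable (M1 \<Otimes>\<^sub>M M2) (\<lambda>z. f (fst z) * g (snd z))"
    by (rule Fubini_integrable) (use f g in \<open>auto simp: norm_mult\<close>)
  show "(LINT z|(M1 \<Otimes>\<^sub>M M2). f (fst z) * g (snd z)) = (LINT x|M1. f x) * (LINT y|M2. g y)"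
    using integral_fst'[OF int] by simp
qed

lemma tendsto_of_norm_diff_le:
  fixes f :: "nat \<Rightarrow> 'a::real_normed_vector"
  assumes "e \<longlonglongrightarrow> 0" "\<And>i. norm (l - f i) \<le> e i"
  shows "f \<longlonglongrightarrow> l"
proof -
  have "(\<lambda>i. f i - l) \<longlonglongrightarrow> 0"
    using assms(2) by (intro Lim_null_comparison[OF _ assms(1)]) (simp add: norm_minus_commute)
  then show ?thesis
    by (rule LIM_zero_cancel)
qed

section \<open>The measure on the gauge sphere as an image of a product measure\<close>

locale gauge_sphere_setting =
  fixes \<alpha> :: nat and M :: "('a::euclidean_space \<times> 'b::euclidean_space) measure"
    and A :: "real measure" and S1 :: "'a measure" and S2 :: "'b measure"
  assumes M_def: "M = gauge_sphere_measure \<alpha>" and A_def: "A = angle_measure \<alpha> DIM('a) DIM('b)"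
    and S1_def: "S1 = sphere_measure" and S2_def: "S2 = sphere_measure"
    and dim: "DIM('a) \<ge> 2" "DIM('b) \<ge> 2"
begin

lemma sets_M [simp]: "sets M = sets (restrict_space borel (gauge_sphere \<alpha>))"
  by (simp add: M_def gauge_sphere_measure_def)

lemma space_M [simp]: "space M = gauge_sphere \<alpha>"
  by (simp add: M_def gauge_sphere_measure_def space_restrict_space)

lemma param_measurable: "gauge_sphere_param \<alpha> \<in> measurable (A \<Otimes>\<^sub>M (S1 \<Otimes>\<^sub>M S2)) (restrict_space borel (gauge_sphere \<alpha>))"
  unfolding A_def S1_def S2_def by (rule gauge_sphere_param_measurable)

lemma M_eq_distr: "M = distr (A \<Otimes>\<^sub>M (S1 \<Otimes>\<^sub>M S2)) (restrict_space borel (gauge_sphere \<alpha>)) (gauge_sphere_param \<alpha>)"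
  unfolding M_def A_def S1_def S2_def gauge_sphere_measure_def ..

lemma finite_measure_pairs:
  "finite_measure A" "finite_measure S1" "finite_measure S2" "finite_measure (S1 \<Otimes>\<^sub>M S2)" "finite_measure (A \<Otimes>\<^sub>M (S1 \<Otimes>\<^sub>M S2))"
proof -
  show A: "finite_measure A" and S: "finite_measure S1" "finite_measure S2"
    using dim by (auto simp: A_def S1_def S2_def intro: finite_measure_angle_measure finite_measure_sphere_measure)
  show SS: "finite_measure (S1 \<Otimes>\<^sub>M S2)"
    by (intro finite_measure_pair_measure S)
  show "finite_measure (A \<Otimes>\<^sub>M (S1 \<Otimes>\<^sub>M S2))"
    by (intro finite_measure_pair_measure A SS)
qed

lemma pair_sigma_finite_pairs: "pair_sigma_finite S1 S2" "pair_sigma_finite A (S1 \<Otimes>\<^sub>M S2)"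
  using finite_measure_pairs by (auto simp: pair_sigma_finite_def finite_measure_def)

lemma finite_measure_M: "finite_measure M"
  unfolding M_eq_distr
  by (rule finite_measure.finite_measure_distr[OF finite_measure_pairs(5) param_measurable])

lemma borel_measurable_M: "f \<in> borel_measurable borel \<Longrightarrow> f \<in> borel_measurable M"
  by (simp add: measurable_cong_sets[OF sets_M refl] measurable_restrict_space1)

lemma continuous_L2:
  assumes "continuous_on UNIV f"
  shows "f \<in> L2 M"
proof -
  have "compact (f ` (gauge_sphere \<alpha>))"
    by (intro compact_continuous_image compact_gauge_sphere continuous_on_subset[OF assms]) simp
  then obtain K where "\<forall>z\<in>f ` (gauge_sphere \<alpha>). norm z \<le> K"
    using compact_imp_bounded bounded_iff by metis
  then show ?thesis
    using assms by (intro finite_measure.bounded_in_L2[OF finite_measure_M, of _ K] borel_measurable_M borel_measurable_continuous_onI) auto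
qed

lemma nonzero_borel: "{z :: 'a \<times> 'b. fst z \<noteq> 0 \<and> snd z \<noteq> 0} \<in> sets borel"
  by (intro borel_open open_Collect_conj open_Collect_neq continuous_intros)

text \<open>This makes the value 0 that the harmonics take where polar coordinates fail irrelevant:
  x vanishes only where sin phi does, y only where cos phi does.\<close>

lemma AE_M_nonzero: "AE z in M. fst z \<noteq> 0 \<and> snd z \<noteq> 0"
proof -
  interpret pair_sigma_finite A "S1 \<Otimes>\<^sub>M S2"
    by (rule pair_sigma_finite_pairs)
  have sc: "AE w in A \<Otimes>\<^sub>M (S1 \<Otimes>\<^sub>M S2). sin (fst w) \<noteq> 0 \<and> cos (fst w) \<noteq> 0"
  proof (rule AE_pair_measure)
    have [measurable]: "sin \<in> borel_measurable A" "cos \<in> borel_measurable A"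
      by (simp_all add: A_def borel_measurable_angle_measure)
    show "{w \<in> space (A \<Otimes>\<^sub>M (S1 \<Otimes>\<^sub>M S2)). sin (fst w) \<noteq> 0 \<and> cos (fst w) \<noteq> 0} \<in> sets (A \<Otimes>\<^sub>M (S1 \<Otimes>\<^sub>M S2))"
      by measurable
    show "AE \<phi> in A. AE \<omega> in S1 \<Otimes>\<^sub>M S2. sin (fst (\<phi>, \<omega>)) \<noteq> 0 \<and> cos (fst (\<phi>, \<omega>)) \<noteq> 0"
      using AE_angle_measure_interior[OF dim(2)] unfolding A_def by eventually_elim auto
  qed
  have "AE w in A \<Otimes>\<^sub>M (S1 \<Otimes>\<^sub>M S2). fst (gauge_sphere_param \<alpha> w :: 'a \<times> 'b) \<noteq> 0 \<and> snd (gauge_sphere_param \<alpha> w :: 'a \<times> 'b) \<noteq> 0"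
    using sc AE_space
  proof eventually_elim
    case (elim w)
    then have "fst (snd w) \<noteq> 0" "snd (snd w) \<noteq> 0"
      by (auto simp: space_pair_measure S1_def S2_def)
    with elim(1) show ?case
      by (auto simp: gauge_sphere_param_def case_prod_beta)
  qed
  moreover have "{z \<in> space (restrict_space borel (gauge_sphere \<alpha>)). fst z \<noteq> 0 \<and> snd z \<noteq> 0}
      \<in> sets (restrict_space borel (gauge_sphere \<alpha> :: ('a \<times> 'b) set))"
  proof -
    have eq: "{z \<in> space (restrict_space borel (gauge_sphere \<alpha>)). fst z \<noteq> 0 \<and> snd z \<noteq> 0}
        = gauge_sphere \<alpha> \<inter> {z :: 'a \<times> 'b. fst z \<noteq> 0 \<and> snd z \<noteq> 0}"
      by (auto simp: space_restrict_space)
    show ?thesis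
      unfolding eq sets_restrict_space by (intro imageI nonzero_borel)
  qed
  ultimately show ?thesis
    unfolding M_eq_distr by (subst AE_distr_iff[OF param_measurable]) auto
qed

lemma grushin_harmonic_L2_AE:
  fixes H :: "'a \<Rightarrow> complex" and G :: "'b \<Rightarrow> complex"
  assumes H: "polynomial_function H" "homogeneous l H" and G: "polynomial_function G" "homogeneous j G"
  shows "grushin_harmonic \<alpha> k N l j (sphere_restriction H) (sphere_restriction G) \<in> borel_measurable M"
    and "AE z in M. grushin_harmonic \<alpha> k N l j (sphere_restriction H) (sphere_restriction G) z = grushin_product \<alpha> N l j H G z"
proof -
  have [measurable]: "grushin_product \<alpha> N l j H G \<in> borel_measurable borel"
    using H G by (intro borel_measurable_continuous_onI continuous_on_grushin_product) auto
  have eq: "grushin_harmonic \<alpha> k N l j (sphere_restriction H) (sphere_restriction G) z =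
      (if fst z \<noteq> 0 \<and> snd z \<noteq> 0 then grushin_product \<alpha> N l j H G z else 0)" if "z \<in> space M" for z
    using grushin_harmonic_gauge_sphere[OF H(2) G(2), of "fst z" "snd z" \<alpha> k N] that by simp
  have "(\<lambda>z. if fst z \<noteq> 0 \<and> snd z \<noteq> 0 then grushin_product \<alpha> N l j H G z else 0) \<in> borel_measurable M"
    using nonzero_borel by (intro borel_measurable_M measurable_If) auto
  then show "grushin_harmonic \<alpha> k N l j (sphere_restriction H) (sphere_restriction G) \<in> borel_measurable M"
    by (subst measurable_cong[OF eq])
  show "AE z in M. grushin_harmonic \<alpha> k N l j (sphere_restriction H) (sphere_restriction G) z = grushin_product \<alpha> N l j H G z"
    using AE_M_nonzero AE_space
  proof eventually_elim
    case (elim z)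
    then show ?case
      using eq[of z] by (simp only: if_True simp_thms)
  qed
qed

lemma L2_inner_grushin_product:
  fixes H H' :: "'a \<Rightarrow> complex" and G G' :: "'b \<Rightarrow> complex"
  assumes H: "polynomial_function H" "homogeneous l H" and G: "polynomial_function G" "homogeneous j G"
    and H': "polynomial_function H'" "homogeneous l' H'" and G': "polynomial_function G'" "homogeneous j' G'"
  shows "L2_inner M (grushin_product \<alpha> N l j H G) (grushin_product \<alpha> N' l' j' H' G') =
    of_real (LINT \<phi>|A. angular_part \<alpha> DIM('a) DIM('b) N l j \<phi> * angular_part \<alpha> DIM('a) DIM('b) N' l' j' \<phi>)
    * (L2_inner S1 H H' * L2_inner S2 G G')"
proof -
  interpret SS: pair_sigma_finite S1 S2
    by (rule pair_sigma_finite_pairs)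
  interpret AS: pair_sigma_finite A "S1 \<Otimes>\<^sub>M S2"
    by (rule pair_sigma_finite_pairs)
  interpret A: finite_measure A
    by (rule finite_measure_pairs)
  define a where "a \<phi> = angular_part \<alpha> DIM('a) DIM('b) N l j \<phi> * angular_part \<alpha> DIM('a) DIM('b) N' l' j' \<phi>" for \<phi>
  have a_cont: "continuous_on S a" for S
    unfolding a_def by (intro continuous_intros continuous_on_angular_part)
  have a_int: "integrable A (\<lambda>\<phi>. complex_of_real (a \<phi>))"
  proof -
    have "compact (a ` {0..pi/2})"
      by (intro compact_continuous_image a_cont) simp
    then obtain K where bound: "\<forall>z\<in>a ` {0..pi/2}. norm z \<le> K"
      using compact_imp_bounded bounded_iff by metis
    have "(\<lambda>\<phi>. complex_of_real (a \<phi>)) \<in> borel_measurable A"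
      unfolding A_def by (intro borel_measurable_angle_measure borel_measurable_continuous_onI continuous_intros a_cont)
    then show ?thesis
      using bound by (intro A.integrable_const_bound[of _ K]) (auto simp: A_def)
  qed
  have H_int: "integrable S1 (\<lambda>x. H x * cnj (H' x))" and G_int: "integrable S2 (\<lambda>y. G y * cnj (G' y))"
    using H H' G G' unfolding S1_def S2_def by (auto intro!: integrable_sphere_continuous polynomial_function_continuous_on)
  have cont: "continuous_on UNIV (grushin_product \<alpha> N l j H G)" "continuous_on UNIV (grushin_product \<alpha> N' l' j' H' G')"
    using H G H' G' by (auto intro!: continuous_on_grushin_product)
  have "L2_inner M (grushin_product \<alpha> N l j H G) (grushin_product \<alpha> N' l' j' H' G')
      = (LINT w|(A \<Otimes>\<^sub>M (S1 \<Otimes>\<^sub>M S2)). grushin_product \<alpha> N l j H G (gauge_sphere_param \<alpha> w) * cnj (grushin_product \<alpha> N' l' j' H' G' (gauge_sphere_param \<alpha> w)))"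
    unfolding L2_inner_def M_eq_distr
    using cont by (intro integral_distr param_measurable)
      (auto intro!: measurable_restrict_space1 borel_measurable_continuous_onI continuous_intros)
  also have "\<dots> = (LINT w|(A \<Otimes>\<^sub>M (S1 \<Otimes>\<^sub>M S2)). complex_of_real (a (fst w)) *
      (\<lambda>\<omega>. (H (fst \<omega>) * cnj (H' (fst \<omega>))) * (G (snd \<omega>) * cnj (G' (snd \<omega>)))) (snd w))"
  proof (rule Bochner_Integration.integral_cong)
    fix w assume "w \<in> space (A \<Otimes>\<^sub>M (S1 \<Otimes>\<^sub>M S2))"
    then have w: "fst w \<in> {0..pi/2}" "norm (fst (snd w)) = 1"
      by (auto simp: space_pair_measure A_def S1_def S2_def)
    show "grushin_product \<alpha> N l j H G (gauge_sphere_param \<alpha> w) * cnj (grushin_product \<alpha> N' l' j' H' G' (gauge_sphere_param \<alpha> w))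
      = complex_of_real (a (fst w)) * (\<lambda>\<omega>. (H (fst \<omega>) * cnj (H' (fst \<omega>))) * (G (snd \<omega>) * cnj (G' (snd \<omega>)))) (snd w)"
      using grushin_product_param[OF H(2) G(2) w, of \<alpha> N "snd (snd w)"] grushin_product_param[OF H'(2) G'(2) w, of \<alpha> N' "snd (snd w)"]
      by (simp add: a_def)
  qed simp
  also have "\<dots> = (LINT \<phi>|A. complex_of_real (a \<phi>)) * (LINT \<omega>|(S1 \<Otimes>\<^sub>M S2). (H (fst \<omega>) * cnj (H' (fst \<omega>))) * (G (snd \<omega>) * cnj (G' (snd \<omega>))))"
    by (rule AS.integral_pair_mult(2)[OF a_int SS.integral_pair_mult(1)[OF H_int G_int]])
  also have "(LINT \<omega>|(S1 \<Otimes>\<^sub>M S2). (H (fst \<omega>) * cnj (H' (fst \<omega>))) * (G (snd \<omega>) * cnj (G' (snd \<omega>))))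
      = L2_inner S1 H H' * L2_inner S2 G G'"
    unfolding L2_inner_def by (rule SS.integral_pair_mult(2)[OF H_int G_int])
  finally show ?thesis
    unfolding integral_complex_of_real a_def .
qed

section \<open>Density of the products of radial factors and solid harmonics\<close>

lemma L2_dense_of_grushin_products:
  assumes S: "S \<subseteq> L2 M" "csubspace S"
    and prod: "\<And>N l j H G. \<lbrakk>H \<in> solid_harmonics l; G \<in> solid_harmonics j\<rbrakk> \<Longrightarrow> grushin_product \<alpha> N l j H G \<in> L2_closure M S"
  shows "L2 M \<subseteq> L2_closure M S"
proof -
  let ?C = "L2_closure M S"
  have C: "csubspace ?C"
    by (rule csubspace_L2_closure[OF S(2,1)])
  \<comment> \<open>For fixed l and j the Jacobi factors have the exact degrees 0, 1, 2, ..., so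
    every polynomial is a combination of them; dividing by (\<alpha> + 1)^j removes the constant
    built into \<open>grushin_product\<close>.\<close>
  have poly: "(\<lambda>(x, y). of_real (poly q (norm x ^ (2 * (\<alpha> + 1)))) * H x * G y) \<in> ?C"
    if HG: "H \<in> solid_harmonics l" "G \<in> solid_harmonics j" for q l j and H :: "'a \<Rightarrow> complex" and G :: "'b \<Rightarrow> complex"
  proof -
    have nonneg: "(real DIM('a) - 2 + 2 * real l) / (2 * (real \<alpha> + 1)) \<ge> 0" "real j + real DIM('b) / 2 - 1 \<ge> 0"
      using dim by auto
    have "\<exists>p. degree p = N \<and> coeff p N \<noteq> 0 \<and> (\<forall>u. poly p u = jacobi_factor \<alpha> DIM('a) DIM('b) N l j u)" for N
      using jacobi_poly_eq_poly[OF nonneg, of N] unfolding jacobi_factor_def by metis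
    then obtain p where p: "\<And>N. degree (p N) = N" "\<And>N. coeff (p N) N \<noteq> 0"
      "\<And>N u. poly (p N) u = jacobi_factor \<alpha> DIM('a) DIM('b) N l j u"
      by metis
    obtain c where c: "q = (\<Sum>i\<le>degree q. smult (c i) (p i))"
      using poly_eq_sum_of_degree_basis[of p q "degree q"] p by auto
    have q: "poly q u = (\<Sum>i\<le>degree q. c i * jacobi_factor \<alpha> DIM('a) DIM('b) i l j u)" for u
      by (subst c) (simp add: poly_sum p(3))
    have "(\<lambda>z. \<Sum>i\<le>degree q. of_real (c i / (real \<alpha> + 1) ^ j) * grushin_product \<alpha> i l j H G z) \<in> ?C"
      by (intro csubspace_sum csubspace_scale C prod HG)
    moreover have "(\<lambda>z. \<Sum>i\<le>degree q. of_real (c i / (real \<alpha> + 1) ^ j) * grushin_product \<alpha> i l j H G z)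
        = (\<lambda>(x, y). of_real (poly q (norm x ^ (2 * (\<alpha> + 1)))) * H x * G y)"
    proof
      fix z
      have *: "c i / (real \<alpha> + 1) ^ j * ((real \<alpha> + 1) ^ j * u) = c i * u" for i u
        by simp
      show "(\<Sum>i\<le>degree q. of_real (c i / (real \<alpha> + 1) ^ j) * grushin_product \<alpha> i l j H G z)
          = (\<lambda>(x, y). of_real (poly q (norm x ^ (2 * (\<alpha> + 1)))) * H x * G y) z"
        unfolding q grushin_product_def case_prod_beta of_real_sum sum_distrib_right
        by (intro sum.cong refl) (simp only: mult.assoc[symmetric] of_real_mult[symmetric] *[unfolded mult.assoc[symmetric]])
    qed
    ultimately show ?thesis
      by (simp only:)
  qed
  have cont: "(\<lambda>(x, y). of_real (q (norm x ^ (2 * (\<alpha> + 1)))) * H x * G y) \<in> ?C"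
    if HG: "H \<in> solid_harmonics l" "G \<in> solid_harmonics j" and q: "continuous_on UNIV q"
    for q :: "real \<Rightarrow> real" and l j and H :: "'a \<Rightarrow> complex" and G :: "'b \<Rightarrow> complex"
  proof -
    have HG': "continuous_on UNIV H" "continuous_on UNIV G"
      using HG by (auto simp: solid_harmonics_iff)
    have contHG: "continuous_on UNIV (\<lambda>z. H (fst z) * G (snd z))"
      by (intro continuous_intros continuous_on_compose2[OF HG'(1)] continuous_on_compose2[OF HG'(2)]) auto
    have "compact ((\<lambda>z. H (fst z) * G (snd z)) ` gauge_sphere \<alpha>)"
      by (intro compact_continuous_image compact_gauge_sphere continuous_on_subset[OF contHG]) simp
    then obtain B where B: "\<forall>w\<in>(\<lambda>z. H (fst z) * G (snd z)) ` gauge_sphere \<alpha>. norm w \<le> B"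
      using compact_imp_bounded bounded_iff by metis
    \<comment> \<open>The argument |x|^(2(\<alpha> + 1)) ranges over [0, 1], and H(x) G(y) is
      bounded by \<open>B\<close>. A uniform error of 1/(i + 1) for q thus costs at most B/(i + 1)
      on the gauge sphere, and B^2 dominates the squared errors.\<close>
    have "\<exists>r. \<forall>t\<in>{0..1}. \<bar>q t - poly r t\<bar> < inverse (real (Suc i))" for i
    proof -
      obtain g where g: "real_polynomial_function g" "\<And>t. t \<in> {0..1} \<Longrightarrow> \<bar>q t - g t\<bar> < inverse (real (Suc i))"
        using Stone_Weierstrass_real_polynomial_function[of "{0..1}" q "inverse (real (Suc i))"]
          continuous_on_subset[OF q subset_UNIV, of "{0..1}"] by auto
      from g(1) obtain a d where "g = (\<lambda>x. \<Sum>k\<le>d. a k * x ^ k)"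
        using real_polynomial_function_imp_sum by blast
      then have "g t = poly (\<Sum>k\<le>d. monom (a k) k) t" for t
        by (simp add: poly_sum poly_monom)
      with g(2) show ?thesis
        by (intro exI[of _ "\<Sum>k\<le>d. monom (a k) k"]) simp
    qed
    then obtain r where r: "\<And>i t. t \<in> {0..1} \<Longrightarrow> \<bar>q t - poly (r i) t\<bar> < inverse (real (Suc i))"
      by metis
    have u01: "norm x ^ (2 * (\<alpha> + 1)) \<in> {0..1}" if "(x, y) \<in> gauge_sphere \<alpha>" for x :: 'a and y :: 'b
      using gauge_sphere_norm_le(1)[OF that] by (auto intro!: power_le_one simp del: power_Suc mult_Suc_right)
    have diff: "(\<lambda>(x, y). of_real (q (norm x ^ (2 * (\<alpha> + 1)))) * H x * G y) z - (\<lambda>(x, y). of_real (poly (r i) (norm x ^ (2 * (\<alpha> + 1)))) * H x * G y) z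
      = of_real (q (norm (fst z) ^ (2 * (\<alpha> + 1))) - poly (r i) (norm (fst z) ^ (2 * (\<alpha> + 1)))) * (H (fst z) * G (snd z))" for z i
      by (simp only: case_prod_beta of_real_diff left_diff_distrib mult.assoc)
    have le: "cmod ((\<lambda>(x, y). of_real (q (norm x ^ (2 * (\<alpha> + 1)))) * H x * G y) z - (\<lambda>(x, y). of_real (poly (r i) (norm x ^ (2 * (\<alpha> + 1)))) * H x * G y) z)
      \<le> inverse (real (Suc i)) * B" if "z \<in> space M" for z i
      unfolding diff norm_mult[of "of_real _"] norm_of_real
      using that u01[of "fst z" "snd z"] r[of "norm (fst z) ^ (2 * (\<alpha> + 1))" i] B
      by (intro mult_mono) (auto simp del: of_nat_Suc power_Suc mult_Suc_right intro: less_imp_le)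
    show ?thesis
    proof (rule L2_closure_dominated[OF S(1) poly[OF HG, of "r _"]])
      show "(\<lambda>(x, y). of_real (q (norm x ^ (2 * (\<alpha> + 1)))) * H x * G y) \<in> L2 M"
        unfolding case_prod_beta mult.assoc
        by (intro continuous_L2 continuous_on_mult contHG continuous_on_of_real continuous_on_compose2[OF q] continuous_intros) auto
      show "integrable M (\<lambda>z. B\<^sup>2)"
        using finite_measure_M by (rule finite_measure.integrable_const)
      show "(\<lambda>i. (\<lambda>(x, y). of_real (poly (r i) (norm x ^ (2 * (\<alpha> + 1)))) * H x * G y) z) \<longlonglongrightarrow>
          (\<lambda>(x, y). of_real (q (norm x ^ (2 * (\<alpha> + 1)))) * H x * G y) z" if "z \<in> space M" for z
      proof -
        have "(\<lambda>i. inverse (real (Suc i)) * B) \<longlonglongrightarrow> 0"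
          using tendsto_mult_left_zero[OF LIMSEQ_inverse_real_of_nat, of B] by simp
        then show ?thesis
          using le[OF that] by (rule tendsto_of_norm_diff_le)
      qed
      show "(cmod ((\<lambda>(x, y). of_real (q (norm x ^ (2 * (\<alpha> + 1)))) * H x * G y) z - (\<lambda>(x, y). of_real (poly (r i) (norm x ^ (2 * (\<alpha> + 1)))) * H x * G y) z))\<^sup>2 \<le> B\<^sup>2"
        if z: "z \<in> space M" for i z
      proof (rule power_mono)
        have "0 \<le> cmod (H (fst z) * G (snd z))"
          by (rule norm_ge_zero)
        also have "\<dots> \<le> B"
          using B z by auto
        finally have "inverse (real (Suc i)) * B \<le> 1 * B"
          by (intro mult_right_mono) (auto simp: field_simps)
        with le[OF z, of i] show "cmod ((\<lambda>(x, y). of_real (q (norm x ^ (2 * (\<alpha> + 1)))) * H x * G y) z - (\<lambda>(x, y). of_real (poly (r i) (norm x ^ (2 * (\<alpha> + 1)))) * H x * G y) z) \<le> B"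
          by linarith
      qed simp
    qed
  qed
  define gen where "gen i i' H G = (\<lambda>(x, y). norm_sq x ^ i * norm_sq y ^ i' * (H x * G y))"
    for i i' and H :: "'a \<Rightarrow> complex" and G :: "'b \<Rightarrow> complex"
  \<comment> \<open>\<open>D\<close> consists of functions on the whole space, where multiplication
    by coordinates can be computed freely; the equation of the gauge sphere enters only through
    \<open>gen_C\<close>.\<close>
  define D where "D = cspan {gen i i' H G | i i' H G l j. H \<in> solid_harmonics l \<and> G \<in> solid_harmonics j}"
  have gen_C: "gen i i' H G \<in> ?C" if HG: "H \<in> solid_harmonics l" "G \<in> solid_harmonics j" for i i' H G l j
  proof -
    \<comment> \<open>With t = |x|^(2(\<alpha> + 1)), the root is |x|^2 and, on the gauge sphere, (1
      - t) / (\<alpha> + 1)^2 is |y|^2. So q(t) is the factor |x|^(2i) |y|^(2i') of the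
      generator.\<close>
    define q where "q t = root (\<alpha> + 1) t ^ i * ((1 - t) / (real \<alpha> + 1)\<^sup>2) ^ i'" for t
    have q: "continuous_on UNIV q"
      unfolding q_def by (intro continuous_intros) auto
    have meas: "gen i i' H G \<in> borel_measurable M"
    proof -
      have "continuous_on UNIV (norm_sq :: 'a \<Rightarrow> complex)" "continuous_on UNIV (norm_sq :: 'b \<Rightarrow> complex)"
        "continuous_on UNIV H" "continuous_on UNIV G"
        using HG by (auto simp: solid_harmonics_iff)
      then show ?thesis
        unfolding gen_def case_prod_beta
        by (intro borel_measurable_M borel_measurable_continuous_onI continuous_on_mult continuous_on_power)
          (auto elim!: continuous_on_compose2 intro!: continuous_intros)
    qed
    have eq: "gen i i' H G z = (\<lambda>(x, y). of_real (q (norm x ^ (2 * (\<alpha> + 1)))) * H x * G y) z" if z: "z \<in> space M" for z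
    proof -
      obtain x y where xy: "z = (x, y)"
        by (cases z)
      with z have eq: "norm x ^ (2 * (\<alpha> + 1)) + ((real \<alpha> + 1) * norm y)\<^sup>2 = 1"
        by (simp only: space_M gauge_sphere_iff)
      have "root (\<alpha> + 1) (norm x ^ (2 * (\<alpha> + 1))) = (norm x)\<^sup>2"
        by (simp only: power_mult) (simp add: real_root_power_cancel del: power_Suc)
      moreover have "(1 - norm x ^ (2 * (\<alpha> + 1))) / (real \<alpha> + 1)\<^sup>2 = (norm y)\<^sup>2"
      proof -
        have "1 - norm x ^ (2 * (\<alpha> + 1)) = (real \<alpha> + 1)\<^sup>2 * (norm y)\<^sup>2"
          using eq by (simp only: power_mult_distrib[symmetric])
        then show ?thesis
          by (simp del: mult_Suc_right power_Suc)
      qed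
      ultimately show ?thesis
        unfolding xy gen_def case_prod_conv q_def
        by (simp only: norm_sq_def of_real_mult of_real_power mult.assoc)
    qed
    show ?thesis
      by (rule L2_closure_AE_cong[OF S(1) cont[OF HG q] meas AE_I2[OF eq]])
  qed
  have D: "csubspace D"
    unfolding D_def by (rule csubspace_cspan)
  have gen_D: "gen i i' H G \<in> D" if "H \<in> solid_harmonics l" "G \<in> solid_harmonics j" for i i' H G l j
    unfolding D_def using that by (intro cspan_base) blast
  \<comment> \<open>A coordinate times a generator is a sum of two generators, one of which has an
    exponent of |x|^2 or |y|^2 raised by one; this is why the generators carry these powers.
    Products of polynomials are handled one factor at a time, with f arbitrary in the
    induction.\<close>
  have mult_D: "(\<lambda>z. P z * f z) \<in> D" if "polynomial_function P" "f \<in> D" for P f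
    using that
  proof (induction P arbitrary: f rule: polynomial_function_complex_induct)
    case (const c)
    then show ?case
      by (intro csubspace_scale D)
  next
    case (add P Q)
    then show ?case
      using csubspace_add[OF D, of "\<lambda>z. P z * f z" "\<lambda>z. Q z * f z"] by (simp add: distrib_right)
  next
    case (mult P Q)
    then show ?case
      by (simp add: mult.assoc)
  next
    case (coord b)
    have "D \<subseteq> {f. (\<lambda>z. of_real (z \<bullet> b) * f z) \<in> D}"
      unfolding D_def
    proof (intro cspan_minimal, fold D_def)
      show "csubspace {f. (\<lambda>z. complex_of_real (z \<bullet> b) * f z) \<in> D}"
      proof (intro csubspaceI; clarsimp)
        show "(\<lambda>z. 0) \<in> D"
          by (rule csubspace_0[OF D])
      next
        fix f g assume "(\<lambda>z. complex_of_real (z \<bullet> b) * f z) \<in> D" "(\<lambda>z. complex_of_real (z \<bullet> b) * g z) \<in> D"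
        then show "(\<lambda>z. complex_of_real (z \<bullet> b) * (f z + g z)) \<in> D"
          using csubspace_add[OF D] by (simp add: distrib_left)
      next
        fix c f assume "(\<lambda>z. complex_of_real (z \<bullet> b) * f z) \<in> D"
        then show "(\<lambda>z. complex_of_real (z \<bullet> b) * (c * f z)) \<in> D"
          using csubspace_scale[OF D, of _ c] by (simp add: mult.left_commute)
      qed
      show "{gen i i' H G | i i' H G l j. H \<in> solid_harmonics l \<and> G \<in> solid_harmonics j} \<subseteq> {f. (\<lambda>z. complex_of_real (z \<bullet> b) * f z) \<in> D}"
      proof clarify
        fix i i' l j and H :: "'a \<Rightarrow> complex" and G :: "'b \<Rightarrow> complex"
        assume HG: "H \<in> solid_harmonics l" "G \<in> solid_harmonics j"
        from coord.hyps consider u where "u \<in> Basis" "b = (u, 0)" | v where "v \<in> Basis" "b = (0, v)"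
          by (auto simp: Basis_prod_def)
        then show "(\<lambda>z. complex_of_real (z \<bullet> b) * gen i i' H G z) \<in> D"
        proof cases
          case (1 u)
          obtain H1 H2 where H12: "H1 \<in> solid_harmonics (l + 1)" "H2 \<in> solid_harmonics (l - 1)"
            "\<And>x. of_real (x \<bullet> u) * H x = H1 x + norm_sq x * H2 x"
            using coord_mult_solid_harmonic[OF HG(1) 1(1)] by blast
          have "(\<lambda>z. complex_of_real (z \<bullet> b) * gen i i' H G z) = (\<lambda>z. gen i i' H1 G z + gen (Suc i) i' H2 G z)"
          proof
            fix z :: "'a \<times> 'b"
            have "complex_of_real (z \<bullet> b) * gen i i' H G z = norm_sq (fst z) ^ i * norm_sq (snd z) ^ i' * ((of_real (fst z \<bullet> u) * H (fst z)) * G (snd z))"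
              by (simp add: 1 gen_def case_prod_beta inner_prod_def mult_ac)
            then show "complex_of_real (z \<bullet> b) * gen i i' H G z = gen i i' H1 G z + gen (Suc i) i' H2 G z"
              unfolding H12(3) by (simp add: gen_def case_prod_beta algebra_simps)
          qed
          then show ?thesis
            using csubspace_add[OF D gen_D[OF H12(1) HG(2)] gen_D[OF H12(2) HG(2)]] by simp
        next
          case (2 v)
          obtain G1 G2 where G12: "G1 \<in> solid_harmonics (j + 1)" "G2 \<in> solid_harmonics (j - 1)"
            "\<And>x. of_real (x \<bullet> v) * G x = G1 x + norm_sq x * G2 x"
            using coord_mult_solid_harmonic[OF HG(2) 2(1)] by blast
          have "(\<lambda>z. complex_of_real (z \<bullet> b) * gen i i' H G z) = (\<lambda>z. gen i i' H G1 z + gen i (Suc i') H G2 z)"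
          proof
            fix z :: "'a \<times> 'b"
            have "complex_of_real (z \<bullet> b) * gen i i' H G z = norm_sq (fst z) ^ i * norm_sq (snd z) ^ i' * (H (fst z) * (of_real (snd z \<bullet> v) * G (snd z)))"
              by (simp add: 2 gen_def case_prod_beta inner_prod_def mult_ac)
            then show "complex_of_real (z \<bullet> b) * gen i i' H G z = gen i i' H G1 z + gen i (Suc i') H G2 z"
              unfolding G12(3) by (simp add: gen_def case_prod_beta algebra_simps)
          qed
          then show ?thesis
            using csubspace_add[OF D gen_D[OF HG(1) G12(1)] gen_D[OF HG(1) G12(2)]] by simp
        qed
      qed
    qed
    with coord show ?case
      by blast
  qed
  have "(\<lambda>z. 1) \<in> D"
  proof -
    have one: "(\<lambda>x. 1) \<in> solid_harmonics 0"
      by (simp add: solid_harmonics_iff homogeneous_def laplacian_def)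
    have "gen 0 0 (\<lambda>x. 1) (\<lambda>y. 1) = (\<lambda>z. 1)"
      by (simp add: gen_def fun_eq_iff)
    then show ?thesis
      using gen_D[OF one one, of 0 0] by simp
  qed
  then have "P \<in> D" if "polynomial_function P" for P
    using mult_D[OF that, of "\<lambda>z. 1"] by simp
  moreover have "D \<subseteq> ?C"
    unfolding D_def using gen_C by (intro cspan_minimal C) blast
  ultimately have poly_C: "P \<in> ?C" if "polynomial_function P" for P
    using that by blast
  have sphere_borel: "gauge_sphere \<alpha> \<in> sets (borel :: ('a \<times> 'b) measure)"
    using compact_gauge_sphere by (intro borel_closed compact_imp_closed)
  show ?thesis
  proof (rule L2_closure_of_continuous[OF finite_measure_M sets_M sphere_borel S])
    fix f :: "'a \<times> 'b \<Rightarrow> complex" assume f: "continuous_on UNIV f"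
    have "\<exists>P. polynomial_function P \<and> (\<forall>z\<in>gauge_sphere \<alpha>. norm (f z - P z) < inverse (real (Suc i)))" for i
      by (rule Stone_Weierstrass_polynomial_function[OF compact_gauge_sphere continuous_on_subset[OF f subset_UNIV]]) simp
    then obtain P where P: "\<And>i. polynomial_function (P i)" "\<And>i z. z \<in> gauge_sphere \<alpha> \<Longrightarrow> norm (f z - P i z) < inverse (real (Suc i))"
      by metis
    show "f \<in> ?C"
    proof (rule L2_closure_dominated[OF S(1) poly_C[OF P(1)] continuous_L2[OF f]])
      show "integrable M (\<lambda>z. 1 :: real)"
        using finite_measure_M by (rule finite_measure.integrable_const)
      show "(\<lambda>i. P i z) \<longlonglongrightarrow> f z" if "z \<in> space M" for z
        using P(2)[of z] that by (intro tendsto_of_norm_diff_le[OF LIMSEQ_inverse_real_of_nat] less_imp_le) simp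
      show "(cmod (f z - P i z))\<^sup>2 \<le> 1" if "z \<in> space M" for i z
      proof -
        have "inverse (real (Suc i)) \<le> 1"
          by (simp add: field_simps)
        with P(2)[of z i] that have "cmod (f z - P i z) \<le> 1"
          by simp
        then show ?thesis
          by (simp add: power_le_one)
      qed
    qed
  qed
qed

end

section \<open>Degrees, change of basis and the final decomposition\<close>

lemma jacobi_index_eq_iff: "jacobi_index \<alpha> k l j = real N \<longleftrightarrow> k = l + j * (\<alpha> + 1) + 2 * (\<alpha> + 1) * N"
proof -
  have "jacobi_index \<alpha> k l j = real N \<longleftrightarrow> real k = real (l + j * (\<alpha> + 1) + 2 * (\<alpha> + 1) * N)"
  proof -
    have nz: "2 * (real \<alpha> + 1) \<noteq> 0"
      by simp
    have "jacobi_index \<alpha> k l j = real N \<longleftrightarrow> real k - real l - real j * (real \<alpha> + 1) = real N * (2 * (real \<alpha> + 1))"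
      by (simp only: jacobi_index_def nonzero_divide_eq_eq[OF nz])
    also have "\<dots> \<longleftrightarrow> real k = real (l + j * (\<alpha> + 1) + 2 * (\<alpha> + 1) * N)"
      by (auto simp: algebra_simps)
    finally show ?thesis .
  qed
  then show ?thesis
    by (simp only: of_nat_eq_iff)
qed

text \<open>Linearity in the spherical factor: what holds for the given basis functions extends to
  all spherical harmonics of that degree.\<close>

lemma csubspace_grushin_harmonic_left:
  fixes V :: "('a::euclidean_space \<times> 'b::euclidean_space \<Rightarrow> complex) set"
  assumes "csubspace V"
  shows "csubspace {y. grushin_harmonic \<alpha> k N l j y z \<in> V}"
proof (intro csubspaceI CollectI)
  have "grushin_harmonic \<alpha> k N l j (\<lambda>x :: 'a. 0) z = (\<lambda>w. 0)"
    by (auto simp: grushin_harmonic_def fun_eq_iff)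
  then show "grushin_harmonic \<alpha> k N l j (\<lambda>x. 0) z \<in> V"
    using csubspace_0[OF assms] by simp
next
  fix f g assume fg: "f \<in> {y. grushin_harmonic \<alpha> k N l j y z \<in> V}" "g \<in> {y. grushin_harmonic \<alpha> k N l j y z \<in> V}"
  have "grushin_harmonic \<alpha> k N l j (\<lambda>x. f x + g x) z
      = (\<lambda>w. grushin_harmonic \<alpha> k N l j f z w + grushin_harmonic \<alpha> k N l j g z w)"
    by (auto simp: grushin_harmonic_def fun_eq_iff algebra_simps)
  then show "grushin_harmonic \<alpha> k N l j (\<lambda>x. f x + g x) z \<in> V"
    using csubspace_add[OF assms] fg by simp
next
  fix c f assume f: "f \<in> {y. grushin_harmonic \<alpha> k N l j y z \<in> V}"
  have "grushin_harmonic \<alpha> k N l j (\<lambda>x. c * f x) z = (\<lambda>w. c * grushin_harmonic \<alpha> k N l j f z w)"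
    by (auto simp: grushin_harmonic_def fun_eq_iff)
  then show "grushin_harmonic \<alpha> k N l j (\<lambda>x. c * f x) z \<in> V"
    using csubspace_scale[OF assms] f by simp
qed

lemma csubspace_grushin_harmonic_right:
  fixes V :: "('a::euclidean_space \<times> 'b::euclidean_space \<Rightarrow> complex) set"
  assumes "csubspace V"
  shows "csubspace {z. grushin_harmonic \<alpha> k N l j y z \<in> V}"
proof (intro csubspaceI CollectI)
  have "grushin_harmonic \<alpha> k N l j y (\<lambda>x :: 'b. 0) = (\<lambda>w. 0)"
    by (auto simp: grushin_harmonic_def fun_eq_iff)
  then show "grushin_harmonic \<alpha> k N l j y (\<lambda>x. 0) \<in> V"
    using csubspace_0[OF assms] by simp
next
  fix f g assume fg: "f \<in> {z. grushin_harmonic \<alpha> k N l j y z \<in> V}" "g \<in> {z. grushin_harmonic \<alpha> k N l j y z \<in> V}"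
  have "grushin_harmonic \<alpha> k N l j y (\<lambda>x. f x + g x)
      = (\<lambda>w. grushin_harmonic \<alpha> k N l j y f w + grushin_harmonic \<alpha> k N l j y g w)"
    by (auto simp: grushin_harmonic_def fun_eq_iff algebra_simps)
  then show "grushin_harmonic \<alpha> k N l j y (\<lambda>x. f x + g x) \<in> V"
    using csubspace_add[OF assms] fg by simp
next
  fix c f assume f: "f \<in> {z. grushin_harmonic \<alpha> k N l j y z \<in> V}"
  have "grushin_harmonic \<alpha> k N l j y (\<lambda>x. c * f x) = (\<lambda>w. c * grushin_harmonic \<alpha> k N l j y f w)"
    by (auto simp: grushin_harmonic_def fun_eq_iff)
  then show "grushin_harmonic \<alpha> k N l j y (\<lambda>x. c * f x) \<in> V"
    using csubspace_scale[OF assms] f by simp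
qed

lemma L2_inner_AE_cong:
  assumes "f \<in> borel_measurable M" "f' \<in> borel_measurable M" "g \<in> borel_measurable M" "g' \<in> borel_measurable M"
    and "AE x in M. f x = f' x" "AE x in M. g x = g' x"
  shows "L2_inner M f g = L2_inner M f' g'"
  unfolding L2_inner_def
proof (rule integral_cong_AE)
  have cnj: "(\<lambda>x. cnj (u x)) \<in> borel_measurable M" if "u \<in> borel_measurable M" for u :: "'a \<Rightarrow> complex"
    by (rule measurable_compose[OF that borel_measurable_continuous_onI]) (auto intro: continuous_intros)
  show "(\<lambda>x. f x * cnj (g x)) \<in> borel_measurable M" "(\<lambda>x. f' x * cnj (g' x)) \<in> borel_measurable M"
    using assms by (auto intro!: borel_measurable_times cnj)
  show "AE x in M. f x * cnj (g x) = f' x * cnj (g' x)"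
    using assms(5,6) by eventually_elim simp
qed

lemma L2_inner_sphere_restriction:
  "L2_inner sphere_measure (sphere_restriction H) (sphere_restriction H') = L2_inner sphere_measure H H'"
  unfolding L2_inner_def by (rule Bochner_Integration.integral_cong) auto

text \<open>For equal degrees this is the orthonormality of the given basis. For different degrees
  it is the bilinear statement, applied to H and to the conjugate of H', again a solid
  harmonic.\<close>

lemma L2_inner_solid_harmonics:
  fixes e :: "nat \<Rightarrow> nat \<Rightarrow> 'a::euclidean_space \<Rightarrow> complex"
  assumes e: "\<And>l. harmonic_orthonormal_basis l (e l)" and "DIM('a) \<ge> 2"
    and H: "H \<in> solid_harmonics l" "e l p = sphere_restriction H" "p \<in> {1..harmonic_dim TYPE('a) l}"
    and H': "H' \<in> solid_harmonics l'" "e l' p' = sphere_restriction H'" "p' \<in> {1..harmonic_dim TYPE('a) l'}"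
    and "(l, p) \<noteq> (l', p')"
  shows "L2_inner sphere_measure H H' = 0"
proof (cases "l = l'")
  case True
  then have "L2_inner sphere_measure (e l p) (e l p') = 0"
    using e[of l] H(3) H'(3) assms(9) unfolding harmonic_orthonormal_basis_def Let_def by auto
  then show ?thesis
    using True H(2) H'(2) L2_inner_sphere_restriction[of H H'] by (simp only:)
next
  case False
  then show ?thesis
    unfolding L2_inner_def using assms(2) H(1) H'(1)
    by (intro integral_sphere_solid_harmonics_mult solid_harmonics_cnj)
qed

context gauge_sphere_setting
begin

theorem L2_orthogonal_sum_grushin_harmonics:
  fixes Y :: "nat \<Rightarrow> nat \<Rightarrow> 'a \<Rightarrow> complex" and Z :: "nat \<Rightarrow> nat \<Rightarrow> 'b \<Rightarrow> complex"
  assumes Y: "\<And>l. harmonic_orthonormal_basis l (Y l)" and Z: "\<And>j. harmonic_orthonormal_basis j (Z j)"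
  shows "L2_orthogonal_sum M (grushin_harmonics \<alpha> Y Z)"
proof -
  let ?V = "grushin_harmonics \<alpha> Y Z"
  let ?P = "\<lambda>l. {1..harmonic_dim TYPE('a) l}" and ?Q = "\<lambda>j. {1..harmonic_dim TYPE('b) j}"
  have Y_span: "cspan (Y l ` ?P l) = spherical_harmonics l" and Z_span: "cspan (Z j ` ?Q j) = spherical_harmonics j" for l j
    using Y[of l] Z[of j] by (simp_all add: harmonic_orthonormal_basis_def Let_def)
  have HY_ex: "\<exists>H. H \<in> solid_harmonics l \<and> Y l p = sphere_restriction H" if "p \<in> ?P l" for l p
    using cspan_base[of "Y l p" "Y l ` ?P l"] that unfolding Y_span spherical_harmonics_def by blast
  \<comment> \<open>The basis functions are given on the sphere and extended by 0; polynomial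
    representatives are chosen for them.\<close>
  define HY where "HY l p = (SOME H. H \<in> solid_harmonics l \<and> Y l p = sphere_restriction H)" for l p
  have HY: "HY l p \<in> solid_harmonics l \<and> Y l p = sphere_restriction (HY l p)" if "p \<in> ?P l" for l p
    unfolding HY_def by (rule someI_ex[OF HY_ex[OF that]])
  have GZ_ex: "\<exists>G. G \<in> solid_harmonics j \<and> Z j q = sphere_restriction G" if "q \<in> ?Q j" for j q
    using cspan_base[of "Z j q" "Z j ` ?Q j"] that unfolding Z_span spherical_harmonics_def by blast
  define GZ where "GZ j q = (SOME G. G \<in> solid_harmonics j \<and> Z j q = sphere_restriction G)" for j q
  have GZ: "GZ j q \<in> solid_harmonics j \<and> Z j q = sphere_restriction (GZ j q)" if "q \<in> ?Q j" for j q
    unfolding GZ_def by (rule someI_ex[OF GZ_ex[OF that]])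
  define I where "I k = {(N, l, j, p, q). l \<le> k \<and> j \<le> k \<and> jacobi_index \<alpha> k l j = real N \<and> p \<in> ?P l \<and> q \<in> ?Q j}" for k
  define g where "g k = (\<lambda>(N, l, j, p, q). grushin_harmonic \<alpha> k N l j (Y l p) (Z j q))" for k
  have V: "?V k = cspan (g k ` I k)" for k
  proof -
    have "{grushin_harmonic \<alpha> k N l j (Y l p) (Z j q) | N l j p q.
        l \<le> k \<and> j \<le> k \<and> jacobi_index \<alpha> k l j = real N \<and> p \<in> ?P l \<and> q \<in> ?Q j} = g k ` I k" (is "?W = _")
    proof (intro equalityI subsetI)
      fix f assume "f \<in> ?W"
      then obtain N l j p q where f: "f = grushin_harmonic \<alpha> k N l j (Y l p) (Z j q)"
        and i: "l \<le> k \<and> j \<le> k \<and> jacobi_index \<alpha> k l j = real N \<and> p \<in> ?P l \<and> q \<in> ?Q j"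
        by blast
      have "f = g k (N, l, j, p, q)"
        by (simp only: f g_def case_prod_conv)
      moreover have "(N, l, j, p, q) \<in> I k"
        unfolding I_def mem_Collect_eq case_prod_conv by (rule i)
      ultimately show "f \<in> g k ` I k"
        by (rule image_eqI)
    next
      fix f assume "f \<in> g k ` I k"
      then obtain i where i: "f = g k i" "i \<in> I k"
        by blast
      obtain N l j p q where i_eq: "i = (N, l, j, p, q)"
        by (metis prod_cases5)
      show "f \<in> ?W"
        using i unfolding i_eq g_def I_def mem_Collect_eq case_prod_conv by blast
    qed
    then show ?thesis
      by (simp only: grushin_harmonics_def)
  qed
  have harmonic: "grushin_harmonic \<alpha> k N l j (Y l p) (Z j q) \<in> borel_measurable M"
    "AE z in M. grushin_harmonic \<alpha> k N l j (Y l p) (Z j q) z = grushin_product \<alpha> N l j (HY l p) (GZ j q) z"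
    if "p \<in> ?P l" "q \<in> ?Q j" for k N l j p q
    using grushin_harmonic_L2_AE[of "HY l p" l "GZ j q" j k N] HY[OF that(1)] GZ[OF that(2)]
    by (simp_all only: solid_harmonics_iff)
  have product_L2: "grushin_product \<alpha> N l j H G \<in> L2 M" if "H \<in> solid_harmonics l" "G \<in> solid_harmonics j" for N l j H G
    using that by (intro continuous_L2 continuous_on_grushin_product) (auto simp: solid_harmonics_iff)
  have harmonic_L2: "grushin_harmonic \<alpha> k N l j (Y l p) (Z j q) \<in> L2 M" if "p \<in> ?P l" "q \<in> ?Q j" for k N l j p q
    using L2_AE_cong[OF product_L2 harmonic[OF that]] HY[OF that(1)] GZ[OF that(2)] by blast
  have g_L2: "g k i \<in> L2 M" if "i \<in> I k" for k i
    using that harmonic_L2 by (auto simp: g_def I_def)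
  have V_L2: "?V k \<subseteq> L2 M" for k
    unfolding V using g_L2 by (intro cspan_minimal csubspace_L2) auto
  show ?thesis
  proof (rule L2_orthogonal_sumI[OF _ V g_L2])
    \<comment> \<open>The equation k = l + j (\<alpha> + 1) + 2 (\<alpha> + 1) N bounds N by k
      too.\<close>
    show "finite (I k)" for k
    proof (rule finite_subset)
      show "I k \<subseteq> (\<Union>l\<in>{..k}. \<Union>j\<in>{..k}. {..k} \<times> {l} \<times> {j} \<times> ?P l \<times> ?Q j)"
        unfolding I_def jacobi_index_eq_iff by auto
    qed auto
  next
    fix k k' i i' assume i: "i \<in> I k" and i': "i' \<in> I k'" and ne: "(k, i) \<noteq> (k', i')"
    obtain N l j p q where i_eq: "i = (N, l, j, p, q)"
      by (metis prod_cases5)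
    obtain N' l' j' p' q' where i'_eq: "i' = (N', l', j', p', q')"
      by (metis prod_cases5)
    have pq: "p \<in> ?P l" "q \<in> ?Q j" "p' \<in> ?P l'" "q' \<in> ?Q j'"
      and k: "k = l + j * (\<alpha> + 1) + 2 * (\<alpha> + 1) * N" "k' = l' + j' * (\<alpha> + 1) + 2 * (\<alpha> + 1) * N'"
      using i i' unfolding I_def i_eq i'_eq jacobi_index_eq_iff by auto
    note H = HY[OF pq(1)] HY[OF pq(3)] and G = GZ[OF pq(2)] GZ[OF pq(4)]
    have "L2_inner M (g k i) (g k' i')
        = L2_inner M (grushin_product \<alpha> N l j (HY l p) (GZ j q)) (grushin_product \<alpha> N' l' j' (HY l' p') (GZ j' q'))"
      unfolding g_def i_eq i'_eq case_prod_conv using H G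
      by (intro L2_inner_AE_cong harmonic pq L2_measurable product_L2) auto
    also have "\<dots> = of_real (LINT \<phi>|A. angular_part \<alpha> DIM('a) DIM('b) N l j \<phi> * angular_part \<alpha> DIM('a) DIM('b) N' l' j' \<phi>)
        * (L2_inner S1 (HY l p) (HY l' p') * L2_inner S2 (GZ j q) (GZ j' q'))"
      using H G by (intro L2_inner_grushin_product) (auto simp: solid_harmonics_iff)
    also have "\<dots> = 0"
    proof (cases "(l, p) = (l', p') \<and> (j, q) = (j', q')")
      case True
      \<comment> \<open>If N and N' agreed, the formula for the degree would give k = k', and the
        two indices would coincide.\<close>
      with ne k have "N \<noteq> N'"
        by (auto simp: i_eq i'_eq)
      with True show ?thesis
        using angular_part_orthogonal[OF dim, of N N' \<alpha> l j] by (simp add: A_def)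
    next
      case False
      then have "L2_inner S1 (HY l p) (HY l' p') = 0 \<or> L2_inner S2 (GZ j q) (GZ j' q') = 0"
        using L2_inner_solid_harmonics[OF Y dim(1), of "HY l p" l p "HY l' p'" l' p'] H pq
          L2_inner_solid_harmonics[OF Z dim(2), of "GZ j q" j q "GZ j' q'" j' q'] G
        unfolding S1_def S2_def by blast
      then show ?thesis
        by auto
    qed
    finally show "L2_inner M (g k i) (g k' i') = 0" .
  next
    show "L2 M \<subseteq> L2_closure M (cspan (\<Union>k. ?V k))"
    proof (rule L2_dense_of_grushin_products)
      show S: "cspan (\<Union>k. ?V k) \<subseteq> L2 M"
        using V_L2 by (intro cspan_minimal csubspace_L2) auto
      show "csubspace (cspan (\<Union>k. ?V k))"
        by (rule csubspace_cspan)
      fix N l j and H :: "'a \<Rightarrow> complex" and G :: "'b \<Rightarrow> complex"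
      assume HG: "H \<in> solid_harmonics l" "G \<in> solid_harmonics j"
      \<comment> \<open>The only degree in which the triple (N, l, j) occurs; the conditions l <= k
        and j <= k then hold by themselves.\<close>
      define k where "k = l + j * (\<alpha> + 1) + 2 * (\<alpha> + 1) * N"
      have index: "jacobi_index \<alpha> k l j = real N" "l \<le> k" "j \<le> k"
        unfolding jacobi_index_eq_iff by (auto simp: k_def)
      have sub: "csubspace (?V k)"
        unfolding V by (rule csubspace_cspan)
      have basis: "grushin_harmonic \<alpha> k N l j (Y l p) (Z j q) \<in> ?V k" if "p \<in> ?P l" "q \<in> ?Q j" for p q
        unfolding grushin_harmonics_def using that index by (intro cspan_base) blast
      \<comment> \<open>The bases are replaced one factor at a time: an arbitrary harmonic in x
        against a basis function in y, then that harmonic against an arbitrary one in y.\<close>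
      have left: "spherical_harmonics l \<subseteq> {y. grushin_harmonic \<alpha> k N l j y (Z j q) \<in> ?V k}" if "q \<in> ?Q j" for q
        unfolding Y_span[symmetric] using basis that by (intro cspan_minimal csubspace_grushin_harmonic_left sub) auto
      have "sphere_restriction H \<in> spherical_harmonics l" "sphere_restriction G \<in> spherical_harmonics j"
        using HG unfolding spherical_harmonics_def by blast+
      moreover from this have "spherical_harmonics j \<subseteq> {z. grushin_harmonic \<alpha> k N l j (sphere_restriction H) z \<in> ?V k}"
        unfolding Z_span[symmetric] using left by (intro cspan_minimal csubspace_grushin_harmonic_right sub) blast+
      ultimately have "grushin_harmonic \<alpha> k N l j (sphere_restriction H) (sphere_restriction G) \<in> ?V k"
        by blast
      then have "grushin_harmonic \<alpha> k N l j (sphere_restriction H) (sphere_restriction G) \<in> L2_closure M (cspan (\<Union>k. ?V k))"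
        using L2_closure_superset[OF S] cspan_base[of _ "\<Union>k. ?V k"] by blast
      then show "grushin_product \<alpha> N l j H G \<in> L2_closure M (cspan (\<Union>k. ?V k))"
      proof (rule L2_closure_AE_cong[OF S])
        show "grushin_product \<alpha> N l j H G \<in> borel_measurable M"
          by (intro L2_measurable product_L2 HG)
        show "AE z in M. grushin_product \<alpha> N l j H G z = grushin_harmonic \<alpha> k N l j (sphere_restriction H) (sphere_restriction G) z"
          using grushin_harmonic_L2_AE(2)[of H l G j k N] HG unfolding solid_harmonics_iff
          by (auto elim: AE_mp)
      qed
    qed
  qed
qed

end

theorem theorem3p6:
  fixes \<alpha> :: nat
    and Y :: "nat \<Rightarrow> nat \<Rightarrow> real ^ 'n \<Rightarrow> complex"
    and Z :: "nat \<Rightarrow> nat \<Rightarrow> real ^ 'm \<Rightarrow> complex"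
  assumes "CARD('n) \<ge> 2" and "CARD('m) \<ge> 2"
    and "\<And>l. harmonic_orthonormal_basis l (Y l)"
    and "\<And>j. harmonic_orthonormal_basis j (Z j)"
  shows "L2_orthogonal_sum
           (gauge_sphere_measure \<alpha> :: ((real ^ 'n) \<times> (real ^ 'm)) measure)
           (grushin_harmonics \<alpha> Y Z)"
proof -
  interpret gauge_sphere_setting \<alpha> "gauge_sphere_measure \<alpha> :: ((real ^ 'n) \<times> (real ^ 'm)) measure"
    "angle_measure \<alpha> DIM(real ^ 'n) DIM(real ^ 'm)" sphere_measure sphere_measure
    using assms(1,2) by unfold_locales simp_all
  show ?thesis
    using assms(3,4) by (rule L2_orthogonal_sum_grushin_harmonics)
qed

end
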